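(* (1) Let $R$ be a ring with local units and let $u_i\colon P_i\to Q_i$, $i\in I$, be a set of right $R$-module maps between fgp right $R$-modules. Then the Cohn localisation of $R$ at $\{u_i : i\in I\}$ exists and is unique up to isomorphism. (2) Let $P$ be a monoid and let $\mathcal F=(P,F_p,\mu_{p,q})$ be a diagram of rings and proper bimodules of shape $P$. Then $\mathcal F$ has a covariance ring.
   Context: Rings are associative, not necessarily unital. A ring $R$ has local units if for every finite subset $F\subseteq R$ there is an idempotent $e\in R$ with $er=r=re$ for all $r\in F$. A left module $M$ over a ring with local units is smooth if the multiplication map $R\otimes_R M\to M$ is an isomorphism (equivalently surjective); similarly for right modules and bimodules (both sides). A smooth right module is fgp if it is finitely generated (spanned as a right module by finitely many elements) and projective (every surjective module homomorphism onto it splits). A smooth $R,S$-bimodule $M$ is proper if $eM$ is an fgp right $S$-module for every idempotent $e\in R$. A ring homomorphism $f\colon A\to B$ between rings with local units is nondegenerate if $f(A)B=B$, that is, if $A\otimes_A B\to B$ is an isomorphism. **Cohn localisation.** The Cohn localisation of $R$ at $\{u_i\}$ is a ring $R'$ with local units with a nondegenerate homomorphism $R\to R'$ such that $u_i\otimes_R\mathrm{id}_{R'}\colon P_i\otimes_R R'\to Q_i\otimes_R R'$ is invertible for all $i\in I$, and which is universal: if $D$ is a ring with local units and $f\colon R\to D$ is a nondegenerate homomorphism, then $f$ factors through $R\to R'$ if and only if $u_i\otimes_R\mathrm{id}_D$ is invertible for all $i\in I$, and the factorisation is unique if it exists. **Diagrams.** A diagram of rings and proper bimodules of shape $P$ (unit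 $1\in P$) consists of a ring $F_1$ with local units, smooth proper $F_1,F_1$-bimodules $F_p$ for $p\in P$ (for $p=1$, the bimodule $F_1$), and $F_1,F_1$-bimodule isomorphisms $\mu_{p,q}\colon F_p\otimes_{F_1}F_q\to F_{pq}$ such that $\mu_{1,q},\mu_{q,1}$ are the canonical multiplication isomorphisms and $\mu_{pq,t}\circ(\mu_{p,q}\otimes\mathrm{id})=\mu_{p,qt}\circ(\mathrm{id}\otimes\mu_{q,t})$ for all $p,q,t\in P$. **Covariance ring.** A covariant representation of $\mathcal F$ in a ring $D$ with local units is a family of additive maps $\tilde\nu_p\colon F_p\to D$, $p\in P$, with $\tilde\nu_p(x)\tilde\nu_q(y)=\tilde\nu_{pq}(\mu_{p,q}(x\otimes y))$ for all $p,q\in P$, $x\in F_p$, $y\in F_q$, such that the maps $\nu_p\colon F_p\otimes_{F_1}D\to D$, $x\otimes d\mapsto\tilde\nu_p(x)d$, are isomorphisms for all $p\in P$. Sending $D$ to the set of covariant representations of $\mathcal F$ in $D$ is a functor (by composition) from the category of rings with local units and nondegenerate homomorphisms to sets; a covariance ring of $\mathcal F$ is a ring with local units representing this functor. *)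

theory Defs
  imports "HOL-Algebra.Free_Abelian_Groups" "HOL-Algebra.AbelCoset"
begin

section \<open>Rings with local units\<close>

text \<open>
  The locale \<^locale>\<open>ring\<close> of HOL-Algebra is unital. Here the record type of HOL-Algebra is
  reused, but its field \<^const>\<open>one\<close> is never mentioned in any axiom.
\<close>

locale rng = abelian_group R for R (structure) +
  assumes m_closed: "\<lbrakk>x \<in> carrier R; y \<in> carrier R\<rbrakk> \<Longrightarrow> x \<otimes> y \<in> carrier R"
    and m_assoc: "\<lbrakk>x \<in> carrier R; y \<in> carrier R; z \<in> carrier R\<rbrakk>
      \<Longrightarrow> (x \<otimes> y) \<otimes> z = x \<otimes> (y \<otimes> z)"
    and l_distr: "\<lbrakk>x \<in> carrier R; y \<in> carrier R; z \<in> carrier R\<rbrakk>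
      \<Longrightarrow> (x \<oplus> y) \<otimes> z = x \<otimes> z \<oplus> y \<otimes> z"
    and r_distr: "\<lbrakk>x \<in> carrier R; y \<in> carrier R; z \<in> carrier R\<rbrakk>
      \<Longrightarrow> x \<otimes> (y \<oplus> z) = x \<otimes> y \<oplus> x \<otimes> z"

locale lu_ring = rng +
  assumes local_units: "\<lbrakk>finite F; F \<subseteq> carrier R\<rbrakk>
    \<Longrightarrow> \<exists>e\<in>carrier R. e \<otimes> e = e \<and> (\<forall>r\<in>F. e \<otimes> r = r \<and> r \<otimes> e = r)"

text \<open>
  Homomorphisms are taken to be undefined outside the carrier, so that two homomorphisms are equal
  as morphisms if and only if they are equal as HOL functions.
\<close>

definition rng_hom :: "'a ring \<Rightarrow> 'b ring \<Rightarrow> ('a \<Rightarrow> 'b) set" where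
  "rng_hom A B = {f \<in> carrier A \<rightarrow>\<^sub>E carrier B. \<forall>x\<in>carrier A. \<forall>y\<in>carrier A.
     f (x \<oplus>\<^bsub>A\<^esub> y) = f x \<oplus>\<^bsub>B\<^esub> f y \<and> f (x \<otimes>\<^bsub>A\<^esub> y) = f x \<otimes>\<^bsub>B\<^esub> f y}"

definition rng_iso :: "'a ring \<Rightarrow> 'b ring \<Rightarrow> ('a \<Rightarrow> 'b) set" where
  "rng_iso A B = {f \<in> rng_hom A B. bij_betw f (carrier A) (carrier B)}"

text \<open>Nondegenerate homomorphisms: \<open>f(A)B\<close>, the additive span of all \<open>f(a)b\<close>, is \<open>B\<close>.\<close>

definition nd_hom :: "'a ring \<Rightarrow> 'b ring \<Rightarrow> ('a \<Rightarrow> 'b) set" where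
  "nd_hom A B = {f \<in> rng_hom A B.
     generate (add_monoid B) {f a \<otimes>\<^bsub>B\<^esub> b | a b. a \<in> carrier A \<and> b \<in> carrier B} = carrier B}"


section \<open>Modules and bimodules\<close>

text \<open>
  As for \<open>module\<close> in HOL-Algebra, the module records extend the ring record; its fields
  \<^const>\<open>mult\<close> and \<^const>\<open>one\<close> are unused. A bimodule record is in particular a right module
  record, namely over the right acting ring.
\<close>

record ('r, 'm) rmod = "'m ring" +
  ract :: "'m \<Rightarrow> 'r \<Rightarrow> 'm"

record ('l, 'r, 'm) bimod = "('r, 'm) rmod" +
  lact :: "'l \<Rightarrow> 'm \<Rightarrow> 'm"

locale right_module = R: rng R + M: abelian_group M
  for R :: "'r ring" and M :: "('r, 'm, 'z) rmod_scheme" +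
  assumes ract_closed: "\<lbrakk>x \<in> carrier M; r \<in> carrier R\<rbrakk> \<Longrightarrow> ract M x r \<in> carrier M"
    and ract_add_left: "\<lbrakk>x \<in> carrier M; y \<in> carrier M; r \<in> carrier R\<rbrakk>
      \<Longrightarrow> ract M (x \<oplus>\<^bsub>M\<^esub> y) r = ract M x r \<oplus>\<^bsub>M\<^esub> ract M y r"
    and ract_add_right: "\<lbrakk>x \<in> carrier M; r \<in> carrier R; s \<in> carrier R\<rbrakk>
      \<Longrightarrow> ract M x (r \<oplus>\<^bsub>R\<^esub> s) = ract M x r \<oplus>\<^bsub>M\<^esub> ract M x s"
    and ract_assoc: "\<lbrakk>x \<in> carrier M; r \<in> carrier R; s \<in> carrier R\<rbrakk>
      \<Longrightarrow> ract M x (r \<otimes>\<^bsub>R\<^esub> s) = ract M (ract M x r) s"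

locale bimodule = right_module S M + L: rng R
  for R :: "'l ring" and S :: "'r ring" and M :: "('l, 'r, 'm, 'z) bimod_scheme" +
  assumes lact_closed: "\<lbrakk>r \<in> carrier R; x \<in> carrier M\<rbrakk> \<Longrightarrow> lact M r x \<in> carrier M"
    and lact_add_right: "\<lbrakk>r \<in> carrier R; x \<in> carrier M; y \<in> carrier M\<rbrakk>
      \<Longrightarrow> lact M r (x \<oplus>\<^bsub>M\<^esub> y) = lact M r x \<oplus>\<^bsub>M\<^esub> lact M r y"
    and lact_add_left: "\<lbrakk>r \<in> carrier R; s \<in> carrier R; x \<in> carrier M\<rbrakk>
      \<Longrightarrow> lact M (r \<oplus>\<^bsub>R\<^esub> s) x = lact M r x \<oplus>\<^bsub>M\<^esub> lact M s x"
    and lact_assoc: "\<lbrakk>r \<in> carrier R; s \<in> carrier R; x \<in> carrier M\<rbrakk>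
      \<Longrightarrow> lact M (r \<otimes>\<^bsub>R\<^esub> s) x = lact M r (lact M s x)"
    and lact_ract: "\<lbrakk>r \<in> carrier R; x \<in> carrier M; a \<in> carrier S\<rbrakk>
      \<Longrightarrow> ract M (lact M r x) a = lact M r (ract M x a)"

definition rmod_hom ::
  "'r ring \<Rightarrow> ('r, 'm, 'y) rmod_scheme \<Rightarrow> ('r, 'n, 'z) rmod_scheme \<Rightarrow> ('m \<Rightarrow> 'n) set" where
  "rmod_hom R M N = {f \<in> carrier M \<rightarrow> carrier N.
     (\<forall>x\<in>carrier M. \<forall>y\<in>carrier M. f (x \<oplus>\<^bsub>M\<^esub> y) = f x \<oplus>\<^bsub>N\<^esub> f y) \<and>
     (\<forall>x\<in>carrier M. \<forall>r\<in>carrier R. f (ract M x r) = ract N (f x) r)}"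

definition rmod_iso ::
  "'r ring \<Rightarrow> ('r, 'm, 'y) rmod_scheme \<Rightarrow> ('r, 'n, 'z) rmod_scheme \<Rightarrow> ('m \<Rightarrow> 'n) set" where
  "rmod_iso R M N = {f \<in> rmod_hom R M N. bij_betw f (carrier M) (carrier N)}"

definition bimod_iso ::
  "'l ring \<Rightarrow> 'r ring \<Rightarrow> ('l, 'r, 'm, 'y) bimod_scheme \<Rightarrow> ('l, 'r, 'n, 'z) bimod_scheme
    \<Rightarrow> ('m \<Rightarrow> 'n) set" where
  "bimod_iso R S M N = {f \<in> rmod_iso S M N.
     \<forall>r\<in>carrier R. \<forall>x\<in>carrier M. f (lact M r x) = lact N r (f x)}"

text \<open>The ring \<open>D\<close> as an \<open>R,D\<close>-bimodule, with \<open>R\<close> acting through \<open>f\<close>.\<close>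

definition via :: "('r \<Rightarrow> 'd) \<Rightarrow> 'd ring \<Rightarrow> ('r, 'd, 'd) bimod" where
  "via f D = \<lparr>carrier = carrier D, mult = mult D, one = one D, zero = zero D, add = add D,
     ract = mult D, lact = (\<lambda>r d. f r \<otimes>\<^bsub>D\<^esub> d)\<rparr>"

abbreviation regular :: "'r ring \<Rightarrow> ('r, 'r, 'r) bimod" where
  "regular R \<equiv> via (\<lambda>r. r) R"


section \<open>Tensor products\<close>

text \<open>
  \<open>M \<otimes>\<^sub>R N\<close> is the free abelian group on \<open>M \<times> N\<close> modulo the subgroup generated by the
  biadditivity and balancing relations.
\<close>

definition tensor_rels ::
  "('r, 'm, 'y) rmod_scheme \<Rightarrow> 'r ring \<Rightarrow> ('r, 's, 'n, 'z) bimod_scheme \<Rightarrow> ('m \<times> 'n \<Rightarrow>\<^sub>0 int) set" where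
  "tensor_rels M R N =
     {frag_of (x \<oplus>\<^bsub>M\<^esub> x', y) - frag_of (x, y) - frag_of (x', y) | x x' y.
        x \<in> carrier M \<and> x' \<in> carrier M \<and> y \<in> carrier N} \<union>
     {frag_of (x, y \<oplus>\<^bsub>N\<^esub> y') - frag_of (x, y) - frag_of (x, y') | x y y'.
        x \<in> carrier M \<and> y \<in> carrier N \<and> y' \<in> carrier N} \<union>
     {frag_of (ract M x r, y) - frag_of (x, lact N r y) | x r y.
        x \<in> carrier M \<and> r \<in> carrier R \<and> y \<in> carrier N}"

definition tensor_ker ::
  "('r, 'm, 'y) rmod_scheme \<Rightarrow> 'r ring \<Rightarrow> ('r, 's, 'n, 'z) bimod_scheme \<Rightarrow> ('m \<times> 'n \<Rightarrow>\<^sub>0 int) set" where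
  "tensor_ker M R N =
     generate (free_Abelian_group (carrier M \<times> carrier N)) (tensor_rels M R N)"

definition tensor_group ::
  "('r, 'm, 'y) rmod_scheme \<Rightarrow> 'r ring \<Rightarrow> ('r, 's, 'n, 'z) bimod_scheme \<Rightarrow> ('m \<times> 'n \<Rightarrow>\<^sub>0 int) set monoid"
where
  "tensor_group M R N = free_Abelian_group (carrier M \<times> carrier N) Mod tensor_ker M R N"

definition tens ::
  "('r, 'm, 'y) rmod_scheme \<Rightarrow> 'r ring \<Rightarrow> ('r, 's, 'n, 'z) bimod_scheme \<Rightarrow> 'm \<Rightarrow> 'n
    \<Rightarrow> ('m \<times> 'n \<Rightarrow>\<^sub>0 int) set" where
  "tens M R N x y = tensor_ker M R N #>\<^bsub>free_Abelian_group (carrier M \<times> carrier N)\<^esub> frag_of (x, y)"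

text \<open>
  The map on \<open>M \<otimes>\<^sub>R N\<close> induced by a balanced biadditive map \<open>b\<close> to the abelian group \<open>G\<close>
  (written additively): \<open>b\<close> is extended to formal sums, and for balanced \<open>b\<close> all formal sums
  in the coset \<open>t\<close> are sent to the same element; see \<open>tensor_lift\<close> below.
\<close>

definition tensor_lift ::
  "('g, 'x) ring_scheme \<Rightarrow> ('m \<Rightarrow> 'n \<Rightarrow> 'g) \<Rightarrow> ('m \<times> 'n \<Rightarrow>\<^sub>0 int) set \<Rightarrow> 'g" where
  "tensor_lift G b t = the_elem
     ((\<lambda>c. \<Oplus>\<^bsub>G\<^esub>k\<in>Poly_Mapping.keys c. [Poly_Mapping.lookup c k] \<cdot>\<^bsub>G\<^esub> b (fst k) (snd k)) ` t)"

lemma tensor_lift: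
  fixes M :: "('r, 'm, 'y) rmod_scheme" and N :: "('r, 's, 'n, 'z) bimod_scheme"
    and G :: "('g, 'x) ring_scheme"
  assumes M: "right_module R M" and N: "bimodule R S N" and G: "abelian_group G"
    and closed: "\<And>x y. \<lbrakk>x \<in> carrier M; y \<in> carrier N\<rbrakk> \<Longrightarrow> b x y \<in> carrier G"
    and add_left: "\<And>x x' y. \<lbrakk>x \<in> carrier M; x' \<in> carrier M; y \<in> carrier N\<rbrakk>
      \<Longrightarrow> b (x \<oplus>\<^bsub>M\<^esub> x') y = b x y \<oplus>\<^bsub>G\<^esub> b x' y"
    and add_right: "\<And>x y y'. \<lbrakk>x \<in> carrier M; y \<in> carrier N; y' \<in> carrier N\<rbrakk>
      \<Longrightarrow> b x (y \<oplus>\<^bsub>N\<^esub> y') = b x y \<oplus>\<^bsub>G\<^esub> b x y'"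
    and balanced: "\<And>x r y. \<lbrakk>x \<in> carrier M; r \<in> carrier R; y \<in> carrier N\<rbrakk>
      \<Longrightarrow> b (ract M x r) y = b x (lact N r y)"
  shows "tensor_lift G b \<in> hom (tensor_group M R N) (add_monoid G)"
    and "\<lbrakk>x \<in> carrier M; y \<in> carrier N\<rbrakk> \<Longrightarrow> tensor_lift G b (tens M R N x y) = b x y"
    and "Poly_Mapping.keys c \<subseteq> carrier M \<times> carrier N \<Longrightarrow>
      tensor_lift G b (tensor_ker M R N #>\<^bsub>free_Abelian_group (carrier M \<times> carrier N)\<^esub> c) =
      (\<Oplus>\<^bsub>G\<^esub>k\<in>Poly_Mapping.keys c. [Poly_Mapping.lookup c k] \<cdot>\<^bsub>G\<^esub> b (fst k) (snd k))"
proof -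
  interpret M: right_module R M by (rule M)
  interpret N: bimodule R S N by (rule N)
  interpret G: abelian_group G by (rule G)
  let ?S = "carrier M \<times> carrier N"
  let ?FG = "free_Abelian_group ?S"
  let ?K = "tensor_ker M R N"
  let ?b = "\<lambda>k. b (fst k) (snd k)"
  define ev :: "('m \<times> 'n \<Rightarrow>\<^sub>0 int) \<Rightarrow> 'g" where "ev = (\<lambda>c. \<Oplus>\<^bsub>G\<^esub>k\<in>Poly_Mapping.keys c. [Poly_Mapping.lookup c k] \<cdot>\<^bsub>G\<^esub> ?b k)"
  have bS: "?b k \<in> carrier G" if "k \<in> ?S" for k using that closed by auto
  have p0: "[(0::int)] \<cdot>\<^bsub>G\<^esub> x = \<zero>\<^bsub>G\<^esub>" for x :: 'g
    by (simp add: add_pow_def)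
  have p1: "[(1::int)] \<cdot>\<^bsub>G\<^esub> x = x" if "x \<in> carrier G" for x
    using group.int_pow_1[OF G.a_group, of x] that by (simp add: add_pow_def)
  have pc: "[(k::int)] \<cdot>\<^bsub>G\<^esub> x \<in> carrier G" if "x \<in> carrier G" for k x
    using group.int_pow_closed[OF G.a_group, of x k] that by (simp add: add_pow_def)
  have pa: "[(k + l::int)] \<cdot>\<^bsub>G\<^esub> x = [k] \<cdot>\<^bsub>G\<^esub> x \<oplus>\<^bsub>G\<^esub> [l] \<cdot>\<^bsub>G\<^esub> x" if "x \<in> carrier G" for k l x
    using group.int_pow_mult[OF G.a_group, of x k l] that by (simp add: add_pow_def)
  have pS: "[(k::int)] \<cdot>\<^bsub>G\<^esub> ?b z \<in> carrier G" if "z \<in> ?S" for k z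
    using pc bS that by blast
  have ev_sup: "ev c = (\<Oplus>\<^bsub>G\<^esub>k\<in>L. [Poly_Mapping.lookup c k] \<cdot>\<^bsub>G\<^esub> ?b k)"
    if "finite L" "Poly_Mapping.keys c \<subseteq> L" "L \<subseteq> ?S" for c L
    unfolding ev_def
    using that pS by (intro G.add.finprod_mono_neutral_cong_left) (auto simp: in_keys_iff p0 subset_iff)
  have ev_closed: "ev c \<in> carrier G" if "Poly_Mapping.keys c \<subseteq> ?S" for c
    unfolding ev_def using that pS by (intro G.finsum_closed) blast
  have ev_add: "ev (c + d) = ev c \<oplus>\<^bsub>G\<^esub> ev d"
    if "Poly_Mapping.keys c \<subseteq> ?S" "Poly_Mapping.keys d \<subseteq> ?S" for c d
  proof -
    let ?L = "Poly_Mapping.keys c \<union> Poly_Mapping.keys d"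
    have L: "finite ?L" "?L \<subseteq> ?S" using that by auto
    have bL: "?b z \<in> carrier G" if "z \<in> ?L" for z using bS L that by blast
    have pL: "[(k::int)] \<cdot>\<^bsub>G\<^esub> ?b z \<in> carrier G" if "z \<in> ?L" for k z using pc bL that by blast
    have "ev (c + d) = (\<Oplus>\<^bsub>G\<^esub>k\<in>?L. [Poly_Mapping.lookup (c + d) k] \<cdot>\<^bsub>G\<^esub> ?b k)"
      using L keys_add[of c d] by (intro ev_sup) auto
    also have "\<dots> = (\<Oplus>\<^bsub>G\<^esub>k\<in>?L. [Poly_Mapping.lookup c k] \<cdot>\<^bsub>G\<^esub> ?b k \<oplus>\<^bsub>G\<^esub> [Poly_Mapping.lookup d k] \<cdot>\<^bsub>G\<^esub> ?b k)"
      using bL pL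
      by (intro G.finsum_cong') (simp_all add: Poly_Mapping.lookup_add pa Pi_iff)
    also have "\<dots> = ev c \<oplus>\<^bsub>G\<^esub> ev d"
      using L pL by (subst G.finsum_addf) (auto simp: ev_sup[of ?L])
    finally show ?thesis .
  qed
  have ev_hom: "ev \<in> hom ?FG (add_monoid G)"
    using ev_closed ev_add by (auto simp: hom_def)
  interpret ev: group_hom ?FG "add_monoid G" ev
    by (intro group_hom.intro group_hom_axioms.intro ev_hom G.a_group group_free_Abelian_group)
  have ev_frag: "ev (frag_of k) = ?b k" if "k \<in> ?S" for k
    using bS[OF that] by (simp add: ev_def p1)
  have ev_diff: "ev (c - d) = ev c \<ominus>\<^bsub>G\<^esub> ev d"
    if "Poly_Mapping.keys c \<subseteq> ?S" "Poly_Mapping.keys d \<subseteq> ?S" for c d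
  proof -
    have "ev c = ev (c - d) \<oplus>\<^bsub>G\<^esub> ev d"
      using ev_add[of "c - d" d] that keys_diff[of c d] by force
    moreover have "ev (c - d) \<in> carrier G"
      using that keys_diff[of c d] by (intro ev_closed) auto
    ultimately show ?thesis using ev_closed that by (simp add: G.minus_eq G.a_assoc G.r_neg)
  qed
  have rels: "tensor_rels M R N \<subseteq> carrier ?FG"
    unfolding tensor_rels_def
    using M.ract_closed N.lact_closed keys_diff
    by (auto dest!: subsetD[OF keys_diff])
  have ev_rels: "ev c = \<zero>\<^bsub>G\<^esub>" if "c \<in> tensor_rels M R N" for c
  proof -
    have kd: "Poly_Mapping.keys (frag_of k - frag_of l) \<subseteq> ?S" if "k \<in> ?S" "l \<in> ?S" for k l :: "'m \<times> 'n"
      using that keys_diff[of "frag_of k" "frag_of l"] by auto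
    have canc: "p \<oplus>\<^bsub>G\<^esub> (q \<oplus>\<^bsub>G\<^esub> (\<ominus>\<^bsub>G\<^esub> p \<oplus>\<^bsub>G\<^esub> \<ominus>\<^bsub>G\<^esub> q)) = \<zero>\<^bsub>G\<^esub>"
      if "p \<in> carrier G" "q \<in> carrier G" for p q
      using that by (metis G.a_assoc G.a_closed G.a_inv_closed G.minus_add G.r_neg)
    show ?thesis
      using that unfolding tensor_rels_def
      by (auto simp: ev_diff ev_frag kd add_left add_right balanced closed M.ract_closed N.lact_closed
          G.minus_eq G.minus_add G.a_ac G.r_neg canc)
  qed
  have ev_ker: "ev c = \<zero>\<^bsub>G\<^esub> \<and> Poly_Mapping.keys c \<subseteq> ?S" if "c \<in> ?K" for c
    using that unfolding tensor_ker_def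
  proof (induction rule: generate.induct)
    case one show ?case using ev.hom_one by simp
  next
    case (incl h) show ?case using ev_rels[OF incl] subsetD[OF rels incl] by simp
  next
    case (inv h)
    have "h \<in> carrier ?FG" by (rule subsetD[OF rels inv])
    then show ?case using ev.hom_inv[of h] ev_rels[OF inv] ev.inv_closed[of h] by auto
  next
    case (eng h1 h2)
    then show ?case using ev_add[of h1 h2] ev.m_closed[of h1 h2] by auto
  qed
  interpret K: subgroup ?K ?FG
    unfolding tensor_ker_def by (rule ev.generate_is_subgroup[OF rels])
  have lift: "tensor_lift G b (?K #>\<^bsub>?FG\<^esub> c) = ev c" if "Poly_Mapping.keys c \<subseteq> ?S" for c
  proof -
    have "ev ` (?K #>\<^bsub>?FG\<^esub> c) = {ev c}"
    proof -
      have "ev (k + c) = ev c" if "k \<in> ?K" for k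
        using ev_add[of k c] ev_ker[OF that] \<open>Poly_Mapping.keys c \<subseteq> ?S\<close> ev_closed by simp
      then show ?thesis using K.one_closed by (auto simp: r_coset_def image_iff)
    qed
    then show ?thesis unfolding tensor_lift_def ev_def[symmetric] by simp
  qed
  show "Poly_Mapping.keys c \<subseteq> ?S \<Longrightarrow> tensor_lift G b (?K #>\<^bsub>?FG\<^esub> c) =
      (\<Oplus>\<^bsub>G\<^esub>k\<in>Poly_Mapping.keys c. [Poly_Mapping.lookup c k] \<cdot>\<^bsub>G\<^esub> b (fst k) (snd k))"
    by (simp add: lift ev_def)
  show "tensor_lift G b (tens M R N x y) = b x y" if "x \<in> carrier M" "y \<in> carrier N"
    using that by (simp add: tens_def lift ev_frag)
  interpret K: normal ?K ?FG
    by (rule comm_group.subgroup_imp_normal[OF abelian_free_Abelian_group K.subgroup_axioms])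
  show "tensor_lift G b \<in> hom (tensor_group M R N) (add_monoid G)"
  proof (rule homI)
    fix s assume "s \<in> carrier (tensor_group M R N)"
    then show "tensor_lift G b s \<in> carrier (add_monoid G)"
      by (auto simp: tensor_group_def carrier_FactGroup lift ev_closed)
  next
    fix s t assume "s \<in> carrier (tensor_group M R N)" "t \<in> carrier (tensor_group M R N)"
    then obtain c d where cd: "c \<in> carrier ?FG" "d \<in> carrier ?FG" "s = ?K #>\<^bsub>?FG\<^esub> c" "t = ?K #>\<^bsub>?FG\<^esub> d"
      by (auto simp: tensor_group_def carrier_FactGroup)
    have "s \<otimes>\<^bsub>tensor_group M R N\<^esub> t = ?K #>\<^bsub>?FG\<^esub> (c + d)"
      using cd K.rcos_sum[of c d] by (simp add: tensor_group_def)
    then show "tensor_lift G b (s \<otimes>\<^bsub>tensor_group M R N\<^esub> t) =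
        tensor_lift G b s \<otimes>\<^bsub>add_monoid G\<^esub> tensor_lift G b t"
      using cd ev.m_closed[of c d] by (simp add: lift ev_add)
  qed
qed

text \<open>Right and left actions on \<open>M \<otimes>\<^sub>R N\<close>: \<open>(x \<otimes> y)s = x \<otimes> ys\<close> and \<open>r(x \<otimes> y) = rx \<otimes> y\<close>.\<close>

definition tensor ::
  "('r, 'm, 'y) rmod_scheme \<Rightarrow> 'r ring \<Rightarrow> ('r, 's, 'n, 'z) bimod_scheme
    \<Rightarrow> ('s, ('m \<times> 'n \<Rightarrow>\<^sub>0 int) set) rmod" where
  "tensor M R N =
     (let T = \<lparr>carrier = carrier (tensor_group M R N), mult = undefined, one = undefined,
               zero = one (tensor_group M R N), add = mult (tensor_group M R N)\<rparr>
      in ring.extend T (rmod.fields (\<lambda>t s. tensor_lift T (\<lambda>x y. tens M R N x (ract N y s)) t)))"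

definition bitensor ::
  "('l, 'r, 'm, 'y) bimod_scheme \<Rightarrow> 'r ring \<Rightarrow> ('r, 's, 'n, 'z) bimod_scheme
    \<Rightarrow> ('l, 's, ('m \<times> 'n \<Rightarrow>\<^sub>0 int) set) bimod" where
  "bitensor M R N = rmod.extend (tensor M R N)
     (bimod.fields (\<lambda>r t. tensor_lift (tensor M R N) (\<lambda>x y. tens M R N (lact M r x) y) t))"

text \<open>The map \<open>u \<otimes> id\<close> from \<open>P \<otimes>\<^sub>R N\<close> to \<open>Q \<otimes>\<^sub>R N\<close>.\<close>

definition tensor_id ::
  "('r, 'q, 'y) rmod_scheme \<Rightarrow> 'r ring \<Rightarrow> ('r, 's, 'n, 'z) bimod_scheme \<Rightarrow> ('p \<Rightarrow> 'q)
    \<Rightarrow> ('p \<times> 'n \<Rightarrow>\<^sub>0 int) set \<Rightarrow> ('q \<times> 'n \<Rightarrow>\<^sub>0 int) set" where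
  "tensor_id Q R N u = tensor_lift (tensor Q R N) (\<lambda>x y. tens Q R N (u x) y)"


section \<open>Smooth, finitely generated projective and proper modules\<close>

definition right_smooth :: "'r ring \<Rightarrow> ('r, 'm, 'z) rmod_scheme \<Rightarrow> bool" where
  "right_smooth R M \<longleftrightarrow> right_module R M \<and>
     tensor_lift M (ract M) \<in> rmod_iso R (tensor M R (regular R)) M"

definition smooth_bimodule :: "'l ring \<Rightarrow> 'r ring \<Rightarrow> ('l, 'r, 'm, 'z) bimod_scheme \<Rightarrow> bool" where
  "smooth_bimodule R S M \<longleftrightarrow> bimodule R S M \<and>
     tensor_lift M (lact M) \<in> bimod_iso R S (bitensor (regular R) R M) M \<and>
     tensor_lift M (ract M) \<in> bimod_iso R S (bitensor M S (regular S)) M"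

definition finitely_generated :: "'r ring \<Rightarrow> ('r, 'm, 'z) rmod_scheme \<Rightarrow> bool" where
  "finitely_generated R M \<longleftrightarrow> (\<exists>X. finite X \<and> X \<subseteq> carrier M \<and>
     generate (add_monoid M) (X \<union> {ract M x r | x r. x \<in> X \<and> r \<in> carrier R}) = carrier M)"

text \<open>Projectivity tested against the modules with carrier in the type \<open>'n\<close>.\<close>

definition projective :: "'n itself \<Rightarrow> 'r ring \<Rightarrow> ('r, 'm, 'z) rmod_scheme \<Rightarrow> bool" where
  "projective (_ :: 'n itself) R M \<longleftrightarrow> (\<forall>(N :: ('r, 'n) rmod) g.
     right_module R N \<and> g \<in> rmod_hom R N M \<and> g ` carrier N = carrier M
       \<longrightarrow> (\<exists>s\<in>rmod_hom R M N. \<forall>x\<in>carrier M. g (s x) = x))"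

text \<open>
  For finitely generated smooth modules, a single test type is enough: the type
  \<^typ>\<open>nat \<Rightarrow> 'r\<close> contains all free modules of finite rank, and a splitting of one of these gives a
  splitting of every surjection; see \<open>fgp_projective\<close> below.
\<close>

definition fgp :: "'r ring \<Rightarrow> ('r, 'm, 'z) rmod_scheme \<Rightarrow> bool" where
  "fgp R M \<longleftrightarrow> right_smooth R M \<and> finitely_generated R M \<and> projective TYPE(nat \<Rightarrow> 'r) R M"

definition proper :: "'l ring \<Rightarrow> 'r ring \<Rightarrow> ('l, 'r, 'm) bimod \<Rightarrow> bool" where
  "proper R S M \<longleftrightarrow> smooth_bimodule R S M \<and>
     (\<forall>e\<in>carrier R. e \<otimes>\<^bsub>R\<^esub> e = e \<longrightarrow> fgp S (M\<lparr>carrier := lact M e ` carrier M\<rparr>))"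


subsection \<open>Finitely generated projective modules split all surjections\<close>

lemma rmod_homD:
  assumes "f \<in> rmod_hom R M N"
  shows "x \<in> carrier M \<Longrightarrow> f x \<in> carrier N"
    and "\<lbrakk>x \<in> carrier M; y \<in> carrier M\<rbrakk> \<Longrightarrow> f (x \<oplus>\<^bsub>M\<^esub> y) = f x \<oplus>\<^bsub>N\<^esub> f y"
    and "\<lbrakk>x \<in> carrier M; r \<in> carrier R\<rbrakk> \<Longrightarrow> f (ract M x r) = ract N (f x) r"
  using assms by (auto simp: rmod_hom_def)

lemma rmod_hom_comp:
  assumes "f \<in> rmod_hom R M N" "g \<in> rmod_hom R N K"
  shows "(\<lambda>x. g (f x)) \<in> rmod_hom R M K"
  using assms by (simp add: rmod_hom_def Pi_iff)

lemma bimodule_regular: "rng R \<Longrightarrow> bimodule R R (regular R)"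
proof -
  assume "rng R"
  then interpret rng R .
  have [simp]: "carrier (regular R) = carrier R" "add (regular R) = add R" "zero (regular R) = zero R"
    "ract (regular R) = mult R" "lact (regular R) = mult R"
    by (auto simp: via_def)
  have "abelian_group (regular R)"
    by (intro abelian_groupI) (auto simp: a_ac intro: l_neg)
  then show ?thesis
    by (intro bimodule.intro right_module.intro right_module_axioms.intro bimodule_axioms.intro)
      (auto simp: m_closed l_distr r_distr m_assoc rng_axioms)
qed


context right_module
begin

lemma ract_zero_left: "r \<in> carrier R \<Longrightarrow> ract M \<zero>\<^bsub>M\<^esub> r = \<zero>\<^bsub>M\<^esub>"
  using ract_add_left[of "\<zero>\<^bsub>M\<^esub>" "\<zero>\<^bsub>M\<^esub>" r] ract_closed[of "\<zero>\<^bsub>M\<^esub>" r] by simp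

lemma ract_minus_left:
  assumes "x \<in> carrier M" "r \<in> carrier R"
  shows "ract M (\<ominus>\<^bsub>M\<^esub> x) r = \<ominus>\<^bsub>M\<^esub> ract M x r"
proof -
  have "ract M (\<ominus>\<^bsub>M\<^esub> x) r \<oplus>\<^bsub>M\<^esub> ract M x r = \<zero>\<^bsub>M\<^esub>"
    using ract_add_left[of "\<ominus>\<^bsub>M\<^esub> x" x r] assms by (simp add: M.l_neg ract_zero_left)
  then show ?thesis using assms by (metis M.a_inv_closed M.minus_equality ract_closed)
qed

text \<open>The free module \<open>R\<^sup>n\<close> and the map to \<open>M\<close> given by \<open>n\<close> elements of \<open>M\<close>.\<close>

definition free_rmod :: "nat \<Rightarrow> ('r, nat \<Rightarrow> 'r) rmod" where
  "free_rmod n = \<lparr>carrier = {h. (\<forall>j<n. h j \<in> carrier R) \<and> (\<forall>j\<ge>n. h j = \<zero>\<^bsub>R\<^esub>)},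
     mult = undefined, one = undefined, zero = (\<lambda>j. \<zero>\<^bsub>R\<^esub>), add = (\<lambda>g h j. g j \<oplus>\<^bsub>R\<^esub> h j),
     ract = (\<lambda>h r j. if j < n then h j \<otimes>\<^bsub>R\<^esub> r else \<zero>\<^bsub>R\<^esub>)\<rparr>"

lemma free_rmod_simps:
  "h \<in> carrier (free_rmod n) \<longleftrightarrow> (\<forall>j<n. h j \<in> carrier R) \<and> (\<forall>j\<ge>n. h j = \<zero>\<^bsub>R\<^esub>)"
  "(g \<oplus>\<^bsub>free_rmod n\<^esub> h) j = g j \<oplus>\<^bsub>R\<^esub> h j"
  "\<zero>\<^bsub>free_rmod n\<^esub> j = \<zero>\<^bsub>R\<^esub>"
  "ract (free_rmod n) h r j = (if j < n then h j \<otimes>\<^bsub>R\<^esub> r else \<zero>\<^bsub>R\<^esub>)"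
  by (auto simp: free_rmod_def)

lemma free_rmod_carrierD: "h \<in> carrier (free_rmod n) \<Longrightarrow> h j \<in> carrier R"
  by (cases "j < n") (auto simp: free_rmod_simps)

lemma right_module_free_rmod: "right_module R (free_rmod n)"
proof -
  have "abelian_group (free_rmod n)"
  proof (rule abelian_groupI)
    fix h assume h: "h \<in> carrier (free_rmod n)"
    have "(\<lambda>j. \<ominus>\<^bsub>R\<^esub> h j) \<in> carrier (free_rmod n)"
      using h by (auto simp: free_rmod_simps)
    moreover have "(\<lambda>j. \<ominus>\<^bsub>R\<^esub> h j) \<oplus>\<^bsub>free_rmod n\<^esub> h = \<zero>\<^bsub>free_rmod n\<^esub>"
      using free_rmod_carrierD[OF h] by (auto simp: free_rmod_simps fun_eq_iff R.l_neg)
    ultimately show "\<exists>g\<in>carrier (free_rmod n). g \<oplus>\<^bsub>free_rmod n\<^esub> h = \<zero>\<^bsub>free_rmod n\<^esub>" by blast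
  qed (auto simp: free_rmod_simps fun_eq_iff R.a_ac free_rmod_carrierD)
  moreover have "right_module_axioms R (free_rmod n)"
  proof (rule right_module_axioms.intro)
    fix g h r s
    assume g: "g \<in> carrier (free_rmod n)" and r: "r \<in> carrier R" and s: "s \<in> carrier R"
    note gR = free_rmod_carrierD[OF g]
    show "ract (free_rmod n) g r \<in> carrier (free_rmod n)"
      using gR r by (simp add: free_rmod_simps R.m_closed)
    show "ract (free_rmod n) g (r \<oplus>\<^bsub>R\<^esub> s) =
        ract (free_rmod n) g r \<oplus>\<^bsub>free_rmod n\<^esub> ract (free_rmod n) g s"
      using gR r s by (intro ext) (simp add: free_rmod_simps R.r_distr)
    show "ract (free_rmod n) g (r \<otimes>\<^bsub>R\<^esub> s) = ract (free_rmod n) (ract (free_rmod n) g r) s"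
      using gR r s by (intro ext) (simp add: free_rmod_simps R.m_assoc)
    assume h: "h \<in> carrier (free_rmod n)"
    show "ract (free_rmod n) (g \<oplus>\<^bsub>free_rmod n\<^esub> h) r =
        ract (free_rmod n) g r \<oplus>\<^bsub>free_rmod n\<^esub> ract (free_rmod n) h r"
      using gR free_rmod_carrierD[OF h] r by (intro ext) (simp add: free_rmod_simps R.l_distr)
  qed
  ultimately show ?thesis by (rule right_module.intro[OF R.rng_axioms])
qed

lemma free_rmod_hom:
  assumes y: "\<And>j. j < n \<Longrightarrow> y j \<in> carrier M"
  shows "(\<lambda>h. \<Oplus>\<^bsub>M\<^esub>j\<in>{..<n}. ract M (y j) (h j)) \<in> rmod_hom R (free_rmod n) M"
proof -
  have ract_sum: "ract M (\<Oplus>\<^bsub>M\<^esub>j\<in>{..<k}. f j) r = (\<Oplus>\<^bsub>M\<^esub>j\<in>{..<k}. ract M (f j) r)"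
    if "\<And>j. j < k \<Longrightarrow> f j \<in> carrier M" "r \<in> carrier R" for k :: nat and f r
    using that
  proof (induction k)
    case (Suc k)
    have "(\<Oplus>\<^bsub>M\<^esub>j\<in>{..<k}. f j) \<in> carrier M" using Suc.prems by (intro M.finsum_closed) auto
    then show ?case
      using Suc by (simp add: lessThan_Suc ract_add_left ract_closed Pi_iff)
  qed (simp add: ract_zero_left)
  show ?thesis
    unfolding rmod_hom_def
  proof (intro CollectI conjI ballI funcsetI)
    fix h assume h: "h \<in> carrier (free_rmod n)"
    note hR = free_rmod_carrierD[OF h]
    show "(\<Oplus>\<^bsub>M\<^esub>j\<in>{..<n}. ract M (y j) (h j)) \<in> carrier M"
      using hR by (intro M.finsum_closed) (auto simp: ract_closed y)
    fix r assume r: "r \<in> carrier R"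
    have "(\<Oplus>\<^bsub>M\<^esub>j\<in>{..<n}. ract M (y j) (ract (free_rmod n) h r j)) =
        (\<Oplus>\<^bsub>M\<^esub>j\<in>{..<n}. ract M (ract M (y j) (h j)) r)"
      using hR r by (intro M.finsum_cong') (auto simp: free_rmod_simps ract_closed ract_assoc y)
    also have "\<dots> = ract M (\<Oplus>\<^bsub>M\<^esub>j\<in>{..<n}. ract M (y j) (h j)) r"
      using hR r by (intro ract_sum[symmetric]) (auto simp: ract_closed y)
    finally show "(\<Oplus>\<^bsub>M\<^esub>j\<in>{..<n}. ract M (y j) (ract (free_rmod n) h r j)) =
        ract M (\<Oplus>\<^bsub>M\<^esub>j\<in>{..<n}. ract M (y j) (h j)) r" .
  next
    fix g h assume g: "g \<in> carrier (free_rmod n)" and h: "h \<in> carrier (free_rmod n)"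
    note gR = free_rmod_carrierD[OF g] and hR = free_rmod_carrierD[OF h]
    have "(\<Oplus>\<^bsub>M\<^esub>j\<in>{..<n}. ract M (y j) ((g \<oplus>\<^bsub>free_rmod n\<^esub> h) j)) =
        (\<Oplus>\<^bsub>M\<^esub>j\<in>{..<n}. ract M (y j) (g j) \<oplus>\<^bsub>M\<^esub> ract M (y j) (h j))"
      using gR hR by (intro M.finsum_cong') (auto simp: free_rmod_simps ract_add_right ract_closed y)
    also have "\<dots> = (\<Oplus>\<^bsub>M\<^esub>j\<in>{..<n}. ract M (y j) (g j)) \<oplus>\<^bsub>M\<^esub> (\<Oplus>\<^bsub>M\<^esub>j\<in>{..<n}. ract M (y j) (h j))"
      using gR hR by (intro M.finsum_addf) (auto simp: ract_closed y)
    finally show "(\<Oplus>\<^bsub>M\<^esub>j\<in>{..<n}. ract M (y j) ((g \<oplus>\<^bsub>free_rmod n\<^esub> h) j)) =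
        (\<Oplus>\<^bsub>M\<^esub>j\<in>{..<n}. ract M (y j) (g j)) \<oplus>\<^bsub>M\<^esub> (\<Oplus>\<^bsub>M\<^esub>j\<in>{..<n}. ract M (y j) (h j))" .
  qed
qed

end

lemma rmod_hom_finsum:
  assumes f: "f \<in> rmod_hom R M N" and M: "abelian_group M" and N: "abelian_group N"
    and x: "\<And>j. j < k \<Longrightarrow> x j \<in> carrier M"
  shows "f (\<Oplus>\<^bsub>M\<^esub>j\<in>{..<k}. x j) = (\<Oplus>\<^bsub>N\<^esub>j\<in>{..<k::nat}. f (x j))"
proof -
  interpret M: abelian_group M by (rule M)
  interpret N: abelian_group N by (rule N)
  have fh: "f \<in> hom (add_monoid M) (add_monoid N)"
    using f by (auto simp: rmod_hom_def hom_def)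
  interpret f: group_hom "add_monoid M" "add_monoid N" f
    by (intro group_hom.intro group_hom_axioms.intro fh M.a_group N.a_group)
  show ?thesis using x
  proof (induction k)
    case 0 then show ?case using f.hom_one by simp
  next
    case (Suc k)
    have "(\<Oplus>\<^bsub>M\<^esub>j\<in>{..<k}. x j) \<in> carrier M" using Suc.prems by (intro M.finsum_closed) auto
    then show ?case using Suc rmod_homD[OF f] by (simp add: lessThan_Suc Pi_iff)
  qed
qed

lemma smooth_local_unit:
  assumes R: "lu_ring R" and M: "right_smooth R M" and m: "m \<in> carrier M"
  obtains e where "e \<in> carrier R" "ract M m e = m"
proof -
  interpret R: lu_ring R by (rule R)
  interpret M: right_module R M using M by (simp add: right_smooth_def)
  have reg: "carrier (regular R) = carrier R" "add (regular R) = add R" "lact (regular R) = mult R"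
    by (auto simp: via_def)
  let ?K = "tensor_ker M R (regular R)"
  let ?FG = "free_Abelian_group (carrier M \<times> carrier R)"
  have "m \<in> tensor_lift M (ract M) ` carrier (tensor M R (regular R))"
    using M m by (auto simp: right_smooth_def rmod_iso_def bij_betw_def)
  moreover have "carrier (tensor M R (regular R)) = carrier (tensor_group M R (regular R))"
    by (simp add: tensor_def ring.defs rmod.defs Let_def)
  ultimately obtain c where c: "Poly_Mapping.keys c \<subseteq> carrier M \<times> carrier R"
    "m = tensor_lift M (ract M) (?K #>\<^bsub>?FG\<^esub> c)"
    by (auto simp: tensor_group_def carrier_FactGroup reg)
  have mc: "m = (\<Oplus>\<^bsub>M\<^esub>k\<in>Poly_Mapping.keys c. [Poly_Mapping.lookup c k] \<cdot>\<^bsub>M\<^esub> ract M (fst k) (snd k))"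
    using c tensor_lift(3)[OF M.right_module_axioms bimodule_regular[OF R.rng_axioms] M.M.abelian_group_axioms,
        of "ract M" c]
    by (simp add: reg M.ract_closed M.ract_add_left M.ract_add_right M.ract_assoc)
  obtain e where e: "e \<in> carrier R" "\<And>k. k \<in> Poly_Mapping.keys c \<Longrightarrow> snd k \<otimes>\<^bsub>R\<^esub> e = snd k"
    using R.local_units[of "snd ` Poly_Mapping.keys c"] c(1) by fastforce
  have fh: "(\<lambda>x. ract M x e) \<in> hom (add_monoid M) (add_monoid M)"
    using e by (auto simp: hom_def M.ract_closed M.ract_add_left)
  interpret f: group_hom "add_monoid M" "add_monoid M" "\<lambda>x. ract M x e"
    by (intro group_hom.intro group_hom_axioms.intro fh M.M.a_group)
  have kc: "[(z::int)] \<cdot>\<^bsub>M\<^esub> ract M (fst k) (snd k) \<in> carrier M \<and>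
      ract M ([z] \<cdot>\<^bsub>M\<^esub> ract M (fst k) (snd k)) e = [z] \<cdot>\<^bsub>M\<^esub> ract M (fst k) (snd k)"
    if "k \<in> Poly_Mapping.keys c" for k z
  proof -
    have k: "fst k \<in> carrier M" "snd k \<in> carrier R" using that c(1) by auto
    have eq: "ract M (ract M (fst k) (snd k)) e = ract M (fst k) (snd k)"
      by (simp only: M.ract_assoc[OF k e(1), symmetric] e(2)[OF that])
    show ?thesis
      using f.hom_int_pow[of "ract M (fst k) (snd k)" z] k M.ract_closed[of "fst k" "snd k"]
        group.int_pow_closed[OF M.M.a_group, of "ract M (fst k) (snd k)" z]
      by (simp add: add_pow_def eq)
  qed
  define t where "t k = [Poly_Mapping.lookup c k] \<cdot>\<^bsub>M\<^esub> ract M (fst k) (snd k)" for k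
  have t: "t k \<in> carrier M" "ract M (t k) e = t k" if "k \<in> Poly_Mapping.keys c" for k
    using kc[OF that] by (simp_all add: t_def)
  have "ract M (\<Oplus>\<^bsub>M\<^esub>k\<in>L. t k) e = (\<Oplus>\<^bsub>M\<^esub>k\<in>L. t k) \<and> (\<Oplus>\<^bsub>M\<^esub>k\<in>L. t k) \<in> carrier M"
    if "finite L" "L \<subseteq> Poly_Mapping.keys c" for L
    using that
  proof (induction rule: finite_induct)
    case empty show ?case using M.ract_zero_left[OF e(1)] by simp
  next
    case (insert k L)
    have "t \<in> L \<rightarrow> carrier M" "t k \<in> carrier M" "ract M (t k) e = t k"
      using insert.prems t by auto
    then show ?case using insert e(1) by (simp add: M.ract_add_left)
  qed
  from this[OF finite_keys subset_refl] have "ract M m e = m" unfolding mc t_def[symmetric] ..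
  then show ?thesis using e that by blast
qed

lemma fgp_projective:
  fixes M :: "('r, 'm, 'z) rmod_scheme"
  assumes R: "lu_ring R" and M: "fgp R M"
  shows "projective TYPE('n) R M"
proof -
  interpret R: lu_ring R by (rule R)
  interpret M: right_module R M using M by (simp add: fgp_def right_smooth_def)
  obtain X where X: "finite X" "X \<subseteq> carrier M"
    "generate (add_monoid M) (X \<union> {ract M x r | x r. x \<in> X \<and> r \<in> carrier R}) = carrier M"
    using M by (auto simp: fgp_def finitely_generated_def)
  obtain n :: nat and x where x: "X = x ` {..<n}"
    using X(1) by (metis finite_imp_nat_seg_image_inj_on lessThan_def)
  have xM: "x j \<in> carrier M" if "j < n" for j using that X(2) x by auto
  let ?g = "\<lambda>h. \<Oplus>\<^bsub>M\<^esub>j\<in>{..<n}. ract M (x j) (h j)"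
  interpret E: right_module R "M.free_rmod n" by (rule M.right_module_free_rmod)
  have g: "?g \<in> rmod_hom R (M.free_rmod n) M" using xM by (rule M.free_rmod_hom)
  have gh: "?g \<in> hom (add_monoid (M.free_rmod n)) (add_monoid M)"
    using rmod_homD[OF g] by (auto simp: hom_def)
  interpret g: group_hom "add_monoid (M.free_rmod n)" "add_monoid M" ?g
    by (intro group_hom.intro group_hom_axioms.intro gh E.M.a_group M.M.a_group)
  have single: "ract M (x i) r \<in> ?g ` carrier (M.free_rmod n)" if "i < n" "r \<in> carrier R" for i r
  proof (rule image_eqI)
    let ?h = "\<lambda>j. if j = i then r else \<zero>\<^bsub>R\<^esub>"
    show "?h \<in> carrier (M.free_rmod n)" using that by (auto simp: M.free_rmod_simps)
    have z: "ract M (x j) \<zero>\<^bsub>R\<^esub> = \<zero>\<^bsub>M\<^esub>" if "j < n" for j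
      using M.ract_add_right[OF xM[OF that], of "\<zero>\<^bsub>R\<^esub>" "\<zero>\<^bsub>R\<^esub>"] M.ract_closed[OF xM[OF that], of "\<zero>\<^bsub>R\<^esub>"]
      by simp
    have "?g ?h = (\<Oplus>\<^bsub>M\<^esub>j\<in>{..<n}. if i = j then ract M (x j) r else \<zero>\<^bsub>M\<^esub>)"
      using that by (intro M.M.finsum_cong') (auto simp: M.ract_closed xM z)
    also have "\<dots> = ract M (x i) r"
      using that by (intro M.M.finsum_singleton) (auto simp: M.ract_closed xM)
    finally show "ract M (x i) r = ?g ?h" by simp
  qed
  have "X \<union> {ract M x r | x r. x \<in> X \<and> r \<in> carrier R} \<subseteq> ?g ` carrier (M.free_rmod n)"
  proof -
    have "x i \<in> ?g ` carrier (M.free_rmod n)" if i: "i < n" for i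
    proof -
      obtain e where "e \<in> carrier R" "ract M (x i) e = x i"
        using smooth_local_unit[OF R _ xM[OF i]] M by (auto simp: fgp_def)
      then show ?thesis using single[OF i, of e] by simp
    qed
    then show ?thesis using single x by auto
  qed
  moreover have "subgroup (?g ` carrier (M.free_rmod n)) (add_monoid M)"
    using g.img_is_subgroup by simp
  ultimately have "generate (add_monoid M) (X \<union> {ract M x r | x r. x \<in> X \<and> r \<in> carrier R})
      \<subseteq> ?g ` carrier (M.free_rmod n)"
    by (rule group.generate_subgroup_incl[OF M.M.a_group])
  then have "carrier M \<subseteq> ?g ` carrier (M.free_rmod n)"
    unfolding X(3) .
  then have "?g ` carrier (M.free_rmod n) = carrier M"
    using rmod_homD(1)[OF g] by blast
  moreover have "projective TYPE(nat \<Rightarrow> 'r) R M" using M by (simp add: fgp_def)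
  ultimately have "\<exists>s\<in>rmod_hom R M (M.free_rmod n). \<forall>m\<in>carrier M. ?g (s m) = m"
    unfolding projective_def using E.right_module_axioms g
    by (elim allE[of _ "M.free_rmod n"] allE[of _ ?g]) (simp only: simp_thms)
  then obtain s where s: "s \<in> rmod_hom R M (M.free_rmod n)" "\<And>m. m \<in> carrier M \<Longrightarrow> ?g (s m) = m"
    by (elim bexE) simp
  show ?thesis unfolding projective_def
  proof (intro allI impI, elim conjE)
    fix N :: "('r, 'n) rmod" and f
    assume N: "right_module R N" and f: "f \<in> rmod_hom R N M" and surj: "f ` carrier N = carrier M"
    interpret N: right_module R N by (rule N)
    define y where "y j = inv_into (carrier N) f (x j)" for j
    have y: "y j \<in> carrier N" "f (y j) = x j" if "j < n" for j
      using xM[OF that] unfolding y_def surj[symmetric]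
      by (simp_all only: inv_into_into f_inv_into_f)
    let ?k = "\<lambda>h. \<Oplus>\<^bsub>N\<^esub>j\<in>{..<n}. ract N (y j) (h j)"
    have k: "?k \<in> rmod_hom R (M.free_rmod n) N"
      using y(1) by (rule N.free_rmod_hom)
    have "(\<lambda>m. ?k (s m)) \<in> rmod_hom R M N"
      by (rule rmod_hom_comp[OF s(1) k])
    moreover have "f (?k (s m)) = m" if m: "m \<in> carrier M" for m
    proof -
      note sR = M.free_rmod_carrierD[OF rmod_homD(1)[OF s(1) m]]
      have "f (?k (s m)) = (\<Oplus>\<^bsub>M\<^esub>j\<in>{..<n}. f (ract N (y j) (s m j)))"
        using sR by (intro rmod_hom_finsum[OF f] N.M.abelian_group_axioms M.M.abelian_group_axioms)
          (auto simp: N.ract_closed y)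
      also have "\<dots> = ?g (s m)"
        using sR by (intro M.M.finsum_cong') (auto simp: M.ract_closed xM y rmod_homD(3)[OF f])
      finally show ?thesis using s(2)[OF m] by simp
    qed
    ultimately show "\<exists>s\<in>rmod_hom R M N. \<forall>x\<in>carrier M. f (s x) = x"
      by (intro bexI[of _ "\<lambda>m. ?k (s m)"] ballI)
  qed
qed


section \<open>Cohn localisation\<close>

definition inverts ::
  "'r ring \<Rightarrow> ('r, 'p) rmod \<Rightarrow> ('r, 'q) rmod \<Rightarrow> ('p \<Rightarrow> 'q) \<Rightarrow> 'd ring \<Rightarrow> ('r \<Rightarrow> 'd) \<Rightarrow> bool" where
  "inverts R P Q u D f \<longleftrightarrow>
     tensor_id Q R (via f D) u \<in> rmod_iso D (tensor P R (via f D)) (tensor Q R (via f D))"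

text \<open>
  HOL cannot quantify over types inside a formula. The first argument names the type whose subsets
  carry the test rings \<open>D\<close>; leaving that type variable free in a theorem makes \<open>D\<close> arbitrary.
\<close>

definition cohn_localisation ::
  "'d itself \<Rightarrow> 'r ring \<Rightarrow> 'i set \<Rightarrow> ('i \<Rightarrow> ('r, 'p) rmod) \<Rightarrow> ('i \<Rightarrow> ('r, 'q) rmod)
    \<Rightarrow> ('i \<Rightarrow> 'p \<Rightarrow> 'q) \<Rightarrow> 'c ring \<Rightarrow> ('r \<Rightarrow> 'c) \<Rightarrow> bool" where
  "cohn_localisation (_ :: 'd itself) R I P Q u R' \<phi> \<longleftrightarrow>
     lu_ring R' \<and> \<phi> \<in> nd_hom R R' \<and> (\<forall>i\<in>I. inverts R (P i) (Q i) (u i) R' \<phi>) \<and>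
     (\<forall>(D :: 'd ring) f. lu_ring D \<and> f \<in> nd_hom R D \<longrightarrow>
        ((\<exists>g\<in>nd_hom R' D. compose (carrier R) g \<phi> = f) \<longleftrightarrow>
           (\<forall>i\<in>I. inverts R (P i) (Q i) (u i) D f)) \<and>
        (\<forall>g\<in>nd_hom R' D. \<forall>h\<in>nd_hom R' D.
           compose (carrier R) g \<phi> = f \<and> compose (carrier R) h \<phi> = f \<longrightarrow> g = h))"

text \<open>
  A type large enough to carry the Cohn localisation: subsets (namely, cosets) of the free ring on
  the elements of \<open>R\<close> and symbols \<open>(i, \<xi>, y)\<close>, standing for \<open>\<xi>(u\<^sub>i\<inverse>(y))\<close> with \<open>y \<in> Q\<^sub>i\<close> and a
  right \<open>R\<close>-linear \<open>\<xi>\<close> from \<open>P\<^sub>i\<close> to \<open>R\<close>.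
\<close>

type_synonym ('r, 'i, 'p, 'q) cohn_elt = "(('r + 'i \<times> ('p \<Rightarrow> 'r) \<times> 'q) list \<Rightarrow>\<^sub>0 int) set"

text \<open>
  A candidate for the Cohn localisation: it is chosen among the pairs that pass the test for rings
  in the type above, if there are any. It does not depend on any further type \<open>'d\<close>, so that it
  makes sense to claim its universal property for all \<open>'d\<close>.
\<close>

definition cohn ::
  "'r ring \<Rightarrow> 'i set \<Rightarrow> ('i \<Rightarrow> ('r, 'p) rmod) \<Rightarrow> ('i \<Rightarrow> ('r, 'q) rmod) \<Rightarrow> ('i \<Rightarrow> 'p \<Rightarrow> 'q)
    \<Rightarrow> ('r, 'i, 'p, 'q) cohn_elt ring \<times> ('r \<Rightarrow> ('r, 'i, 'p, 'q) cohn_elt)" where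
  "cohn R I P Q u = (SOME (R', \<phi>).
     cohn_localisation TYPE(('r, 'i, 'p, 'q) cohn_elt) R I P Q u R' \<phi>)"


section \<open>Diagrams and covariance rings\<close>

text \<open>
  The ring \<open>F\<^sub>1\<close> is called \<open>A\<close>. The associativity condition is stated on elementary tensors, which
  span the triple tensor product; this also avoids spelling out the associator
  \<open>(F\<^sub>p \<otimes> F\<^sub>q) \<otimes> F\<^sub>t \<cong> F\<^sub>p \<otimes> (F\<^sub>q \<otimes> F\<^sub>t)\<close>.
\<close>

locale diagram = monoid P + A: lu_ring A
  for P :: "'p monoid" (structure) and A :: "'m ring" +
  fixes F :: "'p \<Rightarrow> ('m, 'm, 'm) bimod"
    and \<mu> :: "'p \<Rightarrow> 'p \<Rightarrow> ('m \<times> 'm \<Rightarrow>\<^sub>0 int) set \<Rightarrow> 'm"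
  assumes F_one: "F \<one> = regular A"
    and F_proper: "p \<in> carrier P \<Longrightarrow> proper A A (F p)"
    and \<mu>_iso: "\<lbrakk>p \<in> carrier P; q \<in> carrier P\<rbrakk>
      \<Longrightarrow> \<mu> p q \<in> bimod_iso A A (bitensor (F p) A (F q)) (F (p \<otimes> q))"
    and \<mu>_one_left: "\<lbrakk>q \<in> carrier P; w \<in> carrier (bitensor (F \<one>) A (F q))\<rbrakk>
      \<Longrightarrow> \<mu> \<one> q w = tensor_lift (F q) (lact (F q)) w"
    and \<mu>_one_right: "\<lbrakk>q \<in> carrier P; w \<in> carrier (bitensor (F q) A (F \<one>))\<rbrakk>
      \<Longrightarrow> \<mu> q \<one> w = tensor_lift (F q) (ract (F q)) w"
    and \<mu>_assoc: "\<lbrakk>p \<in> carrier P; q \<in> carrier P; t \<in> carrier P;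
        x \<in> carrier (F p); y \<in> carrier (F q); z \<in> carrier (F t)\<rbrakk>
      \<Longrightarrow> \<mu> (p \<otimes> q) t (tens (F (p \<otimes> q)) A (F t) (\<mu> p q (tens (F p) A (F q) x y)) z) =
          \<mu> p (q \<otimes> t) (tens (F p) A (F (q \<otimes> t)) x (\<mu> q t (tens (F q) A (F t) y z)))"

text \<open>
  The tensor product \<open>F\<^sub>p \<otimes> D\<close> is formed with \<open>A\<close> acting on \<open>D\<close> through the ring homomorphism
  \<open>\<nu> \<one>\<close>.
\<close>

definition covariant_reps ::
  "'p monoid \<Rightarrow> 'm ring \<Rightarrow> ('p \<Rightarrow> ('m, 'm, 'm) bimod)
    \<Rightarrow> ('p \<Rightarrow> 'p \<Rightarrow> ('m \<times> 'm \<Rightarrow>\<^sub>0 int) set \<Rightarrow> 'm) \<Rightarrow> 'd ring \<Rightarrow> ('p \<Rightarrow> 'm \<Rightarrow> 'd) set" where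
  "covariant_reps P A F \<mu> D = {\<nu> \<in> (\<Pi>\<^sub>E p\<in>carrier P. carrier (F p) \<rightarrow>\<^sub>E carrier D).
     (\<forall>p\<in>carrier P. \<forall>x\<in>carrier (F p). \<forall>y\<in>carrier (F p).
        \<nu> p (x \<oplus>\<^bsub>F p\<^esub> y) = \<nu> p x \<oplus>\<^bsub>D\<^esub> \<nu> p y) \<and>
     (\<forall>p\<in>carrier P. \<forall>q\<in>carrier P. \<forall>x\<in>carrier (F p). \<forall>y\<in>carrier (F q).
        \<nu> p x \<otimes>\<^bsub>D\<^esub> \<nu> q y = \<nu> (p \<otimes>\<^bsub>P\<^esub> q) (\<mu> p q (tens (F p) A (F q) x y))) \<and>
     (\<forall>p\<in>carrier P. tensor_lift D (\<lambda>x d. \<nu> p x \<otimes>\<^bsub>D\<^esub> d)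
        \<in> rmod_iso D (tensor (F p) A (via (\<nu> \<one>\<^bsub>P\<^esub>) D)) (regular D))}"

text \<open>
  By the Yoneda lemma, a natural bijection between nondegenerate homomorphisms \<open>C \<rightarrow> D\<close> and
  covariant representations in \<open>D\<close> is given by composition with a universal covariant
  representation \<open>\<omega>\<close> in \<open>C\<close>. The first argument plays the same role as for
  \<^const>\<open>cohn_localisation\<close>.
\<close>

definition covariance_ring ::
  "'d itself \<Rightarrow> 'p monoid \<Rightarrow> 'm ring \<Rightarrow> ('p \<Rightarrow> ('m, 'm, 'm) bimod)
    \<Rightarrow> ('p \<Rightarrow> 'p \<Rightarrow> ('m \<times> 'm \<Rightarrow>\<^sub>0 int) set \<Rightarrow> 'm) \<Rightarrow> 'c ring \<Rightarrow> ('p \<Rightarrow> 'm \<Rightarrow> 'c) \<Rightarrow> bool" where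
  "covariance_ring (_ :: 'd itself) P A F \<mu> C \<omega> \<longleftrightarrow>
     lu_ring C \<and> \<omega> \<in> covariant_reps P A F \<mu> C \<and>
     (\<forall>D :: 'd ring. lu_ring D \<longrightarrow>
        bij_betw (\<lambda>h. \<lambda>p\<in>carrier P. compose (carrier (F p)) h (\<omega> p))
          (nd_hom C D) (covariant_reps P A F \<mu> D))"

text \<open>
  As for \<^const>\<open>cohn\<close>, here with generators \<open>(p, x)\<close> for \<open>x \<in> F\<^sub>p\<close> and symbols \<open>(p, \<xi>, e)\<close>,
  standing for \<open>\<xi>(\<nu>\<^sub>p\<inverse>(e))\<close> with an idempotent \<open>e\<close> of \<open>A\<close> and a right \<open>A\<close>-linear \<open>\<xi>\<close> from
  \<open>eF\<^sub>p\<close> to \<open>A\<close>.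
\<close>

type_synonym ('p, 'm) cov_elt = "(('p \<times> 'm + 'p \<times> ('m \<Rightarrow> 'm) \<times> 'm) list \<Rightarrow>\<^sub>0 int) set"

definition cov ::
  "'p monoid \<Rightarrow> 'm ring \<Rightarrow> ('p \<Rightarrow> ('m, 'm, 'm) bimod)
    \<Rightarrow> ('p \<Rightarrow> 'p \<Rightarrow> ('m \<times> 'm \<Rightarrow>\<^sub>0 int) set \<Rightarrow> 'm)
    \<Rightarrow> ('p, 'm) cov_elt ring \<times> ('p \<Rightarrow> 'm \<Rightarrow> ('p, 'm) cov_elt)" where
  "cov P A F \<mu> = (SOME (C, \<omega>). covariance_ring TYPE(('p, 'm) cov_elt) P A F \<mu> C \<omega>)"

end

theory Submission
  imports Defs
begin

text \<open>
  If \<open>u\<^sub>i \<otimes> D\<close> is invertible, then every functional \<open>\<xi>\<close> on \<open>P\<^sub>i\<close> and every \<open>y \<in> Q\<^sub>i\<close> give a scalar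
  \<open>\<xi>(u\<^sub>i\<inverse>(y)) \<in> D\<close>. By dual bases, invertibility amounts to finitary equations between these
  scalars and the image of \<open>R\<close>, the equations determine the scalars uniquely, and every
  scalar is fixed by local units of \<open>R\<close> on both sides. So the ring generated by \<open>R\<close> and such
  scalars, subject to these equations, has local units and is the localisation. The covariance
  ring is obtained likewise from the additive maps \<open>\<nu>\<^sub>p\<close> and scalars \<open>\<xi>(\<nu>\<^sub>p\<inverse>(e))\<close> for
  idempotents \<open>e\<close> and functionals \<open>\<xi>\<close> on \<open>eF\<^sub>p\<close>. Since only equations are involved,
  invertibility is preserved by ring homomorphisms.

  Both objects are \<^emph>\<open>chosen\<close> by test rings in one type only; uniqueness identifies the
  chosen one with the constructed one, which is universal for every type.
\<close>

section \<open>Rings with local units\<close>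

text \<open>The inverse of \<open>u \<otimes> id\<close> lives on tensor products whose type changes
  with D, so it cannot itself be a generator; its matrix entries are elements of D and can. They are
  indexed by all functionals and all elements, and the relations run over all dual bases, so that
  nothing has to be chosen and the scalars keep their meaning over every D.

  Three points need care without a unit. The element y \<otimes> 1 exists only as y \<otimes> f(e)
  with ye = y. Right units of the scalars are visible in the equations, but left units are not: they
  come from expanding a scalar along a dual basis with coefficients in R, by the same calculation
  that proves uniqueness. Finally, A and \<open>F_p\<close> are in general not finitely generated,
  so \<open>\<nu>_p\<close> has no global matrix; only the slices \<open>eF_p\<close> are fgp, and
  the inverse of \<open>\<nu>_p\<close> is known through its values at idempotents e, each valid on
  the part cut out by e.\<close>

definition lsum :: "('a, 'z) ring_scheme \<Rightarrow> 'a list \<Rightarrow> 'a" where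
  "lsum M xs = foldr (add M) xs \<zero>\<^bsub>M\<^esub>"

lemma lsum_simps [simp]:
  "lsum M [] = \<zero>\<^bsub>M\<^esub>"
  "lsum M (x # xs) = x \<oplus>\<^bsub>M\<^esub> lsum M xs"
  by (simp_all add: lsum_def)

lemma lsum_cong: "(\<And>x. x \<in> set xs \<Longrightarrow> f x = g x) \<Longrightarrow> lsum M (map f xs) = lsum M (map g xs)"
  by (simp cong: map_cong)

context abelian_monoid
begin

lemma lsum_closed: "set xs \<subseteq> carrier G \<Longrightarrow> lsum G xs \<in> carrier G"
  by (induction xs) auto

lemma lsum_zero: "(\<And>x. x \<in> set xs \<Longrightarrow> f x = \<zero>) \<Longrightarrow> lsum G (map f xs) = \<zero>"
  by (induction xs) auto

lemma lsum_add:
  assumes "\<And>x. x \<in> set xs \<Longrightarrow> f x \<in> carrier G" "\<And>x. x \<in> set xs \<Longrightarrow> g x \<in> carrier G"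
  shows "lsum G (map (\<lambda>x. f x \<oplus> g x) xs) = lsum G (map f xs) \<oplus> lsum G (map g xs)"
  using assms
proof (induction xs)
  case (Cons x xs)
  have "lsum G (map f xs) \<in> carrier G" "lsum G (map g xs) \<in> carrier G"
    using Cons.prems by (auto intro!: lsum_closed)
  then show ?case using Cons by (simp add: a_ac)
qed simp

lemma lsum_swap:
  assumes "\<And>x y. x \<in> set xs \<Longrightarrow> y \<in> set ys \<Longrightarrow> f x y \<in> carrier G"
  shows "lsum G (map (\<lambda>x. lsum G (map (f x) ys)) xs) =
    lsum G (map (\<lambda>y. lsum G (map (\<lambda>x. f x y) xs)) ys)"
  using assms
proof (induction xs)
  case Nil
  show ?case using lsum_zero[of ys "\<lambda>_. \<zero>"] by simp
next
  case (Cons x xs)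
  have "lsum G (map (\<lambda>y. f x y \<oplus> lsum G (map (\<lambda>x. f x y) xs)) ys) =
      lsum G (map (f x) ys) \<oplus> lsum G (map (\<lambda>y. lsum G (map (\<lambda>x. f x y) xs)) ys)"
    using Cons.prems by (intro lsum_add) (auto intro!: lsum_closed)
  then show ?case using Cons by simp
qed

end

lemma add_homD:
  assumes "f \<in> hom (add_monoid M) (add_monoid N)"
  shows "x \<in> carrier M \<Longrightarrow> f x \<in> carrier N"
    and "\<lbrakk>x \<in> carrier M; y \<in> carrier M\<rbrakk> \<Longrightarrow> f (x \<oplus>\<^bsub>M\<^esub> y) = f x \<oplus>\<^bsub>N\<^esub> f y"
  using assms by (auto simp: hom_def)

lemma add_hom_zero:
  assumes "f \<in> hom (add_monoid M) (add_monoid N)" "abelian_group M" "abelian_group N"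
  shows "f \<zero>\<^bsub>M\<^esub> = \<zero>\<^bsub>N\<^esub>"
  using hom_one[OF assms(1)] assms(2,3) by (simp add: abelian_group.a_group)

lemma add_hom_minus:
  assumes "f \<in> hom (add_monoid M) (add_monoid N)" "abelian_group M" "abelian_group N" "x \<in> carrier M"
  shows "f (\<ominus>\<^bsub>M\<^esub> x) = \<ominus>\<^bsub>N\<^esub> f x"
  using group_hom.hom_inv[of "add_monoid M" "add_monoid N" f x] assms
  by (simp add: group_hom_def group_hom_axioms_def abelian_group.a_group a_inv_def)

lemma add_hom_lsum:
  assumes f: "f \<in> hom (add_monoid M) (add_monoid N)" and M: "abelian_group M" and N: "abelian_group N"
    and x: "\<And>x. x \<in> set xs \<Longrightarrow> g x \<in> carrier M"
  shows "f (lsum M (map g xs)) = lsum N (map (\<lambda>x. f (g x)) xs)"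
  using x
proof (induction xs)
  case Nil show ?case using add_hom_zero[OF f M N] by simp
next
  case (Cons x xs)
  interpret M: abelian_group M by (rule M)
  have "lsum M (map g xs) \<in> carrier M" using Cons.prems by (intro M.lsum_closed) auto
  then show ?case using Cons add_homD[OF f] by simp
qed

context rng
begin

lemma left_unit_widen:
  assumes "e \<in> carrier R" "a \<in> carrier R" "x \<in> carrier R" "e \<otimes> a = a" "a \<otimes> x = x"
  shows "e \<otimes> x = x"
  using m_assoc[of e a x] assms by simp

lemma left_mult_hom: "a \<in> carrier R \<Longrightarrow> (\<lambda>x. a \<otimes> x) \<in> hom (add_monoid R) (add_monoid R)"
  by (auto simp: hom_def m_closed r_distr)

lemma right_mult_hom: "a \<in> carrier R \<Longrightarrow> (\<lambda>x. x \<otimes> a) \<in> hom (add_monoid R) (add_monoid R)"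
  by (auto simp: hom_def m_closed l_distr)

lemma l_null: "a \<in> carrier R \<Longrightarrow> \<zero> \<otimes> a = \<zero>"
  using add_hom_zero[OF right_mult_hom abelian_group_axioms abelian_group_axioms] .

lemma r_null: "a \<in> carrier R \<Longrightarrow> a \<otimes> \<zero> = \<zero>"
  using add_hom_zero[OF left_mult_hom abelian_group_axioms abelian_group_axioms] .

lemma l_minus: "a \<in> carrier R \<Longrightarrow> x \<in> carrier R \<Longrightarrow> (\<ominus> x) \<otimes> a = \<ominus> (x \<otimes> a)"
  using add_hom_minus[OF right_mult_hom abelian_group_axioms abelian_group_axioms] .

lemma r_minus: "a \<in> carrier R \<Longrightarrow> x \<in> carrier R \<Longrightarrow> a \<otimes> (\<ominus> x) = \<ominus> (a \<otimes> x)"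
  using add_hom_minus[OF left_mult_hom abelian_group_axioms abelian_group_axioms] .

lemma lsum_mult_left:
  "a \<in> carrier R \<Longrightarrow> (\<And>x. x \<in> set xs \<Longrightarrow> f x \<in> carrier R) \<Longrightarrow>
    a \<otimes> lsum R (map f xs) = lsum R (map (\<lambda>x. a \<otimes> f x) xs)"
  using add_hom_lsum[OF left_mult_hom abelian_group_axioms abelian_group_axioms] .

lemma lsum_mult_right:
  "a \<in> carrier R \<Longrightarrow> (\<And>x. x \<in> set xs \<Longrightarrow> f x \<in> carrier R) \<Longrightarrow>
    lsum R (map f xs) \<otimes> a = lsum R (map (\<lambda>x. f x \<otimes> a) xs)"
  using add_hom_lsum[OF right_mult_hom abelian_group_axioms abelian_group_axioms] .

end

section \<open>Local units, homomorphisms and nondegeneracy\<close>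

lemma (in lu_ring) common_unit:
  assumes "finite F" "F \<subseteq> carrier R"
  obtains e where "e \<in> carrier R" "e \<otimes> e = e" "\<And>r. r \<in> F \<Longrightarrow> e \<otimes> r = r" "\<And>r. r \<in> F \<Longrightarrow> r \<otimes> e = r"
  using local_units[OF assms] that by (elim bexE conjE) simp

lemma (in lu_ring) common_unit2:
  assumes "a \<in> carrier R" "b \<in> carrier R"
  obtains e where "e \<in> carrier R" "e \<otimes> e = e" "e \<otimes> a = a" "a \<otimes> e = a" "e \<otimes> b = b" "b \<otimes> e = b"
proof -
  have "finite {a, b}" "{a, b} \<subseteq> carrier R" using assms by auto
  then obtain e where "e \<in> carrier R" "e \<otimes> e = e" "\<And>r. r \<in> {a, b} \<Longrightarrow> e \<otimes> r = r" "\<And>r. r \<in> {a, b} \<Longrightarrow> r \<otimes> e = r"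
    by (rule common_unit) blast
  then show thesis by (intro that[of e]) simp_all
qed

lemma rng_homD:
  assumes "f \<in> rng_hom A B"
  shows "x \<in> carrier A \<Longrightarrow> f x \<in> carrier B"
    and "\<lbrakk>x \<in> carrier A; y \<in> carrier A\<rbrakk> \<Longrightarrow> f (x \<oplus>\<^bsub>A\<^esub> y) = f x \<oplus>\<^bsub>B\<^esub> f y"
    and "\<lbrakk>x \<in> carrier A; y \<in> carrier A\<rbrakk> \<Longrightarrow> f (x \<otimes>\<^bsub>A\<^esub> y) = f x \<otimes>\<^bsub>B\<^esub> f y"
    and "f \<in> extensional (carrier A)"
    and "f \<in> hom (add_monoid A) (add_monoid B)"
  using assms by (auto simp: rng_hom_def hom_def PiE_def)

lemma rng_homI:
  assumes "f \<in> extensional (carrier A)"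
    and "\<And>x. x \<in> carrier A \<Longrightarrow> f x \<in> carrier B"
    and "\<And>x y. \<lbrakk>x \<in> carrier A; y \<in> carrier A\<rbrakk> \<Longrightarrow> f (x \<oplus>\<^bsub>A\<^esub> y) = f x \<oplus>\<^bsub>B\<^esub> f y"
    and "\<And>x y. \<lbrakk>x \<in> carrier A; y \<in> carrier A\<rbrakk> \<Longrightarrow> f (x \<otimes>\<^bsub>A\<^esub> y) = f x \<otimes>\<^bsub>B\<^esub> f y"
  shows "f \<in> rng_hom A B"
  using assms by (auto simp: rng_hom_def PiE_iff)

text \<open>Local units may be enlarged: f(e)x = f(e)f(a)x = f(ea)x = f(a)x = x. This lets elements
  with different units share one, and it recurs in the arguments about units below.\<close>

lemma rng_hom_unit_widen:
  assumes "rng B" "f \<in> rng_hom A B" "e \<in> carrier A" "a \<in> carrier A" "x \<in> carrier B"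
  shows "\<lbrakk>e \<otimes>\<^bsub>A\<^esub> a = a; f a \<otimes>\<^bsub>B\<^esub> x = x\<rbrakk> \<Longrightarrow> f e \<otimes>\<^bsub>B\<^esub> x = x"
    and "\<lbrakk>a \<otimes>\<^bsub>A\<^esub> e = a; x \<otimes>\<^bsub>B\<^esub> f a = x\<rbrakk> \<Longrightarrow> x \<otimes>\<^bsub>B\<^esub> f e = x"
proof -
  interpret B: rng B by fact
  note fD = rng_homD[OF assms(2)]
  show "f e \<otimes>\<^bsub>B\<^esub> x = x" if "e \<otimes>\<^bsub>A\<^esub> a = a" "f a \<otimes>\<^bsub>B\<^esub> x = x"
    using B.m_assoc[of "f e" "f a" x] fD(3)[OF assms(3,4)] fD(1)[OF assms(3)] fD(1)[OF assms(4)] assms(5) that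
    by simp
  show "x \<otimes>\<^bsub>B\<^esub> f e = x" if "a \<otimes>\<^bsub>A\<^esub> e = a" "x \<otimes>\<^bsub>B\<^esub> f a = x"
    using B.m_assoc[of x "f a" "f e"] fD(3)[OF assms(4,3)] fD(1)[OF assms(3)] fD(1)[OF assms(4)] assms(5) that
    by simp
qed

text \<open>One local unit for the finitely many \<open>a b\<close> fixes each summand. It provides
  left units for the adjoined scalars, after \<open>inverse_coeffs_expand\<close> or
  \<open>rep_coeffs_expand\<close> has written them in this form.\<close>

lemma lsum_left_unit:
  assumes A: "lu_ring A" and B: "rng B" and f: "f \<in> rng_hom A B"
    and a: "\<And>b. b \<in> set bs \<Longrightarrow> a b \<in> carrier A" and x: "\<And>b. b \<in> set bs \<Longrightarrow> x b \<in> carrier B"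
  shows "\<exists>e\<in>carrier A. f e \<otimes>\<^bsub>B\<^esub> lsum B (map (\<lambda>b. f (a b) \<otimes>\<^bsub>B\<^esub> x b) bs) =
    lsum B (map (\<lambda>b. f (a b) \<otimes>\<^bsub>B\<^esub> x b) bs)"
proof -
  interpret A: lu_ring A by (rule A)
  interpret B: rng B by (rule B)
  note fD = rng_homD[OF f]
  have fin: "finite (a ` set bs)" "a ` set bs \<subseteq> carrier A" using a by auto
  obtain e where e: "e \<in> carrier A" "\<And>r. r \<in> a ` set bs \<Longrightarrow> e \<otimes>\<^bsub>A\<^esub> r = r"
    by (rule A.common_unit[OF fin]) blast
  have "f e \<otimes>\<^bsub>B\<^esub> lsum B (map (\<lambda>b. f (a b) \<otimes>\<^bsub>B\<^esub> x b) bs) =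
      lsum B (map (\<lambda>b. f e \<otimes>\<^bsub>B\<^esub> (f (a b) \<otimes>\<^bsub>B\<^esub> x b)) bs)"
    using a x e(1) by (intro B.lsum_mult_left) (simp_all add: fD B.m_closed)
  also have "\<dots> = lsum B (map (\<lambda>b. f (a b) \<otimes>\<^bsub>B\<^esub> x b) bs)"
  proof (rule lsum_cong)
    fix b assume b: "b \<in> set bs"
    show "f e \<otimes>\<^bsub>B\<^esub> (f (a b) \<otimes>\<^bsub>B\<^esub> x b) = f (a b) \<otimes>\<^bsub>B\<^esub> x b"
      using B.m_assoc[of "f e" "f (a b)" "x b"] fD(3)[OF e(1) a[OF b]] e b
      by (simp add: a x fD(1))
  qed
  finally show ?thesis using e(1) by blast
qed

lemma rng_hom_eqI:
  assumes "f \<in> rng_hom A B" "g \<in> rng_hom A C" "\<And>x. x \<in> carrier A \<Longrightarrow> f x = g x"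
  shows "f = g"
  using assms(3) rng_homD(4)[OF assms(1)] rng_homD(4)[OF assms(2)] by (intro extensionalityI) auto

lemma rng_hom_compose:
  assumes "rng A" "f \<in> rng_hom A B" "g \<in> rng_hom B C"
  shows "compose (carrier A) g f \<in> rng_hom A C"
proof -
  interpret rng A by fact
  show ?thesis
    using rng_homD[OF assms(2)] rng_homD[OF assms(3)]
    by (intro rng_homI) (auto simp: compose_def m_closed)
qed

lemma rng_hom_id: "rng A \<Longrightarrow> (\<lambda>x\<in>carrier A. x) \<in> rng_hom A A"
proof -
  assume "rng A"
  then interpret rng A .
  show ?thesis by (intro rng_homI) (auto simp: m_closed)
qed

text \<open>Products f(a)b are fixed by f(e) with ea = a, negatives inherit the unit, and sums take
  a common one; so every single element of the span that defines nondegeneracy has a unit from A.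
  With the converse \<open>nd_homI\<close>, nondegeneracy becomes a pointwise condition.\<close>

lemma nd_hom_unit:
  assumes A: "lu_ring A" and B: "rng B" and f: "f \<in> nd_hom A B" and b: "b \<in> carrier B"
  obtains e where "e \<in> carrier A" "e \<otimes>\<^bsub>A\<^esub> e = e" "f e \<otimes>\<^bsub>B\<^esub> b = b"
proof -
  interpret A: lu_ring A by (rule A)
  interpret B: rng B by (rule B)
  have f': "f \<in> rng_hom A B" using f by (simp add: nd_hom_def)
  note fD = rng_homD[OF f']
  let ?S = "{f a \<otimes>\<^bsub>B\<^esub> b | a b. a \<in> carrier A \<and> b \<in> carrier B}"
  note widen = rng_hom_unit_widen(1)[OF B f']
  have "b \<in> generate (add_monoid B) ?S" using f b by (simp add: nd_hom_def)
  then have "b \<in> carrier B \<and> (\<exists>a\<in>carrier A. f a \<otimes>\<^bsub>B\<^esub> b = b)"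
  proof (induction rule: generate.induct)
    case one
    show ?case using A.zero_closed fD(1) by (auto simp: B.r_null)
  next
    case (incl h)
    then obtain a b where h: "h = f a \<otimes>\<^bsub>B\<^esub> b" "a \<in> carrier A" "b \<in> carrier B" by blast
    obtain e where "e \<in> carrier A" "e \<otimes>\<^bsub>A\<^esub> a = a"
      using A.common_unit[of "{a}"] h by auto
    moreover from this have "f e \<otimes>\<^bsub>B\<^esub> h = h"
      using h fD(1) fD(3)[of e a, symmetric] B.m_assoc[of "f e" "f a" b] by simp
    ultimately show ?case using h fD by (auto simp: B.m_closed)
  next
    case (inv h)
    then obtain a b where h: "h = f a \<otimes>\<^bsub>B\<^esub> b" "a \<in> carrier A" "b \<in> carrier B" by blast
    obtain e where e: "e \<in> carrier A" "e \<otimes>\<^bsub>A\<^esub> a = a"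
      using A.common_unit[of "{a}"] h by auto
    have "h \<in> carrier B" using h fD by (auto simp: B.m_closed)
    moreover have "f e \<otimes>\<^bsub>B\<^esub> h = h"
      using h e fD(1) fD(3)[of e a, symmetric] B.m_assoc[of "f e" "f a" b] by simp
    ultimately have "\<ominus>\<^bsub>B\<^esub> h \<in> carrier B \<and> (\<exists>a\<in>carrier A. f a \<otimes>\<^bsub>B\<^esub> (\<ominus>\<^bsub>B\<^esub> h) = \<ominus>\<^bsub>B\<^esub> h)"
      using B.r_minus[OF fD(1)[OF e(1)], of h] e(1) by auto
    then show ?case by (simp add: a_inv_def)
  next
    case (eng h1 h2)
    then obtain a1 a2 where a: "a1 \<in> carrier A" "f a1 \<otimes>\<^bsub>B\<^esub> h1 = h1" "a2 \<in> carrier A" "f a2 \<otimes>\<^bsub>B\<^esub> h2 = h2"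
      by blast
    obtain e where e: "e \<in> carrier A" "e \<otimes>\<^bsub>A\<^esub> a1 = a1" "e \<otimes>\<^bsub>A\<^esub> a2 = a2"
      by (rule A.common_unit2[OF a(1,3)])
    have "f e \<otimes>\<^bsub>B\<^esub> h1 = h1" "f e \<otimes>\<^bsub>B\<^esub> h2 = h2"
      using widen[OF e(1) a(1) _ e(2) a(2)] widen[OF e(1) a(3) _ e(3) a(4)] eng by auto
    then have "f e \<otimes>\<^bsub>B\<^esub> (h1 \<oplus>\<^bsub>B\<^esub> h2) = h1 \<oplus>\<^bsub>B\<^esub> h2"
      using eng by (simp add: B.r_distr fD(1) e(1))
    then show ?case using e(1) eng by auto
  qed
  then obtain a where a: "a \<in> carrier A" "f a \<otimes>\<^bsub>B\<^esub> b = b" by blast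
  obtain e where e: "e \<in> carrier A" "e \<otimes>\<^bsub>A\<^esub> e = e" "e \<otimes>\<^bsub>A\<^esub> a = a"
    using A.common_unit[of "{a}"] a by auto
  show thesis using that[OF e(1,2)] widen[OF e(1) a(1) b e(3) a(2)] by simp
qed

lemma nd_homI:
  assumes B: "rng B" and f: "f \<in> rng_hom A B"
    and u: "\<And>b. b \<in> carrier B \<Longrightarrow> \<exists>a\<in>carrier A. f a \<otimes>\<^bsub>B\<^esub> b = b"
  shows "f \<in> nd_hom A B"
proof -
  interpret B: rng B by (rule B)
  let ?S = "{f a \<otimes>\<^bsub>B\<^esub> b | a b. a \<in> carrier A \<and> b \<in> carrier B}"
  have "?S \<subseteq> carrier B" using rng_homD[OF f] by (auto simp: B.m_closed)
  then have "generate (add_monoid B) ?S \<subseteq> carrier B"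
    using group.generate_incl[OF B.a_group, of ?S] by simp
  moreover have "carrier B \<subseteq> ?S"
  proof
    fix b assume b: "b \<in> carrier B"
    then obtain a where a: "a \<in> carrier A" "f a \<otimes>\<^bsub>B\<^esub> b = b" using u by blast
    show "b \<in> ?S" by (rule CollectI, rule exI[of _ a], rule exI[of _ b]) (simp add: a b)
  qed
  moreover have "?S \<subseteq> generate (add_monoid B) ?S" by (auto intro: generate.incl)
  ultimately show ?thesis using f by (auto simp: nd_hom_def)
qed

lemma nd_hom_rng_hom: "f \<in> nd_hom A B \<Longrightarrow> f \<in> rng_hom A B"
  by (simp add: nd_hom_def)

lemma nd_hom_compose:
  assumes "lu_ring A" "lu_ring B" "rng C" "f \<in> nd_hom A B" "g \<in> nd_hom B C"
  shows "compose (carrier A) g f \<in> nd_hom A C"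
proof -
  interpret A: lu_ring A by fact
  interpret B: lu_ring B by fact
  interpret C: rng C by fact
  note f = rng_homD[OF nd_hom_rng_hom[OF assms(4)]] and g = rng_homD[OF nd_hom_rng_hom[OF assms(5)]]
  show ?thesis
  proof (rule nd_homI[OF C.rng_axioms])
    show "compose (carrier A) g f \<in> rng_hom A C"
      by (rule rng_hom_compose[OF A.rng_axioms nd_hom_rng_hom[OF assms(4)] nd_hom_rng_hom[OF assms(5)]])
    fix c assume c: "c \<in> carrier C"
    obtain b where b: "b \<in> carrier B" "g b \<otimes>\<^bsub>C\<^esub> c = c"
      using nd_hom_unit[OF assms(2,3,5) c] by metis
    obtain a where a: "a \<in> carrier A" "f a \<otimes>\<^bsub>B\<^esub> b = b"
      using nd_hom_unit[OF assms(1) B.rng_axioms assms(4) b(1)] by metis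
    have "g (f a) \<otimes>\<^bsub>C\<^esub> c = c"
      by (rule rng_hom_unit_widen(1)[OF C.rng_axioms nd_hom_rng_hom[OF assms(5)] f(1)[OF a(1)] b(1) c a(2) b(2)])
    then show "\<exists>a\<in>carrier A. compose (carrier A) g f a \<otimes>\<^bsub>C\<^esub> c = c"
      using a by (auto simp: compose_def)
  qed
qed

text \<open>Since f(a) = g(h(a)), the units that f supplies for C lie in the image of g. Hence a
  factorisation through a presented ring is nondegenerate as soon as it exists.\<close>

lemma nd_hom_factor:
  assumes "lu_ring A" "rng C" "f \<in> nd_hom A C" "g \<in> rng_hom B C" "h \<in> rng_hom A B"
    and "compose (carrier A) g h = f"
  shows "g \<in> nd_hom B C"
proof (intro nd_homI assms)
  fix c assume c: "c \<in> carrier C"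
  obtain a where a: "a \<in> carrier A" "f a \<otimes>\<^bsub>C\<^esub> c = c"
    using nd_hom_unit[OF assms(1,2,3) c] by metis
  moreover have "f a = g (h a)" using a assms(6) by (auto simp: compose_def)
  ultimately show "\<exists>b\<in>carrier B. g b \<otimes>\<^bsub>C\<^esub> c = c" using rng_homD(1)[OF assms(5)] by auto
qed

lemma nd_hom_id: "lu_ring A \<Longrightarrow> (\<lambda>x\<in>carrier A. x) \<in> nd_hom A A"
proof -
  assume "lu_ring A"
  then interpret lu_ring A .
  show ?thesis
  proof (intro nd_homI rng_hom_id rng_axioms)
    fix b assume "b \<in> carrier A"
    then show "\<exists>a\<in>carrier A. (\<lambda>x\<in>carrier A. x) a \<otimes>\<^bsub>A\<^esub> b = b"
      using common_unit[of "{b}"] by force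
  qed
qed

text \<open>The units of the members of a finite set are pulled back to A, where one idempotent
  dominates them all; its image is again idempotent.\<close>

lemma lu_ring_locally_unitalI:
  assumes A: "lu_ring A" and B: "rng B" and f: "f \<in> rng_hom A B"
    and u: "\<And>b. b \<in> carrier B \<Longrightarrow> \<exists>a\<in>carrier A. f a \<otimes>\<^bsub>B\<^esub> b = b \<and> b \<otimes>\<^bsub>B\<^esub> f a = b"
  shows "lu_ring B"
proof -
  interpret A: lu_ring A by (rule A)
  interpret B: rng B by (rule B)
  note fD = rng_homD[OF f]
  show ?thesis
  proof (intro lu_ring.intro B lu_ring_axioms.intro)
    fix F assume F: "finite F" "F \<subseteq> carrier B"
    have "\<forall>b\<in>F. \<exists>a. a \<in> carrier A \<and> f a \<otimes>\<^bsub>B\<^esub> b = b \<and> b \<otimes>\<^bsub>B\<^esub> f a = b" using u F by blast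
    from bchoice[OF this] obtain a
      where a: "\<And>b. b \<in> F \<Longrightarrow> a b \<in> carrier A \<and> f (a b) \<otimes>\<^bsub>B\<^esub> b = b \<and> b \<otimes>\<^bsub>B\<^esub> f (a b) = b" by blast
    have aF: "finite (a ` F)" "a ` F \<subseteq> carrier A" using F(1) a by blast+
    obtain e where e: "e \<in> carrier A" "e \<otimes>\<^bsub>A\<^esub> e = e"
      "\<And>x. x \<in> a ` F \<Longrightarrow> e \<otimes>\<^bsub>A\<^esub> x = x" "\<And>x. x \<in> a ` F \<Longrightarrow> x \<otimes>\<^bsub>A\<^esub> e = x"
      by (rule A.common_unit[OF aF]) blast
    have "f e \<otimes>\<^bsub>B\<^esub> b = b \<and> b \<otimes>\<^bsub>B\<^esub> f e = b" if "b \<in> F" for b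
      using rng_hom_unit_widen[OF B f e(1)] e(3,4)[OF imageI[OF that]] a[OF that] F(2) that by blast
    moreover have "f e \<otimes>\<^bsub>B\<^esub> f e = f e" using fD(3)[OF e(1) e(1), symmetric] e(2) by simp
    ultimately show "\<exists>e\<in>carrier B. e \<otimes>\<^bsub>B\<^esub> e = e \<and> (\<forall>r\<in>F. e \<otimes>\<^bsub>B\<^esub> r = r \<and> r \<otimes>\<^bsub>B\<^esub> e = r)"
      using e fD(1) by blast
  qed
qed

section \<open>Rings presented by generators and relations\<close>

text \<open>
  A relation is a pair of lists of words; each list stands for the sum of the products of its words.
\<close>

definition words :: "'x set \<Rightarrow> 'x list set" where
  "words G = {w. w \<noteq> [] \<and> set w \<subseteq> G}"

text \<open>The value at the empty word is a dummy, since a ring without unit has no empty product;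
  \<open>words\<close> excludes that word.\<close>

fun wprod :: "'d ring \<Rightarrow> ('x \<Rightarrow> 'd) \<Rightarrow> 'x list \<Rightarrow> 'd" where
  "wprod D \<rho> [] = \<zero>\<^bsub>D\<^esub>"
| "wprod D \<rho> [g] = \<rho> g"
| "wprod D \<rho> (g # h # w) = \<rho> g \<otimes>\<^bsub>D\<^esub> wprod D \<rho> (h # w)"

definition satisfies :: "'d ring \<Rightarrow> ('x \<Rightarrow> 'd) \<Rightarrow> ('x list list \<times> 'x list list) set \<Rightarrow> bool" where
  "satisfies D \<rho> E \<longleftrightarrow> (\<forall>(v, w)\<in>E. lsum D (map (wprod D \<rho>) v) = lsum D (map (wprod D \<rho>) w))"

definition formal :: "'x list list \<Rightarrow> 'x list \<Rightarrow>\<^sub>0 int" where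
  "formal ws = sum_list (map frag_of ws)"

text \<open>Concatenation of words extended biadditively: the product of the free non-unital ring on
  the letters.\<close>

definition fmult :: "('x list \<Rightarrow>\<^sub>0 int) \<Rightarrow> ('x list \<Rightarrow>\<^sub>0 int) \<Rightarrow> 'x list \<Rightarrow>\<^sub>0 int" where
  "fmult c d = frag_extend (\<lambda>v. frag_extend (\<lambda>w. frag_of (v @ w)) d) c"

lemma fmult_of: "fmult (frag_of v) (frag_of w) = frag_of (v @ w)"
  by (simp add: fmult_def)

lemma fmult_add_left: "fmult (a + b) c = fmult a c + fmult b c"
  by (simp add: fmult_def frag_extend_add)

lemma fmult_diff_left: "fmult (a - b) c = fmult a c - fmult b c"
  by (simp add: fmult_def frag_extend_diff)

lemma fmult_zero_left: "fmult 0 c = 0"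
  by (simp add: fmult_def)

text \<open>The second factor sits inside the function handed to the outer
  \<open>frag_extend\<close>, so additivity in it is a statement about functions and takes an
  induction of its own.\<close>

lemma fmult_diff_right: "fmult a (b - c) = fmult a b - fmult a c"
proof -
  have "frag_extend (\<lambda>v. f v - g v) c = frag_extend f c - frag_extend g c"
    for f g :: "'a list \<Rightarrow> 'a list \<Rightarrow>\<^sub>0 int" and c :: "'a list \<Rightarrow>\<^sub>0 int"
    using subset_UNIV by (induction c rule: frag_induction) (auto simp: frag_extend_diff)
  then show ?thesis by (simp add: fmult_def frag_extend_diff)
qed

lemma fmult_zero_right: "fmult a 0 = 0"
  using fmult_diff_right[of a 0 0] by simp

lemma fmult_add_right: "fmult a (b + c) = fmult a b + fmult a c"
  using fmult_diff_right[of a "b + c" c] by simp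

lemma fmult_assoc: "fmult (fmult a b) c = fmult a (fmult b c)"
  using subset_UNIV
proof (induction a rule: frag_induction)
  case (one u)
  show ?case using subset_UNIV
  proof (induction b rule: frag_induction)
    case (one v)
    show ?case using subset_UNIV
      by (induction c rule: frag_induction) (auto simp: fmult_of fmult_diff_right fmult_zero_right)
  qed (auto simp: fmult_diff_left fmult_diff_right fmult_zero_left fmult_zero_right)
qed (auto simp: fmult_diff_left fmult_zero_left)

section \<open>The quotient of the free ring by the ideal of relators\<close>

locale presentation =
  fixes G :: "'x set" and E :: "('x list list \<times> 'x list list) set"
  assumes E_words: "(v, w) \<in> E \<Longrightarrow> set v \<subseteq> words G \<and> set w \<subseteq> words G"
begin

definition free :: "('x list \<Rightarrow>\<^sub>0 int) set" where
  "free = {c. Poly_Mapping.keys c \<subseteq> words G}"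

lemma words_append: "v \<in> words G \<Longrightarrow> w \<in> words G \<Longrightarrow> v @ w \<in> words G"
  by (auto simp: words_def)

lemma free_zero: "0 \<in> free"
  by (simp add: free_def)

lemma free_of: "w \<in> words G \<Longrightarrow> frag_of w \<in> free"
  by (simp add: free_def)

lemma free_diff: "a \<in> free \<Longrightarrow> b \<in> free \<Longrightarrow> a - b \<in> free"
  unfolding free_def using keys_diff[of a b] by blast

lemma free_add: "a \<in> free \<Longrightarrow> b \<in> free \<Longrightarrow> a + b \<in> free"
  unfolding free_def using keys_add[of a b] by blast

lemma free_minus: "a \<in> free \<Longrightarrow> - a \<in> free"
  by (simp add: free_def)

lemma free_induct [consumes 1, case_names zero of diff]:
  assumes "c \<in> free" "P 0" "\<And>w. w \<in> words G \<Longrightarrow> P (frag_of w)"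
    and "\<And>a b. a \<in> free \<Longrightarrow> b \<in> free \<Longrightarrow> P a \<Longrightarrow> P b \<Longrightarrow> P (a - b)"
  shows "P c"
proof -
  have "c \<in> free \<and> P c"
    using assms(1)[unfolded free_def, simplified]
    by (induction rule: frag_induction) (auto intro: assms free_zero free_of free_diff)
  then show ?thesis ..
qed

lemma free_mult: "a \<in> free \<Longrightarrow> b \<in> free \<Longrightarrow> fmult a b \<in> free"
proof (induction a rule: free_induct)
  case (of v)
  show ?case using of.prems
    by (induction b rule: free_induct)
      (auto simp: fmult_of fmult_diff_right fmult_zero_right free_zero
        intro!: free_of words_append free_diff of.hyps)
qed (auto simp: fmult_diff_left fmult_zero_left free_zero free_diff)

lemma free_formal: "set ws \<subseteq> words G \<Longrightarrow> formal ws \<in> free"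
  by (induction ws) (auto simp: formal_def free_zero free_of free_add)

inductive_set relator_ideal :: "('x list \<Rightarrow>\<^sub>0 int) set" where
  rel: "(v, w) \<in> E \<Longrightarrow> formal v - formal w \<in> relator_ideal"
| zero: "0 \<in> relator_ideal"
| diff: "a \<in> relator_ideal \<Longrightarrow> b \<in> relator_ideal \<Longrightarrow> a - b \<in> relator_ideal"
| left: "a \<in> relator_ideal \<Longrightarrow> c \<in> free \<Longrightarrow> fmult c a \<in> relator_ideal"
| right: "a \<in> relator_ideal \<Longrightarrow> c \<in> free \<Longrightarrow> fmult a c \<in> relator_ideal"

lemma ideal_free: "a \<in> relator_ideal \<Longrightarrow> a \<in> free"
  by (induction rule: relator_ideal.induct)
    (use E_words in \<open>auto intro!: free_zero free_diff free_mult free_formal\<close>)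

lemma ideal_minus: "a \<in> relator_ideal \<Longrightarrow> - a \<in> relator_ideal"
  using relator_ideal.diff[OF relator_ideal.zero, of a] by simp

lemma ideal_add: "a \<in> relator_ideal \<Longrightarrow> b \<in> relator_ideal \<Longrightarrow> a + b \<in> relator_ideal"
  using relator_ideal.diff[of a "- b"] ideal_minus[of b] by simp

definition cls :: "('x list \<Rightarrow>\<^sub>0 int) \<Rightarrow> ('x list \<Rightarrow>\<^sub>0 int) set" where
  "cls c = {d. d - c \<in> relator_ideal}"

definition rep :: "('x list \<Rightarrow>\<^sub>0 int) set \<Rightarrow> 'x list \<Rightarrow>\<^sub>0 int" where
  "rep X = (SOME c. c \<in> X)"

text \<open>Elements are full cosets and the operations go through chosen representatives; that the
  choice does not matter is \<open>quot_add\<close> and \<open>quot_mult\<close>. With the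
  generators used below, this puts the ring into the types \<open>cohn_elt\<close> and
  \<open>cov_elt\<close>.\<close>

definition quot :: "('x list \<Rightarrow>\<^sub>0 int) set ring" where
  "quot = \<lparr>carrier = cls ` free, mult = (\<lambda>X Y. cls (fmult (rep X) (rep Y))), one = undefined,
     zero = cls 0, add = (\<lambda>X Y. cls (rep X + rep Y))\<rparr>"

definition gen :: "'x \<Rightarrow> ('x list \<Rightarrow>\<^sub>0 int) set" where
  "gen g = cls (frag_of [g])"

lemma cls_eq_iff: "cls c = cls d \<longleftrightarrow> c - d \<in> relator_ideal"
proof
  assume "cls c = cls d"
  moreover have "c \<in> cls c" by (simp add: cls_def relator_ideal.zero)
  ultimately have "c \<in> cls d" by simp
  then show "c - d \<in> relator_ideal" by (simp add: cls_def)
next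
  assume cd: "c - d \<in> relator_ideal"
  have "x - c \<in> relator_ideal \<longleftrightarrow> x - d \<in> relator_ideal" for x
    using ideal_add[OF _ cd, of "x - c"] relator_ideal.diff[OF _ cd, of "x - d"] by auto
  then show "cls c = cls d" by (simp add: cls_def)
qed

lemma rep_cls: "rep (cls c) - c \<in> relator_ideal"
proof -
  have "c \<in> cls c" by (simp add: cls_def relator_ideal.zero)
  then have "rep (cls c) \<in> cls c" unfolding rep_def by (rule someI)
  then show ?thesis by (simp add: cls_def)
qed

lemma rep_free: "c \<in> free \<Longrightarrow> rep (cls c) \<in> free"
  using free_add[OF ideal_free[OF rep_cls[of c]], of c] by simp

lemma quot_carrier: "carrier quot = cls ` free"
  and quot_zero: "\<zero>\<^bsub>quot\<^esub> = cls 0"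
  by (simp_all add: quot_def)

lemma quot_add: "cls c \<oplus>\<^bsub>quot\<^esub> cls d = cls (c + d)"
proof -
  have "(rep (cls c) - c) + (rep (cls d) - d) \<in> relator_ideal"
    by (intro ideal_add rep_cls)
  then show ?thesis by (simp add: quot_def cls_eq_iff algebra_simps)
qed

lemma quot_mult:
  assumes "c \<in> free" "d \<in> free"
  shows "cls c \<otimes>\<^bsub>quot\<^esub> cls d = cls (fmult c d)"
proof -
  \<comment> \<open>With representatives c' and d' of the classes of c and d, this is c'd' - cd =
    (c' - c)d' + c(d' - d).\<close>
  have "fmult (rep (cls c) - c) (rep (cls d)) + fmult c (rep (cls d) - d) \<in> relator_ideal"
    using assms by (intro ideal_add relator_ideal.left relator_ideal.right rep_cls rep_free)
  then show ?thesis by (simp add: quot_def cls_eq_iff fmult_diff_left fmult_diff_right)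
qed

lemma abelian_group_quot: "abelian_group quot"
proof (rule abelian_groupI)
  fix X assume "X \<in> carrier quot"
  then obtain c where "c \<in> free" "X = cls c" by (auto simp: quot_carrier)
  then show "\<exists>Y\<in>carrier quot. Y \<oplus>\<^bsub>quot\<^esub> X = \<zero>\<^bsub>quot\<^esub>"
    by (intro bexI[of _ "cls (- c)"]) (auto simp: quot_add quot_zero quot_carrier free_minus)
qed (auto simp: quot_carrier quot_add quot_zero free_add free_zero ac_simps)

lemma rng_quot: "rng quot"
  by (intro rng.intro abelian_group_quot rng_axioms.intro)
    (auto simp: quot_carrier quot_add quot_mult free_add free_mult fmult_assoc
      fmult_add_left fmult_add_right)

lemma gen_closed: "g \<in> G \<Longrightarrow> gen g \<in> carrier quot"
  by (auto simp: gen_def quot_carrier words_def intro!: imageI free_of)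

lemma wprod_gen: "w \<in> words G \<Longrightarrow> wprod quot gen w = cls (frag_of w)"
proof (induction w rule: induct_list012)
  case (3 g h w)
  then have "wprod quot gen (h # w) = cls (frag_of (h # w))" by (simp add: words_def)
  moreover have "frag_of [g] \<in> free" "frag_of (h # w) \<in> free"
    using 3(3) by (auto intro!: free_of simp: words_def)
  ultimately show ?case by (simp add: gen_def[of g] quot_mult fmult_of)
qed (auto simp: words_def gen_def)

lemma satisfies_quot: "satisfies quot gen E"
proof -
  have "lsum quot (map (wprod quot gen) ws) = cls (formal ws)" if "set ws \<subseteq> words G" for ws
    using that by (induction ws) (auto simp: formal_def quot_zero quot_add wprod_gen)
  moreover have "cls (formal v) = cls (formal w)" if "(v, w) \<in> E" for v w
    using relator_ideal.rel[OF that] by (simp add: cls_eq_iff)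
  ultimately show ?thesis using E_words by (auto simp: satisfies_def)
qed

text \<open>The classes of the generators generate the quotient as a ring; the case
  \<open>diff\<close> covers sums and negatives at once.\<close>

lemma quot_induct [consumes 1, case_names gen mult zero diff]:
  assumes X: "X \<in> carrier quot"
    and gen: "\<And>g. g \<in> G \<Longrightarrow> P (gen g)"
    and mult: "\<And>X Y. X \<in> carrier quot \<Longrightarrow> Y \<in> carrier quot \<Longrightarrow> P X \<Longrightarrow> P Y \<Longrightarrow> P (X \<otimes>\<^bsub>quot\<^esub> Y)"
    and zero: "P \<zero>\<^bsub>quot\<^esub>"
    and diff: "\<And>X Y. X \<in> carrier quot \<Longrightarrow> Y \<in> carrier quot \<Longrightarrow> P X \<Longrightarrow> P Y \<Longrightarrow> P (X \<ominus>\<^bsub>quot\<^esub> Y)"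
  shows "P X"
proof -
  interpret quot: rng quot by (rule rng_quot)
  have word: "P (wprod quot gen w) \<and> wprod quot gen w \<in> carrier quot" if "w \<in> words G" for w
    using that
    by (induction w rule: induct_list012)
      (auto simp: words_def intro!: gen mult gen_closed quot.m_closed)
  obtain c where c: "c \<in> free" "X = cls c" using X by (auto simp: quot_carrier)
  have "P (cls c)" using c(1)
  proof (induction rule: free_induct)
    case zero show ?case using assms(4) by (simp add: quot_zero)
  next
    case (of w) show ?case using word[OF of] wprod_gen[OF of] by simp
  next
    case (diff a b)
    have "cls (a - b) \<oplus>\<^bsub>quot\<^esub> cls b = cls a" by (simp add: quot_add)
    moreover have "cls (a - b) \<in> carrier quot" "cls a \<in> carrier quot" "cls b \<in> carrier quot"
      using diff by (auto simp: quot_carrier free_diff)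
    ultimately have "cls (a - b) = cls a \<ominus>\<^bsub>quot\<^esub> cls b"
      by (metis quot.minus_eq quot.a_assoc quot.a_inv_closed quot.r_neg quot.r_zero)
    then show ?case using assms(5)[of "cls a" "cls b"] diff by (auto simp: quot_carrier)
  qed
  then show ?thesis using c by simp
qed

lemma quot_hom_eqI:
  assumes D: "rng D" and f: "f \<in> rng_hom quot D" and h: "h \<in> rng_hom quot D"
    and eq: "\<And>g. g \<in> G \<Longrightarrow> f (gen g) = h (gen g)"
  shows "f = h"
proof (rule rng_hom_eqI[OF f h])
  interpret quot: rng quot by (rule rng_quot)
  interpret D: rng D by (rule D)
  fix X assume "X \<in> carrier quot"
  then show "f X = h X"
  proof (induction rule: quot_induct)
    case zero
    show ?case
      using add_hom_zero[OF rng_homD(5)[OF f]] add_hom_zero[OF rng_homD(5)[OF h]]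
        abelian_group_quot D.abelian_group_axioms by simp
  next
    case (diff X Y)
    then show ?case
      using add_hom_minus[OF rng_homD(5)[OF f]] add_hom_minus[OF rng_homD(5)[OF h]]
        abelian_group_quot D.abelian_group_axioms rng_homD(2)[OF f] rng_homD(2)[OF h]
      by (simp add: quot.minus_eq)
  qed (auto simp: eq rng_homD(3)[OF f] rng_homD(3)[OF h])
qed

section \<open>Homomorphisms out of a presented ring\<close>

lemma wprod_closed:
  assumes "rng D" "\<And>g. g \<in> G \<Longrightarrow> \<rho> g \<in> carrier D" "w \<in> words G"
  shows "wprod D \<rho> w \<in> carrier D"
proof -
  interpret D: rng D by fact
  show ?thesis using assms(3)
    by (induction w rule: induct_list012) (auto simp: words_def assms(2) intro!: D.m_closed)
qed

lemma wprod_append: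
  assumes "rng D" "\<And>g. g \<in> G \<Longrightarrow> \<rho> g \<in> carrier D" "v \<in> words G" "w \<in> words G"
  shows "wprod D \<rho> (v @ w) = wprod D \<rho> v \<otimes>\<^bsub>D\<^esub> wprod D \<rho> w"
proof -
  interpret D: rng D by fact
  have wD: "wprod D \<rho> w \<in> carrier D" if "w \<in> words G" for w
    using wprod_closed[OF D.rng_axioms assms(2) that] .
  show ?thesis using assms(3)
  proof (induction v rule: induct_list012)
    case (2 g)
    then show ?case using assms(4) by (cases w) (auto simp: words_def)
  next
    case (3 g h v)
    then have hv: "h # v \<in> words G" by (auto simp: words_def)
    from this have "wprod D \<rho> ((h # v) @ w) = wprod D \<rho> (h # v) \<otimes>\<^bsub>D\<^esub> wprod D \<rho> w" using 3 by blast
    then show ?case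
      using assms(2)[of g] 3(3) wD[OF hv] wD[OF assms(4)]
      by (simp add: D.m_assoc words_def)
  qed (auto simp: words_def)
qed

text \<open>Evaluation of words extends additively to a map k on the free abelian group. It is
  multiplicative by induction on both factors, and its vanishing on the relators spreads to the
  whole ideal, so k descends to classes.\<close>

theorem quot_universal:
  assumes D: "rng D" and \<rho>: "\<And>g. g \<in> G \<Longrightarrow> \<rho> g \<in> carrier D" and sat: "satisfies D \<rho> E"
  obtains h where "h \<in> rng_hom quot D" "\<And>g. g \<in> G \<Longrightarrow> h (gen g) = \<rho> g"
proof -
  interpret D: rng D by (rule D)
  have wD: "wprod D \<rho> w \<in> carrier D" if "w \<in> words G" for w
    using wprod_closed[OF D \<rho> that] .
  have "wprod D \<rho> ` words G \<subseteq> carrier (add_monoid D)" using wD by auto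
  then obtain k where k: "k \<in> hom (free_Abelian_group (words G)) (add_monoid D)"
    "\<And>w. w \<in> words G \<Longrightarrow> k (frag_of w) = wprod D \<rho> w"
    by (rule comm_group.free_Abelian_group_universal[OF D.a_comm_group]) blast
  have kc: "k a \<in> carrier D" if "a \<in> free" for a
    using that k(1) by (auto simp: free_def hom_def)
  have k_add: "k (a + b) = k a \<oplus>\<^bsub>D\<^esub> k b" if "a \<in> free" "b \<in> free" for a b
    using that k(1) by (auto simp: free_def hom_def)
  have k0: "k 0 = \<zero>\<^bsub>D\<^esub>"
    using hom_one[OF k(1)] D.a_group by simp
  have k_diff: "k (a - b) = k a \<ominus>\<^bsub>D\<^esub> k b" if "a \<in> free" "b \<in> free" for a b
    using k_add[OF free_diff[OF that] that(2)] kc[OF that(1)] kc[OF that(2)] kc[OF free_diff[OF that]]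
    by (simp add: D.minus_eq D.a_assoc D.r_neg)
  have k_mult: "k (fmult a b) = k a \<otimes>\<^bsub>D\<^esub> k b" if "a \<in> free" "b \<in> free" for a b
    using that
  proof (induction a rule: free_induct)
    case (of v)
    show ?case using of.prems
    proof (induction b rule: free_induct)
      case zero show ?case using wD[OF of.hyps] by (simp add: fmult_zero_right k0 k(2)[OF of.hyps] D.r_null)
    next
      case (of w) with \<open>v \<in> words G\<close> show ?case
        by (simp add: fmult_of k(2) words_append wprod_append[OF D \<rho>])
    next
      case (diff a b) then show ?case using wD[OF of.hyps] kc free_of[OF of.hyps]
        by (simp add: fmult_diff_right k_diff free_mult D.minus_eq D.r_distr D.r_minus)
    qed
  next
    case (diff a b') then show ?case using kc
      by (simp add: fmult_diff_left k_diff free_mult D.minus_eq D.l_distr D.l_minus)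
  qed (simp add: fmult_zero_left k0 D.l_null kc)
  have k_formal: "k (formal ws) = lsum D (map (wprod D \<rho>) ws)" if "set ws \<subseteq> words G" for ws
    using that
  proof (induction ws)
    case (Cons w ws)
    then show ?case using k_add[of "frag_of w" "formal ws"] free_formal[of ws]
      by (simp add: formal_def free_of k(2))
  qed (simp add: formal_def k0)
  have k_ideal: "k a = \<zero>\<^bsub>D\<^esub>" if "a \<in> relator_ideal" for a
    using that
  proof (induction rule: relator_ideal.induct)
    case (rel v w)
    have "formal v \<in> free" "formal w \<in> free" "k (formal v) = k (formal w)"
      using E_words[OF rel] sat rel by (auto simp: free_formal k_formal satisfies_def)
    then show ?case by (simp add: k_diff D.minus_eq D.r_neg kc)
  qed (auto simp: k0 k_diff k_mult ideal_free kc D.minus_eq D.l_null D.r_null)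
  define h where "h = restrict (\<lambda>X. k (rep X)) (carrier quot)"
  have h_cls: "h (cls c) = k c" if "c \<in> free" for c
  proof -
    have "k (rep (cls c)) = k c"
      using k_add[OF ideal_free[OF rep_cls[of c]] that] k_ideal[OF rep_cls[of c]] kc[OF that] by simp
    then show ?thesis using that by (auto simp: h_def quot_carrier)
  qed
  show thesis
  proof (rule that)
    show "h \<in> rng_hom quot D"
    proof (rule rng_homI)
      show "h \<in> extensional (carrier quot)" by (simp add: h_def)
    qed (auto simp: quot_carrier h_cls kc quot_add quot_mult free_add free_mult k_add k_mult)
    show "h (gen g) = \<rho> g" if "g \<in> G" for g
      using that k(2)[of "[g]"] h_cls[of "frag_of [g]"] free_of[of "[g]"] by (simp add: gen_def words_def)
  qed
qed

text \<open>Only generators are tested, and their left and right units may differ. A product takes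
  the left unit of its first factor and the right unit of its second, a difference takes common
  units, and A supplies a single element above all of these.\<close>

lemma quot_lu_ring:
  assumes A: "lu_ring A" and f: "f \<in> rng_hom A quot"
    and u: "\<And>g. g \<in> G \<Longrightarrow> \<exists>a\<in>carrier A. f a \<otimes>\<^bsub>quot\<^esub> gen g = gen g"
      "\<And>g. g \<in> G \<Longrightarrow> \<exists>a\<in>carrier A. gen g \<otimes>\<^bsub>quot\<^esub> f a = gen g"
  shows "lu_ring quot" "f \<in> nd_hom A quot"
proof -
  interpret A: lu_ring A by (rule A)
  interpret quot: rng quot by (rule rng_quot)
  note fD = rng_homD[OF f]
  note left = rng_hom_unit_widen(1)[OF quot.rng_axioms f]
    and right = rng_hom_unit_widen(2)[OF quot.rng_axioms f]
  have "\<exists>a\<in>carrier A. f a \<otimes>\<^bsub>quot\<^esub> X = X \<and> X \<otimes>\<^bsub>quot\<^esub> f a = X" if "X \<in> carrier quot" for X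
    using that
  proof (induction rule: quot_induct)
    case (gen g)
    obtain a b where ab: "a \<in> carrier A" "f a \<otimes>\<^bsub>quot\<^esub> gen g = gen g" "b \<in> carrier A" "gen g \<otimes>\<^bsub>quot\<^esub> f b = gen g"
      using u[OF gen] by blast
    obtain e where e: "e \<in> carrier A" "e \<otimes>\<^bsub>A\<^esub> a = a" "a \<otimes>\<^bsub>A\<^esub> e = a" "e \<otimes>\<^bsub>A\<^esub> b = b" "b \<otimes>\<^bsub>A\<^esub> e = b"
      by (rule A.common_unit2[of a b]) (use ab in simp_all)
    show ?case
      using left[OF e(1) ab(1) gen_closed[OF gen] e(2) ab(2)]
        right[OF e(1) ab(3) gen_closed[OF gen] e(5) ab(4)] e(1) by blast
  next
    case zero
    show ?case using A.zero_closed fD(1) by (auto simp: quot.l_null quot.r_null)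
  next
    case (mult X Y)
    then obtain a b where ab: "a \<in> carrier A" "f a \<otimes>\<^bsub>quot\<^esub> X = X" "b \<in> carrier A" "Y \<otimes>\<^bsub>quot\<^esub> f b = Y" by blast
    obtain e where e: "e \<in> carrier A" "e \<otimes>\<^bsub>A\<^esub> a = a" "a \<otimes>\<^bsub>A\<^esub> e = a" "e \<otimes>\<^bsub>A\<^esub> b = b" "b \<otimes>\<^bsub>A\<^esub> e = b"
      by (rule A.common_unit2[of a b]) (use ab in simp_all)
    have "f e \<otimes>\<^bsub>quot\<^esub> X = X" "Y \<otimes>\<^bsub>quot\<^esub> f e = Y"
      by (rule left[OF e(1) ab(1) mult.hyps(1) e(2) ab(2)], rule right[OF e(1) ab(3) mult.hyps(2) e(5) ab(4)])
    then have "f e \<otimes>\<^bsub>quot\<^esub> (X \<otimes>\<^bsub>quot\<^esub> Y) = X \<otimes>\<^bsub>quot\<^esub> Y" "(X \<otimes>\<^bsub>quot\<^esub> Y) \<otimes>\<^bsub>quot\<^esub> f e = X \<otimes>\<^bsub>quot\<^esub> Y"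
      using mult.hyps fD(1)[OF e(1)] by (simp_all add: quot.m_assoc flip: quot.m_assoc[of "f e" X Y])
    then show ?case using e(1) by blast
  next
    case (diff X Y)
    then obtain a b where ab: "a \<in> carrier A" "f a \<otimes>\<^bsub>quot\<^esub> X = X" "X \<otimes>\<^bsub>quot\<^esub> f a = X"
      "b \<in> carrier A" "f b \<otimes>\<^bsub>quot\<^esub> Y = Y" "Y \<otimes>\<^bsub>quot\<^esub> f b = Y" by blast
    obtain e where e: "e \<in> carrier A" "e \<otimes>\<^bsub>A\<^esub> a = a" "a \<otimes>\<^bsub>A\<^esub> e = a" "e \<otimes>\<^bsub>A\<^esub> b = b" "b \<otimes>\<^bsub>A\<^esub> e = b"
      by (rule A.common_unit2[of a b]) (use ab in simp_all)
    have "f e \<otimes>\<^bsub>quot\<^esub> X = X" "X \<otimes>\<^bsub>quot\<^esub> f e = X" "f e \<otimes>\<^bsub>quot\<^esub> Y = Y" "Y \<otimes>\<^bsub>quot\<^esub> f e = Y"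
      by (rule left[OF e(1) ab(1) diff.hyps(1) e(2) ab(2)], rule right[OF e(1) ab(1) diff.hyps(1) e(3) ab(3)],
        rule left[OF e(1) ab(4) diff.hyps(2) e(4) ab(5)], rule right[OF e(1) ab(4) diff.hyps(2) e(5) ab(6)])
    then show ?case
      using e(1) fD(1)[OF e(1)] diff.hyps
      by (intro bexI[of _ e]) (simp_all add: quot.minus_eq quot.l_distr quot.r_distr quot.l_minus quot.r_minus)
  qed
  then show "lu_ring quot" "f \<in> nd_hom A quot"
    using lu_ring_locally_unitalI[OF A quot.rng_axioms f] nd_homI[OF quot.rng_axioms f] by blast+
qed

end

section \<open>Tensor products\<close>

text \<open>\<open>tensor_lift\<close> looks only at the additive structure. So it passes between
  records that differ in other fields, such as D and \<open>regular D\<close>, or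
  \<open>tensor\<close> and the auxiliary record inside its definition.\<close>

lemma tensor_lift_cong:
  "\<lbrakk>carrier G = carrier H; add G = add H; zero G = zero H\<rbrakk> \<Longrightarrow> tensor_lift G b = tensor_lift H b"
  by (intro ext) (simp add: tensor_lift_def finsum_def finprod_def add_pow_def int_pow_def nat_pow_def m_inv_def
      Let_def cong: if_cong)

lemma tensor_simps:
  shows carrier_tensor: "carrier (tensor M R N) = carrier (tensor_group M R N)"
    and add_tensor: "add (tensor M R N) = mult (tensor_group M R N)"
    and zero_tensor: "zero (tensor M R N) = one (tensor_group M R N)"
  by (simp_all add: tensor_def ring.defs rmod.defs Let_def)

lemma ract_tensor:
  "ract (tensor M R N) t s = tensor_lift (tensor M R N) (\<lambda>x y. tens M R N x (ract N y s)) t"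
proof -
  have "tensor_lift (tensor M R N) b t = tensor_lift \<lparr>carrier = carrier (tensor_group M R N),
     mult = undefined, one = undefined, zero = one (tensor_group M R N),
     add = mult (tensor_group M R N)\<rparr> b t" for b :: "_ \<Rightarrow> _ \<Rightarrow> _"
    by (rule fun_cong[OF tensor_lift_cong]) (simp_all add: tensor_simps)
  then show ?thesis by (simp add: tensor_def ring.defs rmod.defs Let_def)
qed

lemma carrier_bitensor: "carrier (bitensor M R N) = carrier (tensor M R N)"
  by (simp add: bitensor_def rmod.defs bimod.defs)

text \<open>The hypotheses of \<open>tensor_lift\<close> on the map b, bundled.\<close>

definition balanced ::
  "'r ring \<Rightarrow> ('r, 'm, 'y) rmod_scheme \<Rightarrow> ('r, 's, 'n, 'z) bimod_scheme \<Rightarrow> ('g, 'x) ring_scheme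
    \<Rightarrow> ('m \<Rightarrow> 'n \<Rightarrow> 'g) \<Rightarrow> bool" where
  "balanced R M N G b \<longleftrightarrow>
     (\<forall>x\<in>carrier M. \<forall>y\<in>carrier N. b x y \<in> carrier G) \<and>
     (\<forall>x\<in>carrier M. \<forall>x'\<in>carrier M. \<forall>y\<in>carrier N. b (x \<oplus>\<^bsub>M\<^esub> x') y = b x y \<oplus>\<^bsub>G\<^esub> b x' y) \<and>
     (\<forall>x\<in>carrier M. \<forall>y\<in>carrier N. \<forall>y'\<in>carrier N. b x (y \<oplus>\<^bsub>N\<^esub> y') = b x y \<oplus>\<^bsub>G\<^esub> b x y') \<and>
     (\<forall>x\<in>carrier M. \<forall>r\<in>carrier R. \<forall>y\<in>carrier N. b (ract M x r) y = b x (lact N r y))"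

lemma (in right_module) ract_hom: "r \<in> carrier R \<Longrightarrow> (\<lambda>x. ract M x r) \<in> hom (add_monoid M) (add_monoid M)"
  by (auto simp: hom_def ract_closed ract_add_left)

lemma (in right_module) ract_zero_right: "x \<in> carrier M \<Longrightarrow> ract M x \<zero>\<^bsub>R\<^esub> = \<zero>\<^bsub>M\<^esub>"
  using ract_add_right[of x "\<zero>\<^bsub>R\<^esub>" "\<zero>\<^bsub>R\<^esub>"] ract_closed[of x "\<zero>\<^bsub>R\<^esub>"] by simp

locale tensor_pair = M: right_module R M + N: bimodule R S N
  for R :: "'r ring" and S :: "'s ring" and M :: "('r, 'm, 'y) rmod_scheme"
    and N :: "('r, 's, 'n, 'z) bimod_scheme"
begin

abbreviation T where "T \<equiv> tensor M R N"
abbreviation tn where "tn \<equiv> tens M R N"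
abbreviation (input) FG where "FG \<equiv> free_Abelian_group (carrier M \<times> carrier N)"
abbreviation (input) K where "K \<equiv> tensor_ker M R N"

lemma rels_closed: "tensor_rels M R N \<subseteq> carrier FG"
  unfolding tensor_rels_def
  using M.ract_closed N.lact_closed
  by (auto dest!: subsetD[OF keys_diff])

lemma K_subgroup: "subgroup K FG"
  unfolding tensor_ker_def by (rule group.generate_is_subgroup[OF group_free_Abelian_group rels_closed])

lemma K_normal: "normal K FG"
  by (rule comm_group.subgroup_imp_normal[OF abelian_free_Abelian_group K_subgroup])

lemma coset_eqI:
  assumes "c - d \<in> K" "Poly_Mapping.keys c \<subseteq> carrier M \<times> carrier N" "Poly_Mapping.keys d \<subseteq> carrier M \<times> carrier N"
  shows "K #>\<^bsub>FG\<^esub> c = K #>\<^bsub>FG\<^esub> d"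
proof -
  have "c \<in> K #>\<^bsub>FG\<^esub> d" unfolding r_coset_def using assms(1) by force
  then show ?thesis
    using group.repr_independence[OF group_free_Abelian_group _ _ K_subgroup, of c d] assms by simp
qed

lemma coset_add:
  assumes "Poly_Mapping.keys c \<subseteq> carrier M \<times> carrier N" "Poly_Mapping.keys d \<subseteq> carrier M \<times> carrier N"
  shows "(K #>\<^bsub>FG\<^esub> c) \<oplus>\<^bsub>T\<^esub> (K #>\<^bsub>FG\<^esub> d) = K #>\<^bsub>FG\<^esub> (c + d)"
  using normal.rcos_sum[OF K_normal, of c d] assms by (simp add: add_tensor tensor_group_def)

lemma tens_closed: "\<lbrakk>x \<in> carrier M; y \<in> carrier N\<rbrakk> \<Longrightarrow> tn x y \<in> carrier T"
  by (auto simp: carrier_tensor tens_def tensor_group_def carrier_FactGroup)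

lemma abelian_group_tensor: "abelian_group T"
proof -
  interpret Q: comm_group "tensor_group M R N"
    unfolding tensor_group_def by (rule comm_group.abelian_FactGroup[OF abelian_free_Abelian_group K_subgroup])
  show ?thesis
    by (rule abelian_groupI) (auto simp: tensor_simps Q.m_ac intro: Q.l_inv)
qed

sublocale T: abelian_group T
  by (rule abelian_group_tensor)

lemma K_rel: "c \<in> tensor_rels M R N \<Longrightarrow> c \<in> K"
  unfolding tensor_ker_def by (rule generate.incl)

lemma tens_add_left:
  assumes "x \<in> carrier M" "x' \<in> carrier M" "y \<in> carrier N"
  shows "tn (x \<oplus>\<^bsub>M\<^esub> x') y = tn x y \<oplus>\<^bsub>T\<^esub> tn x' y"
proof -
  have "frag_of (x \<oplus>\<^bsub>M\<^esub> x', y) - (frag_of (x, y) + frag_of (x', y)) \<in> K"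
    using assms by (intro K_rel) (auto simp: tensor_rels_def diff_diff_eq)
  moreover have "Poly_Mapping.keys (frag_of (x, y) + frag_of (x', y)) \<subseteq> carrier M \<times> carrier N"
    using keys_add[of "frag_of (x, y)" "frag_of (x', y)"] assms by auto
  ultimately show ?thesis using assms unfolding tens_def
    by (subst coset_add) (simp_all add: coset_eqI)
qed

lemma tens_add_right:
  assumes "x \<in> carrier M" "y \<in> carrier N" "y' \<in> carrier N"
  shows "tn x (y \<oplus>\<^bsub>N\<^esub> y') = tn x y \<oplus>\<^bsub>T\<^esub> tn x y'"
proof -
  have "frag_of (x, y \<oplus>\<^bsub>N\<^esub> y') - (frag_of (x, y) + frag_of (x, y')) \<in> K"
    using assms by (intro K_rel) (auto simp: tensor_rels_def diff_diff_eq)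
  moreover have "Poly_Mapping.keys (frag_of (x, y) + frag_of (x, y')) \<subseteq> carrier M \<times> carrier N"
    using keys_add[of "frag_of (x, y)" "frag_of (x, y')"] assms by auto
  ultimately show ?thesis using assms unfolding tens_def
    by (subst coset_add) (simp_all add: coset_eqI)
qed

lemma tens_balanced:
  assumes "x \<in> carrier M" "r \<in> carrier R" "y \<in> carrier N"
  shows "tn (ract M x r) y = tn x (lact N r y)"
  unfolding tens_def
  using assms by (intro coset_eqI K_rel) (auto simp: tensor_rels_def M.ract_closed N.lact_closed)

lemma tens_hom_left: "y \<in> carrier N \<Longrightarrow> (\<lambda>x. tn x y) \<in> hom (add_monoid M) (add_monoid T)"
  by (auto simp: hom_def tens_closed tens_add_left)

text \<open>No case for negatives arises, since -(x \<otimes> y) = (-x) \<otimes> y. The proof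
  carries the property for the cosets of c and of -c together, which turns the differences of
  \<open>frag_induction\<close> into sums.\<close>

lemma tensor_induct [consumes 1, case_names tens add]:
  assumes t: "t \<in> carrier T"
    and tens: "\<And>x y. x \<in> carrier M \<Longrightarrow> y \<in> carrier N \<Longrightarrow> P (tn x y)"
    and add: "\<And>s t. s \<in> carrier T \<Longrightarrow> t \<in> carrier T \<Longrightarrow> P s \<Longrightarrow> P t \<Longrightarrow> P (s \<oplus>\<^bsub>T\<^esub> t)"
  shows "P t"
proof -
  let ?S = "carrier M \<times> carrier N"
  obtain c where c: "Poly_Mapping.keys c \<subseteq> ?S" "t = K #>\<^bsub>FG\<^esub> c"
    using t by (auto simp: carrier_tensor tensor_group_def carrier_FactGroup)
  let ?C = "\<lambda>c. K #>\<^bsub>FG\<^esub> c"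
  have closed: "?C c \<in> carrier T" if "Poly_Mapping.keys c \<subseteq> ?S" for c
    using that by (auto simp: carrier_tensor tensor_group_def carrier_FactGroup)
  have C0: "?C 0 = \<zero>\<^bsub>T\<^esub>"
    using subgroup.subset[OF K_subgroup] group.coset_mult_one[OF group_free_Abelian_group, of K]
    by (simp add: zero_tensor tensor_group_def FactGroup_def)
  have zero: "P \<zero>\<^bsub>T\<^esub>"
    using tens[of "\<zero>\<^bsub>M\<^esub>" "\<zero>\<^bsub>N\<^esub>"] add_hom_zero[OF tens_hom_left M.M.abelian_group_axioms abelian_group_tensor, of "\<zero>\<^bsub>N\<^esub>"]
    by simp
  have "Poly_Mapping.keys c \<subseteq> ?S \<and> P (?C c) \<and> P (?C (- c))" using c(1)
  proof (induction rule: frag_induction)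
    case zero show ?case using C0 \<open>P \<zero>\<^bsub>T\<^esub>\<close> by simp
  next
    case (one k)
    then obtain x y where k: "k = (x, y)" "x \<in> carrier M" "y \<in> carrier N" by auto
    have "?C (- frag_of k) \<oplus>\<^bsub>T\<^esub> ?C (frag_of k) = \<zero>\<^bsub>T\<^esub>"
      using coset_add[of "- frag_of k" "frag_of k"] k C0 by simp
    then have "?C (- frag_of k) = \<ominus>\<^bsub>T\<^esub> tn x y"
      using closed[of "- frag_of k"] tens_closed[of x y] k T.minus_equality[of "?C (- frag_of k)" "tn x y"]
      by (simp add: tens_def)
    also have "\<dots> = tn (\<ominus>\<^bsub>M\<^esub> x) y"
      using add_hom_minus[OF tens_hom_left M.M.abelian_group_axioms abelian_group_tensor, of y x] k by simp
    finally show ?case using tens[of x y] tens[of "\<ominus>\<^bsub>M\<^esub> x" y] k by (simp add: tens_def)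
  next
    case (diff a b)
    have "Poly_Mapping.keys (a - b) \<subseteq> ?S" using diff keys_diff[of a b] by blast
    moreover have "?C (a - b) = ?C a \<oplus>\<^bsub>T\<^esub> ?C (- b)" "?C (- (a - b)) = ?C (- a) \<oplus>\<^bsub>T\<^esub> ?C b"
      using coset_add[of a "- b"] coset_add[of "- a" b] diff by simp_all
    ultimately show ?case using diff closed[of a] closed[of b] closed[of "- a"] closed[of "- b"] by (simp add: add)
  qed
  then show ?thesis using c by simp
qed

lemma tensor_hom_eqI:
  assumes "f \<in> hom (add_monoid T) (add_monoid G)" "g \<in> hom (add_monoid T) (add_monoid G)"
    and "\<And>x y. x \<in> carrier M \<Longrightarrow> y \<in> carrier N \<Longrightarrow> f (tn x y) = g (tn x y)" and "t \<in> carrier T"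
  shows "f t = g t"
  using assms(4) by (induction rule: tensor_induct) (auto simp: add_homD[OF assms(1)] add_homD[OF assms(2)] assms(3))

lemma lift_hom:
  "abelian_group G \<Longrightarrow> balanced R M N G b \<Longrightarrow> tensor_lift G b \<in> hom (add_monoid T) (add_monoid G)"
  using tensor_lift(1)[OF M.right_module_axioms N.bimodule_axioms, of G b]
  by (simp add: balanced_def hom_def tensor_simps)

lemma lift_tens:
  "\<lbrakk>abelian_group G; balanced R M N G b; x \<in> carrier M; y \<in> carrier N\<rbrakk> \<Longrightarrow> tensor_lift G b (tn x y) = b x y"
  using tensor_lift(2)[OF M.right_module_axioms N.bimodule_axioms, of G b x y]
  by (simp add: balanced_def)

lemma balanced_tens_ract: "s \<in> carrier S \<Longrightarrow> balanced R M N T (\<lambda>x y. tn x (ract N y s))"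
  by (auto simp: balanced_def tens_closed N.ract_closed tens_add_left tens_add_right N.ract_add_left
      tens_balanced N.lact_ract)

lemma ract_hom: "s \<in> carrier S \<Longrightarrow> (\<lambda>t. ract T t s) \<in> hom (add_monoid T) (add_monoid T)"
  using lift_hom[OF abelian_group_tensor balanced_tens_ract] by (simp add: ract_tensor)

lemma ract_tens:
  "\<lbrakk>x \<in> carrier M; y \<in> carrier N; s \<in> carrier S\<rbrakk> \<Longrightarrow> ract T (tn x y) s = tn x (ract N y s)"
  using lift_tens[OF abelian_group_tensor balanced_tens_ract] by (simp add: ract_tensor)

lemma lift_rmod_hom:
  assumes "abelian_group G" "balanced R M N G b"
    and "\<And>x y s. \<lbrakk>x \<in> carrier M; y \<in> carrier N; s \<in> carrier S\<rbrakk> \<Longrightarrow> b x (ract N y s) = ract G (b x y) s"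
    and "\<And>s. s \<in> carrier S \<Longrightarrow> (\<lambda>x. ract G x s) \<in> hom (add_monoid G) (add_monoid G)"
  shows "tensor_lift G b \<in> rmod_hom S T G"
proof -
  note L = lift_hom[OF assms(1,2)]
  have "tensor_lift G b (ract T t s) = ract G (tensor_lift G b t) s" if "t \<in> carrier T" "s \<in> carrier S" for t s
    using that(1)
  proof (induction rule: tensor_induct)
    case (tens x y)
    then show ?case using that(2) by (simp add: ract_tens lift_tens assms N.ract_closed)
  next
    case (add t t')
    then show ?case
      using add_homD[OF ract_hom[OF that(2)]] add_homD[OF L] add_homD[OF assms(4)[OF that(2)]] by simp
  qed
  then show ?thesis using add_homD[OF L] by (auto simp: rmod_hom_def)
qed

end

section \<open>Extension of scalars along a ring homomorphism\<close>

lemma via_simps [simp]: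
  "carrier (via f D) = carrier D" "add (via f D) = add D" "zero (via f D) = zero D"
  "ract (via f D) = mult D" "lact (via f D) r d = f r \<otimes>\<^bsub>D\<^esub> d"
  by (simp_all add: via_def)

lemma bimodule_via:
  assumes "rng R" "rng D" "f \<in> rng_hom R D"
  shows "bimodule R D (via f D)"
proof -
  interpret R: rng R by fact
  interpret D: rng D by fact
  note f = rng_homD[OF assms(3)]
  have "abelian_group (via f D)"
    by (intro abelian_groupI) (auto simp: D.a_ac intro: D.l_neg)
  then show ?thesis
    by (intro bimodule.intro right_module.intro right_module_axioms.intro bimodule_axioms.intro R.rng_axioms
        D.rng_axioms)
      (auto simp: D.m_closed D.l_distr D.r_distr D.m_assoc f)
qed

abbreviation functionals :: "'r ring \<Rightarrow> ('r, 'm, 'z) rmod_scheme \<Rightarrow> ('m \<Rightarrow> 'r) set" where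
  "functionals R M \<equiv> rmod_hom R M (regular R)"

lemma functionalD:
  assumes "\<xi> \<in> functionals R M"
  shows "x \<in> carrier M \<Longrightarrow> \<xi> x \<in> carrier R"
    and "\<lbrakk>x \<in> carrier M; y \<in> carrier M\<rbrakk> \<Longrightarrow> \<xi> (x \<oplus>\<^bsub>M\<^esub> y) = \<xi> x \<oplus>\<^bsub>R\<^esub> \<xi> y"
    and "\<lbrakk>x \<in> carrier M; r \<in> carrier R\<rbrakk> \<Longrightarrow> \<xi> (ract M x r) = \<xi> x \<otimes>\<^bsub>R\<^esub> r"
  using rmod_homD[OF assms] by simp_all

lemma (in right_module) functional_closed: "\<lbrakk>\<xi> \<in> functionals R M; x \<in> carrier M\<rbrakk> \<Longrightarrow> \<xi> x \<in> carrier R"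
  by (rule functionalD(1))

text \<open>The data of the dual basis lemma: pairs of an element b and a functional \<beta> with m
  = \<Sum> b\<beta>(m). A list is used so that it can be turned directly into the list of words of a
  relation.\<close>

definition dual_basis :: "'r ring \<Rightarrow> ('r, 'm, 'z) rmod_scheme \<Rightarrow> ('m \<times> ('m \<Rightarrow> 'r)) list \<Rightarrow> bool" where
  "dual_basis R M bs \<longleftrightarrow> fst ` set bs \<subseteq> carrier M \<and> snd ` set bs \<subseteq> functionals R M \<and>
     (\<forall>m\<in>carrier M. lsum M (map (\<lambda>b. ract M (fst b) (snd b m)) bs) = m)"

lemma dual_basisD:
  assumes "dual_basis R M bs"
  shows "b \<in> set bs \<Longrightarrow> fst b \<in> carrier M" "b \<in> set bs \<Longrightarrow> snd b \<in> functionals R M"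
    "m \<in> carrier M \<Longrightarrow> lsum M (map (\<lambda>b. ract M (fst b) (snd b m)) bs) = m"
  using assms by (auto simp: dual_basis_def)

text \<open>The list is reversed because \<open>lessThan_Suc\<close> splits off the largest index,
  which becomes the head of the list.\<close>

lemma (in abelian_monoid) finsum_lsum:
  "(\<And>j. j < n \<Longrightarrow> f j \<in> carrier G) \<Longrightarrow> finsum G f {..<n} = lsum G (map f (rev [0..<n]))"
proof (induction n)
  case (Suc n)
  then show ?case by (simp add: lessThan_Suc Pi_iff)
qed simp

text \<open>Even without a unit in R, n generators give a surjection of R^n onto M: smoothness
  provides e with xe = x, so each generator x lies in the image. The coordinates of a splitting are
  the functionals of the dual basis.\<close>

lemma fgp_dual_basis:
  fixes M :: "('r, 'm, 'z) rmod_scheme"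
  assumes R: "lu_ring R" and M: "fgp R M"
  obtains bs where "dual_basis R M bs"
proof -
  interpret R: lu_ring R by (rule R)
  interpret M: right_module R M using M by (simp add: fgp_def right_smooth_def)
  obtain X where X: "finite X" "X \<subseteq> carrier M"
    "generate (add_monoid M) (X \<union> {ract M x r | x r. x \<in> X \<and> r \<in> carrier R}) = carrier M"
    using M by (auto simp: fgp_def finitely_generated_def)
  obtain n :: nat and x where x: "X = x ` {..<n}"
    using X(1) by (metis finite_imp_nat_seg_image_inj_on lessThan_def)
  have xM: "x j \<in> carrier M" if "j < n" for j using that X(2) x by auto
  let ?F = "M.free_rmod n"
  let ?g = "\<lambda>h. \<Oplus>\<^bsub>M\<^esub>j\<in>{..<n}. ract M (x j) (h j)"
  interpret E: right_module R ?F by (rule M.right_module_free_rmod)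
  have g: "?g \<in> rmod_hom R ?F M" using xM by (rule M.free_rmod_hom)
  then have gh: "?g \<in> hom (add_monoid ?F) (add_monoid M)"
    by (auto simp: rmod_hom_def hom_def)
  have im: "subgroup (?g ` carrier ?F) (add_monoid M)"
    using group_hom.img_is_subgroup[of "add_monoid ?F" "add_monoid M" ?g] gh
    by (simp add: group_hom_def group_hom_axioms_def E.M.a_group M.M.a_group)
  have single: "ract M (x i) r \<in> ?g ` carrier ?F" if "i < n" "r \<in> carrier R" for i r
  proof -
    let ?h = "\<lambda>j. if i = j then r else \<zero>\<^bsub>R\<^esub>"
    have "?g ?h = (\<Oplus>\<^bsub>M\<^esub>j\<in>{..<n}. if i = j then ract M (x j) r else \<zero>\<^bsub>M\<^esub>)"
      using that by (intro M.M.finsum_cong') (auto simp: M.ract_closed xM M.ract_zero_right)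
    also have "\<dots> = ract M (x i) r"
      using that by (intro M.M.finsum_singleton) (auto simp: M.ract_closed xM)
    finally have "?g ?h = ract M (x i) r" .
    moreover have "?h \<in> carrier ?F" using that by (auto simp: M.free_rmod_simps)
    ultimately show ?thesis by (rule image_eqI[of _ ?g, OF sym])
  qed
  have "x i \<in> ?g ` carrier ?F" if i: "i < n" for i
  proof -
    obtain e where "e \<in> carrier R" "ract M (x i) e = x i"
      using smooth_local_unit[OF R _ xM[OF i]] M by (auto simp: fgp_def)
    then show ?thesis using single[OF i, of e] by simp
  qed
  with single have "X \<union> {ract M x r | x r. x \<in> X \<and> r \<in> carrier R} \<subseteq> ?g ` carrier ?F"
    using x by auto
  from group.generate_subgroup_incl[OF M.M.a_group this im]
  have "?g ` carrier ?F = carrier M"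
    using X(3) rmod_homD(1)[OF g] by blast
  moreover have "projective TYPE(nat \<Rightarrow> 'r) R M" using M by (simp add: fgp_def)
  ultimately have "\<exists>s\<in>rmod_hom R M ?F. \<forall>m\<in>carrier M. ?g (s m) = m"
    unfolding projective_def using E.right_module_axioms g
    by (elim allE[of _ "?F"] allE[of _ ?g]) (simp only: simp_thms)
  then obtain s where s: "s \<in> rmod_hom R M ?F" "\<And>m. m \<in> carrier M \<Longrightarrow> ?g (s m) = m"
    by (elim bexE) simp
  have sR: "s m j \<in> carrier R" if "m \<in> carrier M" for m j
    using M.free_rmod_carrierD[OF rmod_homD(1)[OF s(1) that]] .
  have "(\<lambda>m. s m j) \<in> functionals R M" if "j < n" for j
    using that rmod_homD[OF s(1)] sR by (simp add: rmod_hom_def M.free_rmod_simps)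
  then have "dual_basis R M (map (\<lambda>j. (x j, \<lambda>m. s m j)) (rev [0..<n]))"
    using s(2) xM sR by (auto simp: dual_basis_def o_def M.ract_closed M.M.finsum_lsum)
  then show thesis by (rule that)
qed

section \<open>Coordinates on M \<otimes> D, and the elements x \<otimes> 1\<close>

locale base_change = R: lu_ring R + M: right_module R M + D: rng D
  for R :: "'r ring" and M :: "('r, 'm, 'z) rmod_scheme" and D :: "'d ring" (structure) +
  fixes f :: "'r \<Rightarrow> 'd"
  assumes f_hom: "f \<in> rng_hom R D"
begin

sublocale tensor_pair R D M "via f D"
  by (intro tensor_pair.intro M.right_module_axioms bimodule_via R.rng_axioms D.rng_axioms f_hom)

lemmas f_closed = rng_homD(1)[OF f_hom]
  and f_add = rng_homD(2)[OF f_hom]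
  and f_mult = rng_homD(3)[OF f_hom]

lemma tens_via_balanced:
  "\<lbrakk>x \<in> carrier M; r \<in> carrier R; d \<in> carrier D\<rbrakk> \<Longrightarrow> tn (ract M x r) d = tn x (f r \<otimes> d)"
  using tens_balanced[of x r d] by simp

lemma tens_via_closed: "\<lbrakk>x \<in> carrier M; d \<in> carrier D\<rbrakk> \<Longrightarrow> tn x d \<in> carrier T"
  using tens_closed[of x d] by simp

lemma tens_via_add_right:
  "\<lbrakk>x \<in> carrier M; d \<in> carrier D; d' \<in> carrier D\<rbrakk> \<Longrightarrow> tn x (d \<oplus> d') = tn x d \<oplus>\<^bsub>T\<^esub> tn x d'"
  using tens_add_right[of x d d'] by simp

lemma tens_via_add_left:
  "\<lbrakk>x \<in> carrier M; y \<in> carrier M; d \<in> carrier D\<rbrakk> \<Longrightarrow> tn (x \<oplus>\<^bsub>M\<^esub> y) d = tn x d \<oplus>\<^bsub>T\<^esub> tn y d"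
  using tens_add_left[of x y d] by simp

lemma ract_tens_via:
  "\<lbrakk>x \<in> carrier M; d \<in> carrier D; s \<in> carrier D\<rbrakk> \<Longrightarrow> ract T (tn x d) s = tn x (d \<otimes> s)"
  using ract_tens[of x d s] by simp

text \<open>The map \<xi> \<otimes> id from M \<otimes> D to R \<otimes> D, followed by the
  multiplication of R \<otimes> D into D through f.\<close>

definition coeff :: "('m \<Rightarrow> 'r) \<Rightarrow> ('m \<times> 'd \<Rightarrow>\<^sub>0 int) set \<Rightarrow> 'd" where
  "coeff \<xi> = tensor_lift D (\<lambda>x d. f (\<xi> x) \<otimes> d)"

lemma coeff_balanced: "\<xi> \<in> functionals R M \<Longrightarrow> balanced R M (via f D) D (\<lambda>x d. f (\<xi> x) \<otimes> d)"
  by (auto simp: balanced_def functionalD f_closed f_add f_mult D.m_closed D.l_distr D.r_distr D.m_assoc)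

lemma coeff_hom: "\<xi> \<in> functionals R M \<Longrightarrow> coeff \<xi> \<in> hom (add_monoid T) (add_monoid D)"
  unfolding coeff_def by (rule lift_hom[OF D.abelian_group_axioms coeff_balanced])

lemma coeff_tens:
  "\<lbrakk>\<xi> \<in> functionals R M; x \<in> carrier M; d \<in> carrier D\<rbrakk> \<Longrightarrow> coeff \<xi> (tn x d) = f (\<xi> x) \<otimes> d"
  unfolding coeff_def using lift_tens[OF D.abelian_group_axioms coeff_balanced] by simp

lemma coeff_closed: "\<lbrakk>\<xi> \<in> functionals R M; t \<in> carrier T\<rbrakk> \<Longrightarrow> coeff \<xi> t \<in> carrier D"
  using add_homD(1)[OF coeff_hom] .

lemma coeff_ract:
  assumes "\<xi> \<in> functionals R M" "t \<in> carrier T" "d \<in> carrier D"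
  shows "coeff \<xi> (ract T t d) = coeff \<xi> t \<otimes> d"
  using assms(2)
proof (induction rule: tensor_induct)
  case (tens x y)
  then show ?case using assms
    by (simp add: ract_tens_via coeff_tens D.m_closed D.m_assoc functionalD f_closed)
next
  case (add s t)
  then show ?case using assms add_homD[OF ract_hom[OF assms(3)]] add_homD[OF coeff_hom[OF assms(1)]]
    by (simp add: D.l_distr)
qed

text \<open>A dual basis of M stays one after base change. On m \<otimes> d this is balancing: b
  \<otimes> f(\<beta>(m))d = b\<beta>(m) \<otimes> d, and these add up to m \<otimes> d.\<close>

lemma dual_basis_expand:
  assumes bs: "dual_basis R M bs" and t: "t \<in> carrier T"
  shows "lsum T (map (\<lambda>b. tn (fst b) (coeff (snd b) t)) bs) = t"
  using t
proof (induction rule: tensor_induct)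
  case (tens m d)
  then have d: "d \<in> carrier D" by simp
  note b = dual_basisD(1,2)[OF bs]
  have "lsum T (map (\<lambda>b. tn (fst b) (coeff (snd b) (tn m d))) bs) =
      lsum T (map (\<lambda>b. tn (ract M (fst b) (snd b m)) d) bs)"
    using b tens(1) d
    by (intro arg_cong[of _ _ "lsum T"] map_cong) (simp_all add: coeff_tens tens_via_balanced M.functional_closed)
  also have "\<dots> = tn (lsum M (map (\<lambda>b. ract M (fst b) (snd b m)) bs)) d"
    using b tens(1) d
    by (intro add_hom_lsum[OF tens_hom_left M.M.abelian_group_axioms abelian_group_tensor, symmetric])
      (simp_all add: M.ract_closed M.functional_closed)
  finally show ?case using dual_basisD(3)[OF bs tens(1)] by simp
next
  case (add s t)
  note b = dual_basisD(1,2)[OF bs]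
  have "lsum T (map (\<lambda>b. tn (fst b) (coeff (snd b) (s \<oplus>\<^bsub>T\<^esub> t))) bs) =
      lsum T (map (\<lambda>b. tn (fst b) (coeff (snd b) s) \<oplus>\<^bsub>T\<^esub> tn (fst b) (coeff (snd b) t)) bs)"
    using b add.hyps
    by (intro arg_cong[of _ _ "lsum T"] map_cong)
      (simp_all add: add_homD(2)[OF coeff_hom] tens_via_add_right coeff_closed)
  also have "\<dots> = s \<oplus>\<^bsub>T\<^esub> t"
    using b add by (subst T.lsum_add) (simp_all add: tens_via_closed coeff_closed)
  finally show ?case .
qed

text \<open>The expansion recovers a tensor from its coordinates. Identities in M \<otimes> D
  thereby become identities in D.\<close>

lemma coeff_eqI:
  assumes "dual_basis R M bs" "s \<in> carrier T" "t \<in> carrier T"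
    and eq: "\<And>\<xi>. \<xi> \<in> functionals R M \<Longrightarrow> coeff \<xi> s = coeff \<xi> t"
  shows "s = t"
proof -
  have "map (\<lambda>b. tn (fst b) (coeff (snd b) s)) bs = map (\<lambda>b. tn (fst b) (coeff (snd b) t)) bs"
    using dual_basisD(2)[OF assms(1)] eq by simp
  then show ?thesis
    using dual_basis_expand[OF assms(1,2)] dual_basis_expand[OF assms(1,3)] by metis
qed

text \<open>The elements \<open>x \<otimes> 1\<close>, where \<open>1\<close> stands for the image of any local unit fixing \<open>x\<close>.\<close>

definition emb :: "'m \<Rightarrow> ('m \<times> 'd \<Rightarrow>\<^sub>0 int) set" where
  "emb x = tn x (f (SOME e. e \<in> carrier R \<and> ract M x e = x))"

text \<open>If ec = e, then x \<otimes> f(c) = xe \<otimes> f(c) = x \<otimes> f(ec) = x \<otimes>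
  f(e). Two units of x are compared through a common c.\<close>

lemma emb_eq:
  assumes x: "x \<in> carrier M" and e: "e \<in> carrier R" "ract M x e = x"
  shows "emb x = tn x (f e)"
proof -
  define e' where "e' = (SOME e. e \<in> carrier R \<and> ract M x e = x)"
  have e': "e' \<in> carrier R" "ract M x e' = x"
    using someI[of "\<lambda>e. e \<in> carrier R \<and> ract M x e = x" e] e by (simp_all add: e'_def)
  obtain c where c: "c \<in> carrier R" "e \<otimes>\<^bsub>R\<^esub> c = e" "e' \<otimes>\<^bsub>R\<^esub> c = e'"
    by (rule R.common_unit2[OF e(1) e'(1)])
  have "tn x (f a) = tn x (f c)" if "a \<in> carrier R" "a \<otimes>\<^bsub>R\<^esub> c = a" "ract M x a = x" for a
    using tens_via_balanced[OF x that(1) f_closed[OF c(1)]] f_mult[OF that(1) c(1)] that by simp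
  then have "tn x (f e') = tn x (f e)" using e e' c by metis
  then show ?thesis by (simp add: emb_def e'_def)
qed

lemma emb_ract_tens:
  assumes "x \<in> carrier M" "e \<in> carrier R" "ract M x e = x" "d \<in> carrier D"
  shows "ract T (emb x) d = tn x d"
  using tens_via_balanced[OF assms(1,2,4)] assms by (simp add: emb_eq ract_tens_via f_closed)

lemma coeff_emb:
  assumes "x \<in> carrier M" "e \<in> carrier R" "ract M x e = x" "\<xi> \<in> functionals R M"
  shows "coeff \<xi> (emb x) = f (\<xi> x)"
  using functionalD(3)[OF assms(4,1,2)] assms
  by (simp add: emb_eq coeff_tens f_closed functionalD flip: f_mult)

lemma emb_closed: "\<lbrakk>x \<in> carrier M; e \<in> carrier R; ract M x e = x\<rbrakk> \<Longrightarrow> emb x \<in> carrier T"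
  by (simp add: emb_eq tens_via_closed f_closed)

lemma emb_add:
  assumes "x \<in> carrier M" "e \<in> carrier R" "ract M x e = x" "y \<in> carrier M" "e' \<in> carrier R" "ract M y e' = y"
  shows "emb (x \<oplus>\<^bsub>M\<^esub> y) = emb x \<oplus>\<^bsub>T\<^esub> emb y"
proof -
  obtain c where c: "c \<in> carrier R" "e \<otimes>\<^bsub>R\<^esub> c = e" "e' \<otimes>\<^bsub>R\<^esub> c = e'"
    by (rule R.common_unit2[OF assms(2,5)])
  have "ract M x c = x" "ract M y c = y"
    using M.ract_assoc[of x e c] M.ract_assoc[of y e' c] assms c by simp_all
  then show ?thesis
    using assms(1,4) c(1) by (simp add: emb_eq[of _ c] M.ract_add_left tens_via_add_left f_closed)
qed

lemma emb_ract:
  assumes x: "x \<in> carrier M" "e \<in> carrier R" "ract M x e = x" and r: "r \<in> carrier R"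
  shows "emb (ract M x r) = ract T (emb x) (f r)"
proof -
  obtain c where c: "c \<in> carrier R" "r \<otimes>\<^bsub>R\<^esub> c = r"
    by (rule R.common_unit2[OF r r])
  have "emb (ract M x r) = tn (ract M x r) (f c)"
    using M.ract_assoc[of x r c] x r c by (intro emb_eq) (simp_all add: M.ract_closed)
  also have "\<dots> = tn x (f r)"
    using tens_via_balanced[OF x(1) r f_closed[OF c(1)]] f_mult[OF r c(1)] c(2) by simp
  finally show ?thesis using emb_ract_tens[OF x f_closed[OF r]] by simp
qed

end

section \<open>Inverting maps of finitely generated projective modules\<close>

text \<open>
  The scalars \<open>t \<xi> y\<close> play the role of \<open>\<xi>(u\<inverse>(y))\<close>; the equations say that they
  are the coefficients of a two-sided inverse of \<open>u \<otimes> D\<close>.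
\<close>

definition inverse_coeffs ::
  "'r ring \<Rightarrow> ('r, 'p) rmod \<Rightarrow> ('r, 'q) rmod \<Rightarrow> ('p \<Rightarrow> 'q) \<Rightarrow> 'd ring \<Rightarrow> ('r \<Rightarrow> 'd)
    \<Rightarrow> (('p \<Rightarrow> 'r) \<Rightarrow> 'q \<Rightarrow> 'd) \<Rightarrow> bool" where
  "inverse_coeffs R P Q u D f t \<longleftrightarrow>
     (\<forall>\<xi>\<in>functionals R P. \<forall>y\<in>carrier Q. t \<xi> y \<in> carrier D) \<and>
     (\<forall>\<xi>\<in>functionals R P. \<forall>y\<in>carrier Q. \<forall>y'\<in>carrier Q. t \<xi> (y \<oplus>\<^bsub>Q\<^esub> y') = t \<xi> y \<oplus>\<^bsub>D\<^esub> t \<xi> y') \<and>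
     (\<forall>\<xi>\<in>functionals R P. \<forall>y\<in>carrier Q. \<forall>r\<in>carrier R. t \<xi> (ract Q y r) = t \<xi> y \<otimes>\<^bsub>D\<^esub> f r) \<and>
     (\<forall>\<xi>\<in>functionals R P. \<forall>x\<in>carrier P. t \<xi> (u x) = f (\<xi> x)) \<and>
     (\<forall>bs. \<forall>\<eta>\<in>functionals R Q. \<forall>y\<in>carrier Q. dual_basis R P bs \<longrightarrow>
        lsum D (map (\<lambda>b. f (\<eta> (u (fst b))) \<otimes>\<^bsub>D\<^esub> t (snd b) y) bs) = f (\<eta> y))"

lemma inverse_coeffsD:
  assumes "inverse_coeffs R P Q u D f t" "\<xi> \<in> functionals R P"
  shows "y \<in> carrier Q \<Longrightarrow> t \<xi> y \<in> carrier D"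
    and "\<lbrakk>y \<in> carrier Q; y' \<in> carrier Q\<rbrakk> \<Longrightarrow> t \<xi> (y \<oplus>\<^bsub>Q\<^esub> y') = t \<xi> y \<oplus>\<^bsub>D\<^esub> t \<xi> y'"
    and "\<lbrakk>y \<in> carrier Q; r \<in> carrier R\<rbrakk> \<Longrightarrow> t \<xi> (ract Q y r) = t \<xi> y \<otimes>\<^bsub>D\<^esub> f r"
    and "x \<in> carrier P \<Longrightarrow> t \<xi> (u x) = f (\<xi> x)"
    and "t \<xi> \<in> hom (add_monoid Q) (add_monoid D)"
  using assms by (auto simp: inverse_coeffs_def hom_def)

lemma inverse_coeffs_sum:
  assumes "inverse_coeffs R P Q u D f t" "dual_basis R P bs" "\<eta> \<in> functionals R Q" "y \<in> carrier Q"
  shows "lsum D (map (\<lambda>b. f (\<eta> (u (fst b))) \<otimes>\<^bsub>D\<^esub> t (snd b) y) bs) = f (\<eta> y)"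
  using assms by (auto simp: inverse_coeffs_def)

lemma inverse_coeffs_image:
  assumes t: "inverse_coeffs R P Q u C f t" and C: "rng C" and D: "rng D" and R: "rng R"
    and u: "u \<in> rmod_hom R P Q" and f: "f \<in> rng_hom R C" and g: "g \<in> rng_hom C D"
  shows "inverse_coeffs R P Q u D (compose (carrier R) g f) (\<lambda>\<xi> y. g (t \<xi> y))"
proof -
  let ?h = "compose (carrier R) g f"
  interpret C: rng C by (rule C)
  interpret D: rng D by (rule D)
  note gD = rng_homD[OF g] and fD = rng_homD[OF f] and uD = rmod_homD[OF u]
  note tD = inverse_coeffsD[OF t]
  have sum: "lsum D (map (\<lambda>b. ?h (\<eta> (u (fst b))) \<otimes>\<^bsub>D\<^esub> g (t (snd b) y)) bs) =
      ?h (\<eta> y)"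
    if h: "dual_basis R P bs" "\<eta> \<in> functionals R Q" "y \<in> carrier Q" for bs \<eta> y
  proof -
    let ?p = "\<lambda>b. f (\<eta> (u (fst b))) \<otimes>\<^bsub>C\<^esub> t (snd b) y"
    note b = dual_basisD(1,2)[OF h(1)]
    have c: "?p b \<in> carrier C" if "b \<in> set bs" for b
      using b[OF that] h by (auto intro!: C.m_closed fD(1) tD(1) functionalD(1)[OF h(2)] uD(1))
    have "lsum D (map (\<lambda>b. ?h (\<eta> (u (fst b))) \<otimes>\<^bsub>D\<^esub> g (t (snd b) y)) bs) =
        lsum D (map (\<lambda>b. g (?p b)) bs)"
    proof (rule lsum_cong)
      fix x assume x: "x \<in> set bs"
      have "\<eta> (u (fst x)) \<in> carrier R" "t (snd x) y \<in> carrier C"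
        using b[OF x] h by (auto intro!: tD(1) functionalD(1)[OF h(2)] uD(1))
      then show "?h (\<eta> (u (fst x))) \<otimes>\<^bsub>D\<^esub> g (t (snd x) y) =
          g (?p x)"
        by (simp add: compose_def gD fD)
    qed
    also have "\<dots> = g (lsum C (map (\<lambda>b. ?p b) bs))"
      using c by (intro add_hom_lsum[OF gD(5) C.abelian_group_axioms D.abelian_group_axioms, symmetric])
    also have "\<dots> = g (f (\<eta> y))" using inverse_coeffs_sum[OF t h] by simp
    finally show ?thesis using functionalD(1)[OF h(2,3)] by (simp add: compose_def)
  qed
  show ?thesis unfolding inverse_coeffs_def
    by (intro conjI ballI allI impI sum)
      (simp_all add: tD gD fD compose_def functionalD(1))
qed

text \<open>D is just a ring and f just a homomorphism, because these results are also applied to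
  the presented ring, whose local units are deduced from
  \<open>inverse_coeffs_expand\<close>.\<close>

locale fgp_map_over = R: lu_ring R + P: base_change R P D f + Q: base_change R Q D f
  for R :: "'r ring" and P :: "('r, 'p) rmod" and Q :: "('r, 'q) rmod" and D :: "'d ring" (structure)
    and f :: "'r \<Rightarrow> 'd" +
  fixes u :: "'p \<Rightarrow> 'q"
  assumes fgp_P: "fgp R P" and fgp_Q: "fgp R Q" and u_hom: "u \<in> rmod_hom R P Q"
begin

abbreviation U where "U \<equiv> tensor_id Q R (via f D) u"

lemmas uD = rmod_homD[OF u_hom]

lemma U_balanced: "balanced R P (via f D) Q.T (\<lambda>x d. Q.tn (u x) d)"
  by (simp add: balanced_def uD Q.tens_via_closed Q.tens_via_add_left Q.tens_via_add_right Q.tens_via_balanced)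

lemma U_tens: "\<lbrakk>x \<in> carrier P; d \<in> carrier D\<rbrakk> \<Longrightarrow> U (P.tn x d) = Q.tn (u x) d"
  unfolding tensor_id_def using P.lift_tens[OF Q.abelian_group_tensor U_balanced] by simp

lemma U_rmod_hom: "U \<in> rmod_hom D P.T Q.T"
  unfolding tensor_id_def
  by (rule P.lift_rmod_hom[OF Q.abelian_group_tensor U_balanced])
    (simp_all add: uD Q.ract_tens_via Q.ract_hom)

lemma U_hom: "U \<in> hom (add_monoid P.T) (add_monoid Q.T)"
  unfolding tensor_id_def by (rule P.lift_hom[OF Q.abelian_group_tensor U_balanced])

lemma coeff_U_hom:
  "\<eta> \<in> functionals R Q \<Longrightarrow> (\<lambda>w. Q.coeff \<eta> (U w)) \<in> hom (add_monoid P.T) (add_monoid D)"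
  using add_homD[OF U_hom] add_homD[OF Q.coeff_hom[of \<eta>]] by (auto simp: hom_def)

lemma coeff_U_lsum:
  assumes bs: "dual_basis R P bs" and \<eta>: "\<eta> \<in> functionals R Q"
    and c: "\<And>b. b \<in> set bs \<Longrightarrow> c b \<in> carrier D"
  shows "Q.coeff \<eta> (U (lsum P.T (map (\<lambda>b. P.tn (fst b) (c b)) bs))) =
    lsum D (map (\<lambda>b. f (\<eta> (u (fst b))) \<otimes> c b) bs)"
proof -
  note b = dual_basisD(1)[OF bs]
  have "Q.coeff \<eta> (U (lsum P.T (map (\<lambda>b. P.tn (fst b) (c b)) bs))) =
      lsum D (map (\<lambda>b. Q.coeff \<eta> (U (P.tn (fst b) (c b)))) bs)"
    using b c
    by (intro add_hom_lsum[OF coeff_U_hom[OF \<eta>] P.abelian_group_tensor P.D.abelian_group_axioms])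
      (simp add: P.tens_via_closed)
  also have "\<dots> = lsum D (map (\<lambda>b. f (\<eta> (u (fst b))) \<otimes> c b) bs)"
    using b c by (intro lsum_cong) (simp add: U_tens Q.coeff_tens \<eta> uD)
  finally show ?thesis .
qed

lemma unit_P: assumes "x \<in> carrier P" obtains e where "e \<in> carrier R" "ract P x e = x"
  using smooth_local_unit[OF R.lu_ring_axioms _ assms] fgp_P by (auto simp: fgp_def)

lemma unit_Q: assumes "y \<in> carrier Q" obtains e where "e \<in> carrier R" "ract Q y e = y"
  using smooth_local_unit[OF R.lu_ring_axioms _ assms] fgp_Q by (auto simp: fgp_def)

lemma inverse_coeffs_exist:
  assumes "inverts R P Q u D f"
  shows "\<exists>t. inverse_coeffs R P Q u D f t"
proof -
  have bij: "bij_betw U (carrier P.T) (carrier Q.T)"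
    using assms by (simp add: inverts_def rmod_iso_def)
  define W where "W = inv_into (carrier P.T) U"
  have W_closed: "W s \<in> carrier P.T" if "s \<in> carrier Q.T" for s
    using bij that unfolding W_def bij_betw_def by (metis inv_into_into)
  have UW: "U (W s) = s" if "s \<in> carrier Q.T" for s
    using bij that unfolding W_def by (rule bij_betw_inv_into_right)
  \<comment> \<open>Identities for the inverse are proved this way: the proposed value is checked by
    applying U.\<close>
  have W_eq: "W s = w" if "w \<in> carrier P.T" "U w = s" for s w
    using bij that unfolding W_def by (metis bij_betw_inv_into_left)
  have emb_closed: "Q.emb y \<in> carrier Q.T" if "y \<in> carrier Q" for y
    using unit_Q[OF that] Q.emb_closed[OF that] by metis
  \<comment> \<open>The coordinate \<xi> of the preimage of y \<otimes> 1.\<close>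
  define t where "t \<xi> y = P.coeff \<xi> (W (Q.emb y))" for \<xi> y
  have "inverse_coeffs R P Q u D f t" unfolding inverse_coeffs_def
  proof (intro conjI ballI allI impI)
    fix \<xi> y assume \<xi>: "\<xi> \<in> functionals R P" and y: "y \<in> carrier Q"
    show "t \<xi> y \<in> carrier D"
      unfolding t_def by (intro P.coeff_closed \<xi> W_closed emb_closed y)
    obtain e where e: "e \<in> carrier R" "ract Q y e = y" by (rule unit_Q[OF y])
    { fix y' assume y': "y' \<in> carrier Q"
      obtain e' where e': "e' \<in> carrier R" "ract Q y' e' = y'" by (rule unit_Q[OF y'])
      have "W (Q.emb (y \<oplus>\<^bsub>Q\<^esub> y')) = W (Q.emb y) \<oplus>\<^bsub>P.T\<^esub> W (Q.emb y')"
        using y y' by (intro W_eq)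
          (simp_all add: W_closed emb_closed UW Q.emb_add[OF y e y' e'] add_homD(2)[OF U_hom])
      then show "t \<xi> (y \<oplus>\<^bsub>Q\<^esub> y') = t \<xi> y \<oplus> t \<xi> y'"
        using y y' by (simp add: t_def add_homD(2)[OF P.coeff_hom[OF \<xi>]] W_closed emb_closed)
    next
      fix r assume r: "r \<in> carrier R"
      have ract_closed: "ract P.T w (f r) \<in> carrier P.T" if "w \<in> carrier P.T" for w
        using add_homD(1)[OF P.ract_hom[OF P.f_closed[OF r]] that] .
      have "W (Q.emb (ract Q y r)) = ract P.T (W (Q.emb y)) (f r)"
        using y r by (intro W_eq)
          (simp_all add: W_closed emb_closed UW Q.emb_ract[OF y e] rmod_homD(3)[OF U_rmod_hom] P.f_closed
            ract_closed)
      then show "t \<xi> (ract Q y r) = t \<xi> y \<otimes> f r"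
        using y r by (simp add: t_def P.coeff_ract \<xi> W_closed emb_closed P.f_closed)
    }
  next
    fix \<xi> x assume \<xi>: "\<xi> \<in> functionals R P" and x: "x \<in> carrier P"
    obtain e where e: "e \<in> carrier R" "ract P x e = x" by (rule unit_P[OF x])
    \<comment> \<open>The same e is a unit for x and for u(x), so U maps x \<otimes> 1 to u(x)
      \<otimes> 1.\<close>
    have "ract Q (u x) e = u x" using uD(3)[OF x e(1)] e(2) by simp
    then have "U (P.emb x) = Q.emb (u x)"
      using x e by (simp add: P.emb_eq Q.emb_eq[of _ e] uD U_tens P.f_closed)
    then have "W (Q.emb (u x)) = P.emb x"
      using P.emb_closed[OF x e] by (intro W_eq)
    then show "t \<xi> (u x) = f (\<xi> x)" using P.coeff_emb[OF x e \<xi>] by (simp add: t_def)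
  next
    fix bs \<eta> y
    assume \<eta>: "\<eta> \<in> functionals R Q" and y: "y \<in> carrier Q" and bs: "dual_basis R P bs"
    obtain e where e: "e \<in> carrier R" "ract Q y e = y" by (rule unit_Q[OF y])
    let ?w = "W (Q.emb y)"
    have w: "?w \<in> carrier P.T" by (intro W_closed emb_closed y)
    \<comment> \<open>The sum is the coordinate \<eta> of U applied to the dual basis expansion of
      the preimage of y \<otimes> 1.\<close>
    have "lsum D (map (\<lambda>b. f (\<eta> (u (fst b))) \<otimes> t (snd b) y) bs) =
        Q.coeff \<eta> (U (lsum P.T (map (\<lambda>b. P.tn (fst b) (P.coeff (snd b) ?w)) bs)))"
      unfolding t_def using dual_basisD(2)[OF bs] w
      by (intro coeff_U_lsum[OF bs \<eta>, symmetric] P.coeff_closed)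
    also have "\<dots> = Q.coeff \<eta> (Q.emb y)"
      using P.dual_basis_expand[OF bs w] UW[OF emb_closed[OF y]] by simp
    also have "\<dots> = f (\<eta> y)" by (rule Q.coeff_emb[OF y e \<eta>])
    finally show "lsum D (map (\<lambda>b. f (\<eta> (u (fst b))) \<otimes> t (snd b) y) bs) = f (\<eta> y)" .
  qed
  then show ?thesis by blast
qed

text \<open>The inverse is written down from the scalars: y \<otimes> d goes to \<Sum> b \<otimes>
  t(\<beta>, y)d. One composite is the identity by t(\<xi>, u(x)) = f(\<xi>(x)) and the expansion
  over P; the other is compared in all coordinates \<eta> over Q, where it is the sum
  equation.\<close>

lemma invertsI:
  assumes t: "inverse_coeffs R P Q u D f t"
  shows "inverts R P Q u D f"
proof -
  obtain bs where bs: "dual_basis R P bs" by (rule fgp_dual_basis[OF R.lu_ring_axioms fgp_P])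
  obtain cs where cs: "dual_basis R Q cs" by (rule fgp_dual_basis[OF R.lu_ring_axioms fgp_Q])
  note b = dual_basisD(1,2)[OF bs] and tD = inverse_coeffsD[OF t]
  define v where "v y d = lsum P.T (map (\<lambda>b. P.tn (fst b) (t (snd b) y \<otimes> d)) bs)" for y d
  have cD: "t (snd b) y \<otimes> d \<in> carrier D" if "b \<in> set bs" "y \<in> carrier Q" "d \<in> carrier D" for b y d
    using that b by (simp add: P.D.m_closed tD)
  have cT: "P.tn (fst b) (t (snd b) y \<otimes> d) \<in> carrier P.T"
    if "b \<in> set bs" "y \<in> carrier Q" "d \<in> carrier D" for b y d
    using that b cD by (simp add: P.tens_via_closed)
  have v_balanced: "balanced R Q (via f D) P.T v" unfolding balanced_def
  proof (intro conjI ballI)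
    fix y d assume y: "y \<in> carrier Q" and d: "d \<in> carrier (via f D)"
    then have d: "d \<in> carrier D" by simp
    show "v y d \<in> carrier P.T"
      unfolding v_def using cT y d by (intro P.T.lsum_closed) auto
    { fix y' assume y': "y' \<in> carrier Q"
      have "v (y \<oplus>\<^bsub>Q\<^esub> y') d = lsum P.T (map (\<lambda>b. P.tn (fst b) (t (snd b) y \<otimes> d) \<oplus>\<^bsub>P.T\<^esub>
          P.tn (fst b) (t (snd b) y' \<otimes> d)) bs)"
        unfolding v_def using b y y' d
        by (intro lsum_cong) (simp add: tD(1,2) P.D.l_distr P.tens_via_add_right P.D.m_closed)
      also have "\<dots> = v y d \<oplus>\<^bsub>P.T\<^esub> v y' d"
        unfolding v_def using cT y y' d by (intro P.T.lsum_add) auto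
      finally show "v (y \<oplus>\<^bsub>Q\<^esub> y') d = v y d \<oplus>\<^bsub>P.T\<^esub> v y' d" .
    next
      fix d' assume "d' \<in> carrier (via f D)"
      then have d': "d' \<in> carrier D" by simp
      have "v y (d \<oplus> d') = lsum P.T (map (\<lambda>b. P.tn (fst b) (t (snd b) y \<otimes> d) \<oplus>\<^bsub>P.T\<^esub>
          P.tn (fst b) (t (snd b) y \<otimes> d')) bs)"
        unfolding v_def using b y d d'
        by (intro lsum_cong) (simp add: tD(1) P.D.r_distr P.tens_via_add_right P.D.m_closed)
      also have "\<dots> = v y d \<oplus>\<^bsub>P.T\<^esub> v y d'"
        unfolding v_def using cT y d d' by (intro P.T.lsum_add) auto
      finally show "v y (d \<oplus>\<^bsub>via f D\<^esub> d') = v y d \<oplus>\<^bsub>P.T\<^esub> v y d'" by simp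
    }
  next
    fix y r d assume "y \<in> carrier Q" "r \<in> carrier R" "d \<in> carrier (via f D)"
    then show "v (ract Q y r) d = v y (lact (via f D) r d)"
      unfolding v_def using b by (intro lsum_cong) (simp add: tD(1,3) P.D.m_assoc P.f_closed)
  qed
  define V where "V = tensor_lift P.T v"
  have V_hom: "V \<in> hom (add_monoid Q.T) (add_monoid P.T)"
    unfolding V_def by (rule Q.lift_hom[OF P.abelian_group_tensor v_balanced])
  have V_tens: "V (Q.tn y d) = v y d" if "y \<in> carrier Q" "d \<in> carrier D" for y d
    unfolding V_def using Q.lift_tens[OF P.abelian_group_tensor v_balanced, of y d] that by simp
  have VU: "V (U s) = s" if "s \<in> carrier P.T" for s
  proof (rule P.tensor_hom_eqI[OF _ _ _ that])
    show "(\<lambda>s. V (U s)) \<in> hom (add_monoid P.T) (add_monoid P.T)"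
      using add_homD[OF U_hom] add_homD[OF V_hom] by (auto simp: hom_def)
    show "(\<lambda>s. s) \<in> hom (add_monoid P.T) (add_monoid P.T)"
      by (auto simp: hom_def)
    fix x d assume x: "x \<in> carrier P" and "d \<in> carrier (via f D)"
    then have d: "d \<in> carrier D" by simp
    have "V (U (P.tn x d)) = v (u x) d" using x d by (simp add: U_tens V_tens uD)
    also have "\<dots> = lsum P.T (map (\<lambda>b. P.tn (fst b) (P.coeff (snd b) (P.tn x d))) bs)"
      unfolding v_def using b x d by (intro lsum_cong) (simp add: tD(4) P.coeff_tens)
    also have "\<dots> = P.tn x d" using x d by (intro P.dual_basis_expand[OF bs] P.tens_via_closed)
    finally show "V (U (P.tn x d)) = P.tn x d" .
  qed
  have UV: "U (V s) = s" if "s \<in> carrier Q.T" for s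
  proof (rule Q.tensor_hom_eqI[OF _ _ _ that])
    show "(\<lambda>s. U (V s)) \<in> hom (add_monoid Q.T) (add_monoid Q.T)"
      using add_homD[OF U_hom] add_homD[OF V_hom] by (auto simp: hom_def)
    show "(\<lambda>s. s) \<in> hom (add_monoid Q.T) (add_monoid Q.T)"
      by (auto simp: hom_def)
    fix y d assume y: "y \<in> carrier Q" and "d \<in> carrier (via f D)"
    then have d: "d \<in> carrier D" by simp
    have yd: "Q.tn y d \<in> carrier Q.T" using y d by (rule Q.tens_via_closed)
    show "U (V (Q.tn y d)) = Q.tn y d"
    proof (rule Q.coeff_eqI[OF cs _ yd])
      show "U (V (Q.tn y d)) \<in> carrier Q.T"
        by (intro add_homD(1)[OF U_hom] add_homD(1)[OF V_hom] yd)
      fix \<eta> assume \<eta>: "\<eta> \<in> functionals R Q"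
      have f\<eta>: "f (\<eta> (u (fst b))) \<in> carrier D" if "b \<in> set bs" for b
        using b[OF that] by (intro P.f_closed functionalD(1)[OF \<eta>] uD(1))
      have "Q.coeff \<eta> (U (V (Q.tn y d))) =
          lsum D (map (\<lambda>b. f (\<eta> (u (fst b))) \<otimes> (t (snd b) y \<otimes> d)) bs)"
        using cD y d by (simp add: V_tens v_def coeff_U_lsum[OF bs \<eta>])
      also have "\<dots> = lsum D (map (\<lambda>b. (f (\<eta> (u (fst b))) \<otimes> t (snd b) y) \<otimes> d) bs)"
        using b y d f\<eta> by (intro lsum_cong) (simp add: tD(1) P.D.m_assoc)
      also have "\<dots> = lsum D (map (\<lambda>b. f (\<eta> (u (fst b))) \<otimes> t (snd b) y) bs) \<otimes> d"
        using b y d f\<eta> by (intro P.D.lsum_mult_right[symmetric]) (simp_all add: tD(1) P.D.m_closed)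
      also have "\<dots> = Q.coeff \<eta> (Q.tn y d)"
        using inverse_coeffs_sum[OF t bs \<eta> y] y d \<eta> by (simp add: Q.coeff_tens)
      finally show "Q.coeff \<eta> (U (V (Q.tn y d))) = Q.coeff \<eta> (Q.tn y d)" .
    qed
  qed
  have "bij_betw U (carrier P.T) (carrier Q.T)"
    using VU UV add_homD(1)[OF U_hom] add_homD(1)[OF V_hom] by (intro bij_betw_byWitness[of _ V]) auto
  then show ?thesis using U_rmod_hom by (simp add: inverts_def rmod_iso_def)
qed

text \<open>With dual bases (b, \<beta>) of P and (c, \<gamma>) of Q, evaluate \<Sum> t(\<xi>,
  c)f(\<gamma>(u(b)))t'(\<beta>, y) in two ways. Summing over b first gives \<Sum> t(\<xi>,
  c)f(\<gamma>(y)) = t(\<xi>, y); summing over c first turns the left part into t(\<xi>, u(b)) =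
  f(\<xi>(b)). This is the argument that a left inverse equals a right inverse. Two families yield
  uniqueness; t' = t yields left units.\<close>

lemma inverse_coeffs_expand:
  assumes t: "inverse_coeffs R P Q u D f t" and t': "inverse_coeffs R P Q u D f t'"
    and bs: "dual_basis R P bs" and \<xi>: "\<xi> \<in> functionals R P" and y: "y \<in> carrier Q"
  shows "t \<xi> y = lsum D (map (\<lambda>b. f (\<xi> (fst b)) \<otimes> t' (snd b) y) bs)"
proof -
  let ?a = "\<lambda>c. t \<xi> (fst c)" and ?m = "\<lambda>c b. f (snd c (u (fst b)))" and ?s = "\<lambda>b. t' (snd b) y"
  obtain cs where cs: "dual_basis R Q cs" by (rule fgp_dual_basis[OF R.lu_ring_axioms fgp_Q])
  note b = dual_basisD(1,2)[OF bs] and c = dual_basisD(1,2)[OF cs]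
  note tD = inverse_coeffsD[OF t \<xi>] and t'D = inverse_coeffsD[OF t']
  \<comment> \<open>By additivity and right linearity, t(\<xi>, z) is determined by the values at
    the basis elements of Q.\<close>
  have expand: "lsum D (map (\<lambda>c. ?a c \<otimes> f (snd c z)) cs) = t \<xi> z" if z: "z \<in> carrier Q" for z
  proof -
    have "lsum D (map (\<lambda>c. ?a c \<otimes> f (snd c z)) cs) =
        lsum D (map (\<lambda>c. t \<xi> (ract Q (fst c) (snd c z))) cs)"
      using c z by (intro lsum_cong) (simp add: tD(3) Q.M.functional_closed)
    also have "\<dots> = t \<xi> (lsum Q (map (\<lambda>c. ract Q (fst c) (snd c z)) cs))"
      using c z
      by (intro add_hom_lsum[OF tD(5) Q.M.M.abelian_group_axioms P.D.abelian_group_axioms, symmetric])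
        (simp add: Q.M.ract_closed Q.M.functional_closed)
    finally show ?thesis using dual_basisD(3)[OF cs z] by simp
  qed
  have cl: "?a c \<in> carrier D" "?m c b \<in> carrier D" "?s b \<in> carrier D"
    if "c \<in> set cs" "b \<in> set bs" for c b
    using c[OF that(1)] b[OF that(2)] y
    by (simp_all add: tD(1) t'D(1) P.f_closed Q.M.functional_closed uD)
  have "t \<xi> y = lsum D (map (\<lambda>c. ?a c \<otimes>
      lsum D (map (\<lambda>b. ?m c b \<otimes> ?s b) bs)) cs)"
    unfolding expand[OF y, symmetric]
    using c y by (intro lsum_cong) (simp add: inverse_coeffs_sum[OF t' bs])
  also have "\<dots> = lsum D (map (\<lambda>c. lsum D (map (\<lambda>b. (?a c \<otimes> ?m c b) \<otimes> ?s b) bs)) cs)"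
  proof (rule lsum_cong)
    fix x assume x: "x \<in> set cs"
    have "?a x \<otimes> lsum D (map (\<lambda>b. ?m x b \<otimes> ?s b) bs) =
        lsum D (map (\<lambda>b. ?a x \<otimes> (?m x b \<otimes> ?s b)) bs)"
      using x cl c[OF x] by (intro P.D.lsum_mult_left) (simp_all add: P.D.m_closed tD(1))
    also have "\<dots> = lsum D (map (\<lambda>b. (?a x \<otimes> ?m x b) \<otimes> ?s b) bs)"
      using x cl by (intro lsum_cong) (simp add: P.D.m_assoc)
    finally show "?a x \<otimes> lsum D (map (\<lambda>b. ?m x b \<otimes> ?s b) bs) =
        lsum D (map (\<lambda>b. (?a x \<otimes> ?m x b) \<otimes> ?s b) bs)" .
  qed
  also have "\<dots> = lsum D (map (\<lambda>b. lsum D (map (\<lambda>c. (?a c \<otimes> ?m c b) \<otimes> ?s b) cs)) bs)"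
    using cl by (intro P.D.lsum_swap) (simp add: P.D.m_closed)
  also have "\<dots> = lsum D (map (\<lambda>b. f (\<xi> (fst b)) \<otimes> ?s b) bs)"
  proof (rule lsum_cong)
    fix x assume x: "x \<in> set bs"
    have "lsum D (map (\<lambda>c. (?a c \<otimes> ?m c x) \<otimes> ?s x) cs) =
        lsum D (map (\<lambda>c. ?a c \<otimes> ?m c x) cs) \<otimes> ?s x"
      using x cl b[OF x] y by (intro P.D.lsum_mult_right[symmetric]) (simp_all add: P.D.m_closed t'D(1))
    also have "\<dots> = f (\<xi> (fst x)) \<otimes> ?s x"
      using expand[OF uD(1)] tD(4) b[OF x] by simp
    finally show "lsum D (map (\<lambda>c. (?a c \<otimes> ?m c x) \<otimes> ?s x) cs) =
        f (\<xi> (fst x)) \<otimes> ?s x" .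
  qed
  finally show ?thesis .
qed

text \<open>The right-hand side of the expansion depends on \<open>t'\<close> only, so t and
  \<open>t'\<close> are both equal to it.\<close>

lemma inverse_coeffs_unique:
  assumes t: "inverse_coeffs R P Q u D f t" and t': "inverse_coeffs R P Q u D f t'"
    and "\<xi> \<in> functionals R P" "y \<in> carrier Q"
  shows "t \<xi> y = t' \<xi> y"
proof -
  obtain bs where "dual_basis R P bs" by (rule fgp_dual_basis[OF R.lu_ring_axioms fgp_P])
  then show ?thesis
    using inverse_coeffs_expand[OF t t' _ assms(3,4)] inverse_coeffs_expand[OF t' t' _ assms(3,4)] by simp
qed

end

section \<open>Cohn localisation\<close>

definition cohn_gens ::
  "'r ring \<Rightarrow> 'i set \<Rightarrow> ('i \<Rightarrow> ('r, 'p) rmod) \<Rightarrow> ('i \<Rightarrow> ('r, 'q) rmod) \<Rightarrow> ('r + 'i \<times> ('p \<Rightarrow> 'r) \<times> 'q) set" where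
  "cohn_gens R I P Q = Inl ` carrier R \<union>
     {Inr (i, \<xi>, y) | i \<xi> y. i \<in> I \<and> \<xi> \<in> functionals R (P i) \<and> y \<in> carrier (Q i)}"

text \<open>The first two families turn r \<mapsto> \<open>Inl r\<close> into a homomorphism; the
  other four are the equations of \<open>inverse_coeffs\<close> for the symbols of each i. All dual
  bases occur, so the ring depends on no choice of them.\<close>

definition cohn_rels ::
  "'r ring \<Rightarrow> 'i set \<Rightarrow> ('i \<Rightarrow> ('r, 'p) rmod) \<Rightarrow> ('i \<Rightarrow> ('r, 'q) rmod) \<Rightarrow> ('i \<Rightarrow> 'p \<Rightarrow> 'q)
    \<Rightarrow> (('r + 'i \<times> ('p \<Rightarrow> 'r) \<times> 'q) list list \<times> ('r + 'i \<times> ('p \<Rightarrow> 'r) \<times> 'q) list list) set" where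
  "cohn_rels R I P Q u =
     {([[Inl (r \<oplus>\<^bsub>R\<^esub> s)]], [[Inl r], [Inl s]]) | r s. r \<in> carrier R \<and> s \<in> carrier R} \<union>
     {([[Inl (r \<otimes>\<^bsub>R\<^esub> s)]], [[Inl r, Inl s]]) | r s. r \<in> carrier R \<and> s \<in> carrier R} \<union>
     {([[Inr (i, \<xi>, y \<oplus>\<^bsub>Q i\<^esub> y')]], [[Inr (i, \<xi>, y)], [Inr (i, \<xi>, y')]]) | i \<xi> y y'.
        i \<in> I \<and> \<xi> \<in> functionals R (P i) \<and> y \<in> carrier (Q i) \<and> y' \<in> carrier (Q i)} \<union>
     {([[Inr (i, \<xi>, ract (Q i) y r)]], [[Inr (i, \<xi>, y), Inl r]]) | i \<xi> y r.
        i \<in> I \<and> \<xi> \<in> functionals R (P i) \<and> y \<in> carrier (Q i) \<and> r \<in> carrier R} \<union>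
     {([[Inr (i, \<xi>, u i x)]], [[Inl (\<xi> x)]]) | i \<xi> x.
        i \<in> I \<and> \<xi> \<in> functionals R (P i) \<and> x \<in> carrier (P i)} \<union>
     {(map (\<lambda>b. [Inl (\<eta> (u i (fst b))), Inr (i, snd b, y)]) bs, [[Inl (\<eta> y)]]) | i bs \<eta> y.
        i \<in> I \<and> dual_basis R (P i) bs \<and> \<eta> \<in> functionals R (Q i) \<and> y \<in> carrier (Q i)}"

locale cohn_data = R: lu_ring R
  for R :: "'r ring" and I :: "'i set" and P :: "'i \<Rightarrow> ('r, 'p) rmod" and Q :: "'i \<Rightarrow> ('r, 'q) rmod"
    and u :: "'i \<Rightarrow> 'p \<Rightarrow> 'q" +
  assumes fgp_P: "i \<in> I \<Longrightarrow> fgp R (P i)" and fgp_Q: "i \<in> I \<Longrightarrow> fgp R (Q i)"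
    and u_hom: "i \<in> I \<Longrightarrow> u i \<in> rmod_hom R (P i) (Q i)"
begin

lemma module_P: "i \<in> I \<Longrightarrow> right_module R (P i)" and module_Q: "i \<in> I \<Longrightarrow> right_module R (Q i)"
  using fgp_P fgp_Q by (auto simp: fgp_def right_smooth_def)

lemma fgp_map_over: "\<lbrakk>i \<in> I; rng D; f \<in> rng_hom R D\<rbrakk> \<Longrightarrow> fgp_map_over R (P i) (Q i) D f (u i)"
  by (intro fgp_map_over.intro fgp_map_over_axioms.intro base_change.intro base_change_axioms.intro
      R.lu_ring_axioms module_P module_Q fgp_P fgp_Q u_hom)

lemma gensI:
  "r \<in> carrier R \<Longrightarrow> Inl r \<in> cohn_gens R I P Q"
  "\<lbrakk>i \<in> I; \<xi> \<in> functionals R (P i); y \<in> carrier (Q i)\<rbrakk> \<Longrightarrow> Inr (i, \<xi>, y) \<in> cohn_gens R I P Q"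
  by (auto simp: cohn_gens_def)

lemma cohn_gens_cases:
  assumes "g \<in> cohn_gens R I P Q"
  obtains (R) r where "g = Inl r" "r \<in> carrier R"
  | (t) i \<xi> y where "g = Inr (i, \<xi>, y)" "i \<in> I" "\<xi> \<in> functionals R (P i)" "y \<in> carrier (Q i)"
  using assms unfolding cohn_gens_def by blast

lemma cohn_rels_cases:
  assumes "(v, w) \<in> cohn_rels R I P Q u"
  obtains
    (add) r s where "v = [[Inl (r \<oplus>\<^bsub>R\<^esub> s)]]" "w = [[Inl r], [Inl s]]" "r \<in> carrier R" "s \<in> carrier R"
  | (mult) r s where "v = [[Inl (r \<otimes>\<^bsub>R\<^esub> s)]]" "w = [[Inl r, Inl s]]" "r \<in> carrier R" "s \<in> carrier R"
  | (tadd) i \<xi> y y' where "v = [[Inr (i, \<xi>, y \<oplus>\<^bsub>Q i\<^esub> y')]]" "w = [[Inr (i, \<xi>, y)], [Inr (i, \<xi>, y')]]"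
      "i \<in> I" "\<xi> \<in> functionals R (P i)" "y \<in> carrier (Q i)" "y' \<in> carrier (Q i)"
  | (tract) i \<xi> y r where "v = [[Inr (i, \<xi>, ract (Q i) y r)]]" "w = [[Inr (i, \<xi>, y), Inl r]]"
      "i \<in> I" "\<xi> \<in> functionals R (P i)" "y \<in> carrier (Q i)" "r \<in> carrier R"
  | (u) i \<xi> x where "v = [[Inr (i, \<xi>, u i x)]]" "w = [[Inl (\<xi> x)]]"
      "i \<in> I" "\<xi> \<in> functionals R (P i)" "x \<in> carrier (P i)"
  | (sum) i bs \<eta> y where "v = map (\<lambda>b. [Inl (\<eta> (u i (fst b))), Inr (i, snd b, y)]) bs" "w = [[Inl (\<eta> y)]]"
      "i \<in> I" "dual_basis R (P i) bs" "\<eta> \<in> functionals R (Q i)" "y \<in> carrier (Q i)"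
  using assms unfolding cohn_rels_def by blast

lemma presentation: "presentation (cohn_gens R I P Q) (cohn_rels R I P Q u)"
proof
  fix v w assume "(v, w) \<in> cohn_rels R I P Q u"
  then show "set v \<subseteq> words (cohn_gens R I P Q) \<and> set w \<subseteq> words (cohn_gens R I P Q)"
  proof (cases rule: cohn_rels_cases)
    case add then show ?thesis by (simp add: words_def gensI)
  next
    case mult then show ?thesis by (simp add: words_def gensI R.m_closed)
  next
    case (tadd i)
    then interpret Q: right_module R "Q i" by (intro module_Q)
    show ?thesis using tadd by (simp add: words_def gensI)
  next
    case (tract i)
    then interpret Q: right_module R "Q i" by (intro module_Q)
    show ?thesis using tract by (simp add: words_def gensI Q.ract_closed)
  next
    case u
    then show ?thesis
      by (simp add: words_def gensI functionalD(1) rmod_homD(1)[OF u_hom])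
  next
    case (sum i bs \<eta> y)
    then have "\<eta> (u i (fst b)) \<in> carrier R \<and> snd b \<in> functionals R (P i)" if "b \<in> set bs" for b
      using dual_basisD(1,2)[OF sum(4) that]
      by (simp add: functionalD(1)[OF sum(5)] rmod_homD(1)[OF u_hom[OF sum(3)]])
    then show ?thesis
      using sum by (auto simp: words_def gensI functionalD(1))
  qed
qed

sublocale pres: presentation "cohn_gens R I P Q" "cohn_rels R I P Q u"
  by (rule presentation)

text \<open>Together with \<open>satisfiesD\<close>: values of the generators in the carrier of D
  obey the relations exactly if they come from a homomorphism f and inverse coefficients for every
  i.\<close>

lemma satisfiesI:
  assumes D: "rng D" and f: "f \<in> rng_hom R D"
    and t: "\<And>i. i \<in> I \<Longrightarrow> inverse_coeffs R (P i) (Q i) (u i) D f (t i)"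
  defines "\<rho> \<equiv> case_sum f (\<lambda>(i, \<xi>, y). t i \<xi> y)"
  shows "satisfies D \<rho> (cohn_rels R I P Q u)"
    and "g \<in> cohn_gens R I P Q \<Longrightarrow> \<rho> g \<in> carrier D"
proof -
  interpret D: rng D by (rule D)
  note fD = rng_homD[OF f]
  note tD = inverse_coeffsD[OF t]
  show "\<rho> g \<in> carrier D" if "g \<in> cohn_gens R I P Q"
    using that by (auto simp: cohn_gens_def \<rho>_def fD tD(1))
  have [simp]: "lsum D [x] = x" if "x \<in> carrier D" for x using that by simp
  show "satisfies D \<rho> (cohn_rels R I P Q u)"
    unfolding satisfies_def
  proof (safe, goal_cases)
    case (1 v w)
    then show ?case
    proof (cases rule: cohn_rels_cases)
      case (sum i bs \<eta> y)
      then have "lsum D (map (wprod D \<rho>) v) = f (\<eta> y)"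
        using inverse_coeffs_sum[OF t sum(4,5,6)] by (simp add: \<rho>_def o_def)
      then show ?thesis using sum by (simp add: \<rho>_def fD functionalD(1))
    qed (simp_all add: \<rho>_def fD tD D.m_closed functionalD(1))
  qed
qed

text \<open>Applied to the tautological values \<open>pres.gen\<close>, this gives
  \<open>loc\<close> and \<open>inv_coef\<close> their properties.\<close>

lemma satisfiesD:
  assumes D: "rng D" and \<rho>: "\<And>g. g \<in> cohn_gens R I P Q \<Longrightarrow> \<rho> g \<in> carrier D"
    and sat: "satisfies D \<rho> (cohn_rels R I P Q u)"
  defines "f \<equiv> restrict (\<lambda>r. \<rho> (Inl r)) (carrier R)"
  shows "f \<in> rng_hom R D"
    and "i \<in> I \<Longrightarrow> inverse_coeffs R (P i) (Q i) (u i) D f (\<lambda>\<xi> y. \<rho> (Inr (i, \<xi>, y)))"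
proof -
  let ?E = "cohn_rels R I P Q u"
  interpret D: rng D by (rule D)
  have sat: "lsum D (map (wprod D \<rho>) v) = lsum D (map (wprod D \<rho>) w)"
    if "(v, w) \<in> ?E" for v w
    using sat that by (auto simp: satisfies_def)
  have \<rho>R: "\<rho> (Inl r) \<in> carrier D" if "r \<in> carrier R" for r using \<rho> that by (auto simp: cohn_gens_def)
  show "f \<in> rng_hom R D"
  proof (rule rng_homI)
    fix r s assume rs: "r \<in> carrier R" "s \<in> carrier R"
    show "f (r \<oplus>\<^bsub>R\<^esub> s) = f r \<oplus>\<^bsub>D\<^esub> f s"
      using sat[of "[[Inl (r \<oplus>\<^bsub>R\<^esub> s)]]" "[[Inl r], [Inl s]]"] rs \<rho>R
      by (force simp: cohn_rels_def f_def)
    have "([[Inl (r \<otimes>\<^bsub>R\<^esub> s)]], [[Inl r, Inl s]]) \<in> ?E"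
      using rs unfolding cohn_rels_def by blast
    from sat[OF this] show "f (r \<otimes>\<^bsub>R\<^esub> s) = f r \<otimes>\<^bsub>D\<^esub> f s"
      using rs \<rho>R by (simp add: f_def R.m_closed D.m_closed)
  qed (auto simp: f_def \<rho>R)
  assume i: "i \<in> I"
  interpret P: right_module R "P i" by (rule module_P[OF i])
  interpret Q: right_module R "Q i" by (rule module_Q[OF i])
  have \<rho>t: "\<rho> (Inr (i, \<xi>, y)) \<in> carrier D" if "\<xi> \<in> functionals R (P i)" "y \<in> carrier (Q i)" for \<xi> y
    using \<rho> that i by (auto simp: cohn_gens_def)
  show "inverse_coeffs R (P i) (Q i) (u i) D f (\<lambda>\<xi> y. \<rho> (Inr (i, \<xi>, y)))"
    unfolding inverse_coeffs_def
  proof (intro conjI ballI allI impI)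
    fix \<xi> y assume \<xi>: "\<xi> \<in> functionals R (P i)" and y: "y \<in> carrier (Q i)"
    show "\<rho> (Inr (i, \<xi>, y)) \<in> carrier D" by (rule \<rho>t[OF \<xi> y])
    { fix y' assume y': "y' \<in> carrier (Q i)"
      have "([[Inr (i, \<xi>, y \<oplus>\<^bsub>Q i\<^esub> y')]], [[Inr (i, \<xi>, y)], [Inr (i, \<xi>, y')]]) \<in> ?E"
        using \<xi> y y' i unfolding cohn_rels_def by blast
      from sat[OF this] show "\<rho> (Inr (i, \<xi>, y \<oplus>\<^bsub>Q i\<^esub> y')) = \<rho> (Inr (i, \<xi>, y)) \<oplus>\<^bsub>D\<^esub> \<rho> (Inr (i, \<xi>, y'))"
        using \<rho>t[OF \<xi>] y y' by simp
    next
      fix r assume r: "r \<in> carrier R"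
      have "([[Inr (i, \<xi>, ract (Q i) y r)]], [[Inr (i, \<xi>, y), Inl r]]) \<in> ?E"
        using \<xi> y r i unfolding cohn_rels_def by blast
      from sat[OF this] show "\<rho> (Inr (i, \<xi>, ract (Q i) y r)) = \<rho> (Inr (i, \<xi>, y)) \<otimes>\<^bsub>D\<^esub> f r"
        using \<rho>t[OF \<xi>] y r \<rho>R by (simp add: Q.ract_closed f_def D.m_closed)
    }
  next
    fix \<xi> x assume \<xi>: "\<xi> \<in> functionals R (P i)" and x: "x \<in> carrier (P i)"
    have "([[Inr (i, \<xi>, u i x)]], [[Inl (\<xi> x)]]) \<in> ?E"
      using \<xi> x i unfolding cohn_rels_def by blast
    from sat[OF this] show "\<rho> (Inr (i, \<xi>, u i x)) = f (\<xi> x)"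
      using \<rho>t[OF \<xi>] \<rho>R x rmod_homD(1)[OF u_hom[OF i]] P.functional_closed[OF \<xi> x] by (simp add: f_def)
  next
    fix bs \<eta> y
    assume \<eta>: "\<eta> \<in> functionals R (Q i)" and y: "y \<in> carrier (Q i)" and bs: "dual_basis R (P i) bs"
    have "(map (\<lambda>b. [Inl (\<eta> (u i (fst b))), Inr (i, snd b, y)]) bs, [[Inl (\<eta> y)]]) \<in> ?E"
      using \<eta> y bs i unfolding cohn_rels_def by blast
    from sat[OF this] have "lsum D (map (\<lambda>b. \<rho> (Inl (\<eta> (u i (fst b)))) \<otimes>\<^bsub>D\<^esub> \<rho> (Inr (i, snd b, y))) bs) = \<rho> (Inl (\<eta> y))"
      using \<rho>R Q.functional_closed[OF \<eta> y] by (simp add: o_def)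
    moreover have "lsum D (map (\<lambda>b. f (\<eta> (u i (fst b))) \<otimes>\<^bsub>D\<^esub> \<rho> (Inr (i, snd b, y))) bs) =
        lsum D (map (\<lambda>b. \<rho> (Inl (\<eta> (u i (fst b)))) \<otimes>\<^bsub>D\<^esub> \<rho> (Inr (i, snd b, y))) bs)"
      using dual_basisD(1)[OF bs] rmod_homD(1)[OF u_hom[OF i]] Q.functional_closed[OF \<eta>]
      by (intro lsum_cong) (simp add: f_def)
    ultimately show "lsum D (map (\<lambda>b. f (\<eta> (u i (fst b))) \<otimes>\<^bsub>D\<^esub> \<rho> (Inr (i, snd b, y))) bs) = f (\<eta> y)"
      using Q.functional_closed[OF \<eta> y] by (simp add: f_def)
  qed
qed

definition loc :: "'r \<Rightarrow> ('r, 'i, 'p, 'q) cohn_elt" where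
  "loc = restrict (\<lambda>r. pres.gen (Inl r)) (carrier R)"

definition inv_coef :: "'i \<Rightarrow> ('p \<Rightarrow> 'r) \<Rightarrow> 'q \<Rightarrow> ('r, 'i, 'p, 'q) cohn_elt" where
  "inv_coef i \<xi> y = pres.gen (Inr (i, \<xi>, y))"

lemma loc_hom: "loc \<in> rng_hom R pres.quot"
  unfolding loc_def by (rule satisfiesD(1)[OF pres.rng_quot pres.gen_closed pres.satisfies_quot])

lemma inv_coef_coeffs: "i \<in> I \<Longrightarrow> inverse_coeffs R (P i) (Q i) (u i) pres.quot loc (inv_coef i)"
  using satisfiesD(2)[OF pres.rng_quot pres.gen_closed pres.satisfies_quot]
  unfolding loc_def[symmetric] inv_coef_def[symmetric] .

text \<open>Units have to be found for generators only. The scalar of (\<xi>, y) has the right unit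
  \<open>loc e\<close> with ye = y, by right linearity. On the left, expanding the scalar with t' =
  t gives \<Sum> \<open>loc\<close> (\<xi>(b)) t(\<beta>, y), which is fixed by a unit of the
  finitely many \<xi>(b).\<close>

lemma quot_lu_ring: "lu_ring pres.quot" and loc_nd_hom: "loc \<in> nd_hom R pres.quot"
proof -
  interpret C: rng pres.quot by (rule pres.rng_quot)
  note locD = rng_homD[OF loc_hom]
  have "(\<exists>a\<in>carrier R. loc a \<otimes>\<^bsub>pres.quot\<^esub> pres.gen g = pres.gen g) \<and>
      (\<exists>b\<in>carrier R. pres.gen g \<otimes>\<^bsub>pres.quot\<^esub> loc b = pres.gen g)"
    if "g \<in> cohn_gens R I P Q" for g
    using that
  proof (cases rule: cohn_gens_cases)
    case (R r)
    obtain e where e: "e \<in> carrier R" "e \<otimes>\<^bsub>R\<^esub> r = r" "r \<otimes>\<^bsub>R\<^esub> e = r"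
      by (rule R.common_unit2[OF R(2) R(2)])
    have "pres.gen g = loc r" using R by (simp add: loc_def)
    moreover have "loc e \<otimes>\<^bsub>pres.quot\<^esub> loc r = loc r" "loc r \<otimes>\<^bsub>pres.quot\<^esub> loc e = loc r"
      using locD(3)[OF e(1) R(2)] locD(3)[OF R(2) e(1)] e by simp_all
    ultimately show ?thesis using e(1) by auto
  next
    case (t i \<xi> y)
    interpret P: right_module R "P i" by (rule module_P[OF t(2)])
    interpret F: fgp_map_over R "P i" "Q i" pres.quot loc "u i"
      by (rule fgp_map_over[OF t(2) C.rng_axioms loc_hom])
    have g: "pres.gen g = inv_coef i \<xi> y" by (simp add: inv_coef_def t(1))
    note T = inv_coef_coeffs[OF t(2)]
    obtain e where e: "e \<in> carrier R" "ract (Q i) y e = y" by (rule F.unit_Q[OF t(4)])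
    have right: "inv_coef i \<xi> y \<otimes>\<^bsub>pres.quot\<^esub> loc e = inv_coef i \<xi> y"
      using inverse_coeffsD(3)[OF T t(3,4) e(1)] e(2) by simp
    obtain bs where bs: "dual_basis R (P i) bs"
      by (rule fgp_dual_basis[OF R.lu_ring_axioms fgp_P[OF t(2)]])
    have \<xi>b: "\<xi> (fst b) \<in> carrier R" "inv_coef i (snd b) y \<in> carrier pres.quot" if "b \<in> set bs" for b
      using dual_basisD(1,2)[OF bs that] t P.functional_closed inverse_coeffsD(1)[OF T] by auto
    then have "\<exists>c\<in>carrier R. loc c \<otimes>\<^bsub>pres.quot\<^esub> inv_coef i \<xi> y = inv_coef i \<xi> y"
      unfolding F.inverse_coeffs_expand[OF T T bs t(3,4)]
      by (intro lsum_left_unit[OF R.lu_ring_axioms C.rng_axioms loc_hom])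
    then show ?thesis using e(1) right unfolding g by blast
  qed
  then show "lu_ring pres.quot" "loc \<in> nd_hom R pres.quot"
    using pres.quot_lu_ring[OF R.lu_ring_axioms loc_hom] by blast+
qed

text \<open>\<open>loc\<close> can be cancelled: two homomorphisms that agree on R carry
  \<open>inv_coef\<close> to inverse coefficients over one and the same map from R to D, and those
  are unique.\<close>

lemma quot_hom_eqI:
  assumes D: "rng D" and g: "g \<in> rng_hom pres.quot D" and h: "h \<in> rng_hom pres.quot D"
    and eq: "compose (carrier R) g loc = compose (carrier R) h loc"
  shows "g = h"
proof (rule pres.quot_hom_eqI[OF D g h])
  have eqR: "g (loc r) = h (loc r)" if "r \<in> carrier R" for r
    using fun_cong[OF eq, of r] that by (simp add: compose_def)
  fix x assume "x \<in> cohn_gens R I P Q"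
  then show "g (pres.gen x) = h (pres.gen x)"
  proof (cases rule: cohn_gens_cases)
    case (R r)
    then show ?thesis using eqR[of r] by (simp add: loc_def)
  next
    case (t i \<xi> y)
    have f: "compose (carrier R) g loc \<in> rng_hom R D"
      by (rule rng_hom_compose[OF R.rng_axioms loc_hom g])
    interpret F: fgp_map_over R "P i" "Q i" D "compose (carrier R) g loc" "u i"
      by (rule fgp_map_over[OF t(2) D f])
    note im = inverse_coeffs_image[OF inv_coef_coeffs[OF t(2)] pres.rng_quot D R.rng_axioms u_hom[OF t(2)] loc_hom]
    show ?thesis
      using F.inverse_coeffs_unique[OF im[OF g] im[OF h, folded eq] t(3,4)] by (simp add: t(1) inv_coef_def)
  qed
qed

theorem cohn_localisation_quot: "cohn_localisation TYPE('d) R I P Q u pres.quot loc"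
  unfolding cohn_localisation_def
proof (intro conjI ballI allI impI; (elim conjE)?)
  show "lu_ring pres.quot" by (rule quot_lu_ring)
  show "loc \<in> nd_hom R pres.quot" by (rule loc_nd_hom)
  show "inverts R (P i) (Q i) (u i) pres.quot loc" if "i \<in> I" for i
    by (rule fgp_map_over.invertsI[OF fgp_map_over[OF that pres.rng_quot loc_hom] inv_coef_coeffs[OF that]])
next
  fix D :: "'d ring" and f
  assume D: "lu_ring D" and f: "f \<in> nd_hom R D"
  interpret D: lu_ring D by (rule D)
  note f' = nd_hom_rng_hom[OF f]
  show "(\<exists>g\<in>nd_hom pres.quot D. compose (carrier R) g loc = f) \<longleftrightarrow> (\<forall>i\<in>I. inverts R (P i) (Q i) (u i) D f)"
  proof
    assume "\<exists>g\<in>nd_hom pres.quot D. compose (carrier R) g loc = f"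
    then obtain g where g: "g \<in> rng_hom pres.quot D" "compose (carrier R) g loc = f"
      using nd_hom_rng_hom by blast
    show "\<forall>i\<in>I. inverts R (P i) (Q i) (u i) D f"
    proof
      fix i assume i: "i \<in> I"
      show "inverts R (P i) (Q i) (u i) D f"
        by (rule fgp_map_over.invertsI[OF fgp_map_over[OF i D.rng_axioms f']])
          (rule inverse_coeffs_image[OF inv_coef_coeffs[OF i] pres.rng_quot D.rng_axioms R.rng_axioms
              u_hom[OF i] loc_hom g(1), unfolded g(2)])
    qed
  next
    assume "\<forall>i\<in>I. inverts R (P i) (Q i) (u i) D f"
    then have "\<forall>i\<in>I. \<exists>t. inverse_coeffs R (P i) (Q i) (u i) D f t"
      using fgp_map_over.inverse_coeffs_exist[OF fgp_map_over[OF _ D.rng_axioms f']] by blast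
    \<comment> \<open>Scalars are chosen for all i at once; the presentation then sends the symbols
      to them.\<close>
    from bchoice[OF this] obtain t where t: "\<And>i. i \<in> I \<Longrightarrow> inverse_coeffs R (P i) (Q i) (u i) D f (t i)"
      by blast
    obtain g where g: "g \<in> rng_hom pres.quot D"
      "\<And>x. x \<in> cohn_gens R I P Q \<Longrightarrow> g (pres.gen x) = case_sum f (\<lambda>(i, \<xi>, y). t i \<xi> y) x"
      by (rule pres.quot_universal[OF D.rng_axioms satisfiesI(2,1)[OF D.rng_axioms f' t]]) blast+
    have "compose (carrier R) g loc = f"
    proof (rule rng_hom_eqI[OF rng_hom_compose[OF R.rng_axioms loc_hom g(1)] f'])
      fix r assume "r \<in> carrier R"
      then show "compose (carrier R) g loc r = f r"
        using g(2)[of "Inl r"] by (simp add: compose_def loc_def gensI)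
    qed
    moreover have "g \<in> nd_hom pres.quot D"
      by (rule nd_hom_factor[OF R.lu_ring_axioms D.rng_axioms f g(1) loc_hom calculation])
    ultimately show "\<exists>g\<in>nd_hom pres.quot D. compose (carrier R) g loc = f" by blast
  qed
next
  fix D :: "'d ring" and f g h
  assume D: "lu_ring D" and gh: "g \<in> nd_hom pres.quot D" "h \<in> nd_hom pres.quot D"
    "compose (carrier R) g loc = f" "compose (carrier R) h loc = f"
  interpret D: lu_ring D by (rule D)
  show "g = h"
    by (rule quot_hom_eqI[OF D.rng_axioms nd_hom_rng_hom[OF gh(1)] nd_hom_rng_hom[OF gh(2)]]) (simp add: gh)
qed

end

section \<open>Uniqueness, and passage to test rings of any type\<close>

lemma cohn_localisationD:
  assumes "cohn_localisation TYPE('d) R I P Q u C \<phi>"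
  shows "lu_ring C" "\<phi> \<in> nd_hom R C" "i \<in> I \<Longrightarrow> inverts R (P i) (Q i) (u i) C \<phi>"
    and "\<lbrakk>lu_ring (D :: 'd ring); f \<in> nd_hom R D\<rbrakk> \<Longrightarrow>
      (\<exists>g\<in>nd_hom C D. compose (carrier R) g \<phi> = f) \<longleftrightarrow> (\<forall>i\<in>I. inverts R (P i) (Q i) (u i) D f)"
    and "\<lbrakk>lu_ring (D :: 'd ring); f \<in> nd_hom R D; g \<in> nd_hom C D; h \<in> nd_hom C D;
      compose (carrier R) g \<phi> = f; compose (carrier R) h \<phi> = f\<rbrakk> \<Longrightarrow> g = h"
  using assms unfolding cohn_localisation_def by blast+

lemma compose_restrict_id: "f \<in> rng_hom A B \<Longrightarrow> compose (carrier A) (\<lambda>x\<in>carrier B. x) f = f"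
  using rng_homD(1,4)[of f A B] by (auto simp: compose_def fun_eq_iff extensional_def)

lemma compose_restrict_id_right:
  "f \<in> rng_hom A B \<Longrightarrow> compose (carrier A) f (\<lambda>x\<in>carrier A. x) = f"
  using rng_homD(4)[of f A B] by (auto simp: compose_def fun_eq_iff extensional_def)

lemma compose_rng_hom_assoc:
  "f \<in> rng_hom A B \<Longrightarrow> compose (carrier A) h (compose (carrier A) g f) =
    compose (carrier A) (compose (carrier B) h g) f"
  using rng_homD(1)[of f A B] by (auto simp: compose_def fun_eq_iff)

text \<open>Each hypothesis serves one map. Testing C over \<open>'b\<close> gives k, and testing
  \<open>C'\<close> over \<open>'a\<close> gives l; that the composites are identities uses C tested
  over its own type \<open>'a\<close> and \<open>C'\<close> over \<open>'b\<close>.\<close>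

lemma cohn_localisation_unique:
  fixes C :: "'a ring" and C' :: "'b ring"
  assumes R: "lu_ring R"
    and Ca: "cohn_localisation TYPE('a) R I P Q u C \<phi>" and Cb: "cohn_localisation TYPE('b) R I P Q u C \<phi>"
    and C'a: "cohn_localisation TYPE('a) R I P Q u C' \<phi>'" and C'b: "cohn_localisation TYPE('b) R I P Q u C' \<phi>'"
  obtains k l where "k \<in> nd_hom C C'" "l \<in> nd_hom C' C"
    "compose (carrier R) k \<phi> = \<phi>'" "compose (carrier R) l \<phi>' = \<phi>"
    "compose (carrier C) l k = (\<lambda>x\<in>carrier C. x)"
    "compose (carrier C') k l = (\<lambda>x\<in>carrier C'. x)"
proof -
  note C = cohn_localisationD[OF Ca] and C' = cohn_localisationD[OF C'b]
  interpret C: lu_ring C by (rule C(1))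
  interpret C': lu_ring C' by (rule C'(1))
  note \<phi> = nd_hom_rng_hom[OF C(2)] and \<phi>' = nd_hom_rng_hom[OF C'(2)]
  obtain k where k: "k \<in> nd_hom C C'" "compose (carrier R) k \<phi> = \<phi>'"
    using cohn_localisationD(4)[OF Cb C'(1,2)] C'(3) by blast
  obtain l where l: "l \<in> nd_hom C' C" "compose (carrier R) l \<phi>' = \<phi>"
    using cohn_localisationD(4)[OF C'a C(1,2)] C(3) by blast
  have "compose (carrier C) l k = (\<lambda>x\<in>carrier C. x)"
    by (rule C(5)[OF C(1,2) nd_hom_compose[OF C(1) C'(1) C.rng_axioms k(1) l(1)] nd_hom_id[OF C(1)]])
      (simp_all add: compose_rng_hom_assoc[OF \<phi>, symmetric] compose_restrict_id[OF \<phi>] k l)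
  moreover have "compose (carrier C') k l = (\<lambda>x\<in>carrier C'. x)"
    by (rule C'(5)[OF C'(1,2) nd_hom_compose[OF C'(1) C(1) C'.rng_axioms l(1) k(1)] nd_hom_id[OF C'(1)]])
      (simp_all add: compose_rng_hom_assoc[OF \<phi>', symmetric] compose_restrict_id[OF \<phi>'] k l)
  ultimately show thesis using that k l by blast
qed

lemma rng_iso_of_inverse:
  assumes k: "k \<in> rng_hom C C'" and l: "l \<in> rng_hom C' C"
    and "compose (carrier C) l k = (\<lambda>x\<in>carrier C. x)"
    and "compose (carrier C') k l = (\<lambda>x\<in>carrier C'. x)"
  shows "k \<in> rng_iso C C'"
proof -
  have "l (k x) = x" if "x \<in> carrier C" for x
    using fun_cong[OF assms(3), of x] that by (simp add: compose_def)
  moreover have "k (l x) = x" if "x \<in> carrier C'" for x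
    using fun_cong[OF assms(4), of x] that by (simp add: compose_def)
  ultimately have "bij_betw k (carrier C) (carrier C')"
    using rng_homD(1)[OF k] rng_homD(1)[OF l] by (intro bij_betw_byWitness[of _ l]) auto
  then show ?thesis using k by (simp add: rng_iso_def)
qed

text \<open>Universality over \<open>'d\<close> is known for C only. Composition with k and with l
  carries factorisations between C and \<open>C'\<close>, and a map g out of \<open>C'\<close> is
  recovered from gk as (gk)l, because kl is the identity.\<close>

lemma cohn_localisation_transport:
  assumes R: "lu_ring R" and C: "cohn_localisation TYPE('d) R I P Q u C \<phi>"
    and C': "cohn_localisation TYPE('e) R I P Q u C' \<phi>'"
    and k: "k \<in> nd_hom C C'" "compose (carrier R) k \<phi> = \<phi>'"
    and l: "l \<in> nd_hom C' C" "compose (carrier R) l \<phi>' = \<phi>"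
    and kl: "compose (carrier C') k l = (\<lambda>x\<in>carrier C'. x)"
  shows "cohn_localisation TYPE('d) R I P Q u C' \<phi>'"
  unfolding cohn_localisation_def
proof (intro conjI ballI allI impI; (elim conjE)?)
  note CD = cohn_localisationD[OF C] and C'D = cohn_localisationD(1,2,3)[OF C']
  note \<phi> = nd_hom_rng_hom[OF CD(2)] and \<phi>' = nd_hom_rng_hom[OF C'D(2)]
    and l' = nd_hom_rng_hom[OF l(1)]
  show "lu_ring C'" "\<phi>' \<in> nd_hom R C'" by (fact C'D)+
  show "inverts R (P i) (Q i) (u i) C' \<phi>'" if "i \<in> I" for i by (rule C'D(3)[OF that])
  fix D :: "'d ring" and f assume D: "lu_ring D" and f: "f \<in> nd_hom R D"
  interpret D: lu_ring D by (rule D)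
  have push: "compose (carrier C) g k \<in> nd_hom C D"
    "compose (carrier R) (compose (carrier C) g k) \<phi> = compose (carrier R) g \<phi>'" if "g \<in> nd_hom C' D" for g
    using nd_hom_compose[OF CD(1) C'D(1) D.rng_axioms k(1) that]
    by (simp_all add: compose_rng_hom_assoc[OF \<phi>, symmetric] k(2))
  have pull: "compose (carrier C') g l \<in> nd_hom C' D"
    "compose (carrier R) (compose (carrier C') g l) \<phi>' = compose (carrier R) g \<phi>" if "g \<in> nd_hom C D" for g
    using nd_hom_compose[OF C'D(1) CD(1) D.rng_axioms l(1) that]
    by (simp_all add: compose_rng_hom_assoc[OF \<phi>', symmetric] l(2))
  have "(\<exists>g\<in>nd_hom C' D. compose (carrier R) g \<phi>' = f) \<longleftrightarrow> (\<exists>g\<in>nd_hom C D. compose (carrier R) g \<phi> = f)"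
    using push pull by metis
  then show "(\<exists>g\<in>nd_hom C' D. compose (carrier R) g \<phi>' = f) \<longleftrightarrow> (\<forall>i\<in>I. inverts R (P i) (Q i) (u i) D f)"
    using CD(4)[OF D f] by simp
  fix g h assume g: "g \<in> nd_hom C' D" "compose (carrier R) g \<phi>' = f"
    and h: "h \<in> nd_hom C' D" "compose (carrier R) h \<phi>' = f"
  have "compose (carrier C) g k = compose (carrier C) h k"
    by (rule CD(5)[OF D f push(1)[OF g(1)] push(1)[OF h(1)]]) (simp_all add: push(2) g h)
  then have "compose (carrier C') (compose (carrier C) g k) l = compose (carrier C') (compose (carrier C) h k) l"
    by simp
  then show "g = h"
    by (simp add: compose_rng_hom_assoc[OF l', symmetric] kl
        compose_restrict_id_right[OF nd_hom_rng_hom[OF g(1)]] compose_restrict_id_right[OF nd_hom_rng_hom[OF h(1)]])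
qed

lemma cohn_localisation_cohn:
  fixes R :: "'r ring" and P :: "'i \<Rightarrow> ('r, 'p) rmod" and Q :: "'i \<Rightarrow> ('r, 'q) rmod"
  assumes "cohn_data R I P Q u"
  shows "cohn_localisation TYPE('d) R I P Q u (fst (cohn R I P Q u)) (snd (cohn R I P Q u))"
proof -
  interpret cohn_data R I P Q u by fact
  have "case cohn R I P Q u of (C, \<phi>) \<Rightarrow> cohn_localisation TYPE(('r, 'i, 'p, 'q) cohn_elt) R I P Q u C \<phi>"
    \<comment> \<open>\<open>pres.quot\<close> has exactly the type over which the choice ranges, so
      there is something to choose.\<close>
    unfolding cohn_def by (rule someI[of _ "(pres.quot, loc)"]) (simp add: cohn_localisation_quot)
  then have C: "cohn_localisation TYPE(('r, 'i, 'p, 'q) cohn_elt) R I P Q u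
      (fst (cohn R I P Q u)) (snd (cohn R I P Q u))" by (simp add: case_prod_beta)
  obtain k l where "k \<in> nd_hom pres.quot (fst (cohn R I P Q u))" "l \<in> nd_hom (fst (cohn R I P Q u)) pres.quot"
    "compose (carrier R) k loc = snd (cohn R I P Q u)" "compose (carrier R) l (snd (cohn R I P Q u)) = loc"
    "compose (carrier (fst (cohn R I P Q u))) k l = restrict (\<lambda>x. x) (carrier (fst (cohn R I P Q u)))"
    by (rule cohn_localisation_unique[OF R.lu_ring_axioms cohn_localisation_quot cohn_localisation_quot C C])
  then show ?thesis
    by (intro cohn_localisation_transport[OF R.lu_ring_axioms cohn_localisation_quot C])
qed

section \<open>Representations of a proper bimodule\<close>

text \<open>The right module eM from the definition of \<open>proper\<close>.\<close>

definition slice :: "('l, 'r, 'm) bimod \<Rightarrow> 'l \<Rightarrow> ('l, 'r, 'm) bimod" where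
  "slice M e = M\<lparr>carrier := lact M e ` carrier M\<rparr>"

lemma slice_simps [simp]:
  "add (slice M e) = add M" "zero (slice M e) = zero M" "ract (slice M e) = ract M"
  by (simp_all add: slice_def)

lemma lsum_slice [simp]: "lsum (slice M e) xs = lsum M xs"
  by (simp add: lsum_def)

text \<open>
  The scalars \<open>t \<xi> e\<close> play the role of \<open>\<xi>(\<nu>\<inverse>(e))\<close>; the equations say that they are the
  coefficients of local inverses of \<open>x \<otimes> d \<mapsto> \<nu>(x)d\<close>.
\<close>

definition rep_coeffs ::
  "'a ring \<Rightarrow> ('a, 'a, 'm) bimod \<Rightarrow> 'd ring \<Rightarrow> ('a \<Rightarrow> 'd) \<Rightarrow> ('m \<Rightarrow> 'd) \<Rightarrow> (('m \<Rightarrow> 'a) \<Rightarrow> 'a \<Rightarrow> 'd) \<Rightarrow> bool" where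
  "rep_coeffs A M D f \<nu> t \<longleftrightarrow> (\<forall>e\<in>carrier A. e \<otimes>\<^bsub>A\<^esub> e = e \<longrightarrow>
     (\<forall>\<xi>\<in>functionals A (slice M e). t \<xi> e \<in> carrier D \<and> t \<xi> e \<otimes>\<^bsub>D\<^esub> f e = t \<xi> e \<and>
        (\<forall>x\<in>carrier (slice M e). t \<xi> e \<otimes>\<^bsub>D\<^esub> \<nu> x = f (\<xi> x))) \<and>
     (\<forall>bs. dual_basis A (slice M e) bs \<longrightarrow>
        lsum D (map (\<lambda>b. \<nu> (fst b) \<otimes>\<^bsub>D\<^esub> t (snd b) e) bs) = f e))"

lemma rep_coeffsD:
  assumes "rep_coeffs A M D f \<nu> t" "e \<in> carrier A" "e \<otimes>\<^bsub>A\<^esub> e = e"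
  shows "\<xi> \<in> functionals A (slice M e) \<Longrightarrow> t \<xi> e \<in> carrier D"
    and "\<xi> \<in> functionals A (slice M e) \<Longrightarrow> t \<xi> e \<otimes>\<^bsub>D\<^esub> f e = t \<xi> e"
    and "\<lbrakk>\<xi> \<in> functionals A (slice M e); x \<in> carrier (slice M e)\<rbrakk> \<Longrightarrow> t \<xi> e \<otimes>\<^bsub>D\<^esub> \<nu> x = f (\<xi> x)"
    and "dual_basis A (slice M e) bs \<Longrightarrow> lsum D (map (\<lambda>b. \<nu> (fst b) \<otimes>\<^bsub>D\<^esub> t (snd b) e) bs) = f e"
  using assms unfolding rep_coeffs_def by blast+

locale proper_bimodule = A: lu_ring A + M: bimodule A A M
  for A :: "'a ring" and M :: "('a, 'a, 'm) bimod" +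
  assumes proper: "proper A A M"
begin

lemma slice_carrier:
  assumes "e \<in> carrier A" "e \<otimes>\<^bsub>A\<^esub> e = e"
  shows "x \<in> carrier (slice M e) \<longleftrightarrow> x \<in> carrier M \<and> lact M e x = x"
proof
  assume "x \<in> carrier (slice M e)"
  then obtain y where "y \<in> carrier M" "x = lact M e y" by (auto simp: slice_def)
  then show "x \<in> carrier M \<and> lact M e x = x"
    using M.lact_assoc[of e e y] assms by (simp add: M.lact_closed)
next
  assume "x \<in> carrier M \<and> lact M e x = x"
  then show "x \<in> carrier (slice M e)" by (auto simp: slice_def intro: rev_image_eqI)
qed

lemma fgp_slice: "\<lbrakk>e \<in> carrier A; e \<otimes>\<^bsub>A\<^esub> e = e\<rbrakk> \<Longrightarrow> fgp A (slice M e)"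
  using proper by (simp add: proper_def slice_def)

lemma slice_dual_basis:
  assumes "e \<in> carrier A" "e \<otimes>\<^bsub>A\<^esub> e = e"
  obtains bs where "dual_basis A (slice M e) bs"
  by (rule fgp_dual_basis[OF A.lu_ring_axioms fgp_slice[OF assms]])

text \<open>Precomposition with left multiplication by e, which maps M onto eM. It makes coordinates
  on M \<otimes> D available for functionals that live on a slice.\<close>

lemma extend_functional:
  assumes e: "e \<in> carrier A" "e \<otimes>\<^bsub>A\<^esub> e = e" and \<xi>: "\<xi> \<in> functionals A (slice M e)"
  shows "(\<lambda>x. \<xi> (lact M e x)) \<in> functionals A M"
proof -
  have "lact M e x \<in> carrier (slice M e)" if "x \<in> carrier M" for x
    using that M.lact_assoc[of e e x] e by (simp add: slice_carrier M.lact_closed)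
  then show ?thesis
    using functionalD[OF \<xi>] e(1)
    by (simp add: rmod_hom_def M.lact_add_right flip: M.lact_ract)
qed

text \<open>Right smoothness is read off from smoothness as a bimodule, since
  \<open>bitensor\<close> has the carrier and the right action of \<open>tensor\<close>.\<close>

lemma right_unit: assumes "x \<in> carrier M" obtains a where "a \<in> carrier A" "ract M x a = x"
proof -
  have "right_smooth A M"
    using proper M.right_module_axioms carrier_bitensor[of M A "regular A"]
    unfolding proper_def smooth_bimodule_def right_smooth_def bimod_iso_def rmod_iso_def rmod_hom_def
    by (simp add: bitensor_def rmod.defs bimod.defs)
  then show thesis using smooth_local_unit[OF A.lu_ring_axioms _ assms] that by blast
qed

text \<open>By smoothness x is the image of a tensor in A \<otimes> M. A unit of a fixes ay, sums
  take a common unit, and at the end an idempotent above the unit is taken.\<close>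

lemma left_unit:
  assumes x: "x \<in> carrier M"
  obtains e where "e \<in> carrier A" "e \<otimes>\<^bsub>A\<^esub> e = e" "lact M e x = x"
proof -
  interpret reg: bimodule A A "regular A" by (rule bimodule_regular[OF A.rng_axioms])
  interpret T: tensor_pair A A "regular A" M
    by (intro tensor_pair.intro reg.right_module_axioms M.bimodule_axioms)
  have bal: "balanced A (regular A) M M (lact M)"
    by (auto simp: balanced_def M.lact_closed M.lact_add_left M.lact_add_right M.lact_assoc)
  note L = T.lift_hom[OF M.M.abelian_group_axioms bal]
  have "\<exists>a\<in>carrier A. lact M a (tensor_lift M (lact M) w) = tensor_lift M (lact M) w"
    if "w \<in> carrier T.T" for w
    using that
  proof (induction rule: T.tensor_induct)
    case (tens a y)
    then have a: "a \<in> carrier A" by simp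
    obtain e where e: "e \<in> carrier A" "e \<otimes>\<^bsub>A\<^esub> a = a" by (rule A.common_unit2[OF a a])
    then show ?case
      using tens T.lift_tens[OF M.M.abelian_group_axioms bal tens]
      by (intro bexI[of _ e]) (simp_all add: M.lact_assoc[symmetric])
  next
    case (add s t)
    then obtain a b where ab: "a \<in> carrier A" "b \<in> carrier A"
      "lact M a (tensor_lift M (lact M) s) = tensor_lift M (lact M) s"
      "lact M b (tensor_lift M (lact M) t) = tensor_lift M (lact M) t" by blast
    obtain e where e: "e \<in> carrier A" "e \<otimes>\<^bsub>A\<^esub> a = a" "e \<otimes>\<^bsub>A\<^esub> b = b" by (rule A.common_unit2[OF ab(1,2)])
    note c = add_homD(1)[OF L add.hyps(1)] add_homD(1)[OF L add.hyps(2)]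
    have "lact M e (tensor_lift M (lact M) s) = tensor_lift M (lact M) s"
      "lact M e (tensor_lift M (lact M) t) = tensor_lift M (lact M) t"
      using M.lact_assoc[OF e(1) ab(1) c(1)] M.lact_assoc[OF e(1) ab(2) c(2)] e ab by simp_all
    then show ?case
      using e(1) c add.hyps by (intro bexI[of _ e]) (simp_all add: add_homD(2)[OF L] M.lact_add_right)
  qed
  moreover have "tensor_lift M (lact M) ` carrier T.T = carrier M"
    using proper
    by (simp add: proper_def smooth_bimodule_def bimod_iso_def rmod_iso_def bij_betw_def carrier_bitensor)
  then obtain w where "w \<in> carrier T.T" "x = tensor_lift M (lact M) w"
    using x by blast
  ultimately obtain a where a: "a \<in> carrier A" "lact M a x = x" by blast
  obtain e where e: "e \<in> carrier A" "e \<otimes>\<^bsub>A\<^esub> e = e" "e \<otimes>\<^bsub>A\<^esub> a = a" by (rule A.common_unit2[OF a(1) a(1)])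
  have "lact M e x = x" using M.lact_assoc[OF e(1) a(1) x] e a by simp
  then show thesis using that e by blast
qed

end

section \<open>A single degree of a representation: f is its degree 1 part and \<nu> the part in the
  given degree\<close>

locale bimodule_rep = A: lu_ring A + M: proper_bimodule A M + base_change A M D f
  for A :: "'a ring" and M :: "('a, 'a, 'm) bimod" and D :: "'d ring" (structure) and f :: "'a \<Rightarrow> 'd" +
  fixes \<nu> :: "'m \<Rightarrow> 'd"
  assumes \<nu>_closed: "x \<in> carrier M \<Longrightarrow> \<nu> x \<in> carrier D"
    and \<nu>_add: "\<lbrakk>x \<in> carrier M; y \<in> carrier M\<rbrakk> \<Longrightarrow> \<nu> (x \<oplus>\<^bsub>M\<^esub> y) = \<nu> x \<oplus> \<nu> y"
    and \<nu>_ract: "\<lbrakk>x \<in> carrier M; a \<in> carrier A\<rbrakk> \<Longrightarrow> \<nu> (ract M x a) = \<nu> x \<otimes> f a"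
    and \<nu>_lact: "\<lbrakk>x \<in> carrier M; a \<in> carrier A\<rbrakk> \<Longrightarrow> \<nu> (lact M a x) = f a \<otimes> \<nu> x"
begin

abbreviation L where "L \<equiv> tensor_lift D (\<lambda>x d. \<nu> x \<otimes> d)"

lemma \<nu>_hom: "\<nu> \<in> hom (add_monoid M) (add_monoid D)"
  by (auto simp: hom_def \<nu>_closed \<nu>_add)

lemma L_balanced: "balanced A M (via f D) D (\<lambda>x d. \<nu> x \<otimes> d)"
  by (auto simp: balanced_def \<nu>_closed \<nu>_add \<nu>_ract f_closed D.m_closed D.l_distr D.r_distr D.m_assoc)

lemma L_hom: "L \<in> hom (add_monoid T) (add_monoid D)"
  by (rule lift_hom[OF D.abelian_group_axioms L_balanced])

lemma L_tens: "\<lbrakk>x \<in> carrier M; d \<in> carrier D\<rbrakk> \<Longrightarrow> L (tn x d) = \<nu> x \<otimes> d"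
  using lift_tens[OF D.abelian_group_axioms L_balanced, of x d] by simp

lemma L_closed: "w \<in> carrier T \<Longrightarrow> L w \<in> carrier D"
  using add_homD(1)[OF L_hom] .

lemma L_rmod_hom: "L \<in> rmod_hom D T (regular D)"
proof -
  interpret reg: bimodule D D "regular D" by (rule bimodule_regular[OF D.rng_axioms])
  have eq: "tensor_lift (regular D) (\<lambda>x d. \<nu> x \<otimes> d) = L"
    by (rule tensor_lift_cong) simp_all
  have bal: "balanced A M (via f D) (regular D) (\<lambda>x d. \<nu> x \<otimes> d)"
    using L_balanced by (simp add: balanced_def)
  have "tensor_lift (regular D) (\<lambda>x d. \<nu> x \<otimes> d) \<in> rmod_hom D T (regular D)"
    using reg.ract_hom by (intro lift_rmod_hom[OF reg.M.abelian_group_axioms bal])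
      (simp_all add: \<nu>_closed D.m_assoc)
  then show ?thesis by (simp only: eq)
qed

lemma L_ract: "\<lbrakk>w \<in> carrier T; d \<in> carrier D\<rbrakk> \<Longrightarrow> L (ract T w d) = L w \<otimes> d"
  using rmod_homD(3)[OF L_rmod_hom, of w d] by simp

lemma L_lsum:
  assumes "\<And>b. b \<in> set bs \<Longrightarrow> fst b \<in> carrier M" "\<And>b. b \<in> set bs \<Longrightarrow> c b \<in> carrier D"
  shows "L (lsum T (map (\<lambda>b. tn (fst b) (c b)) bs)) = lsum D (map (\<lambda>b. \<nu> (fst b) \<otimes> c b) bs)"
proof -
  have "L (lsum T (map (\<lambda>b. tn (fst b) (c b)) bs)) = lsum D (map (\<lambda>b. L (tn (fst b) (c b))) bs)"
    using assms by (intro add_hom_lsum[OF L_hom abelian_group_tensor D.abelian_group_axioms])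
      (simp add: tens_via_closed)
  also have "\<dots> = lsum D (map (\<lambda>b. \<nu> (fst b) \<otimes> c b) bs)"
    using assms by (intro lsum_cong) (simp add: L_tens)
  finally show ?thesis .
qed

lemma basisD:
  assumes "e \<in> carrier A" "e \<otimes>\<^bsub>A\<^esub> e = e" "dual_basis A (slice M e) bs"
  shows "b \<in> set bs \<Longrightarrow> fst b \<in> carrier M" "b \<in> set bs \<Longrightarrow> fst b \<in> carrier (slice M e)"
    and "b \<in> set bs \<Longrightarrow> snd b \<in> functionals A (slice M e)"
    and "\<lbrakk>b \<in> set bs; x \<in> carrier (slice M e)\<rbrakk> \<Longrightarrow> snd b x \<in> carrier A"
    and "x \<in> carrier (slice M e) \<Longrightarrow> lsum M (map (\<lambda>b. ract M (fst b) (snd b x)) bs) = x"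
proof -
  note b = dual_basisD[OF assms(3)]
  show "fst b \<in> carrier (slice M e)" "snd b \<in> functionals A (slice M e)" if "b \<in> set bs"
    using b(1,2)[OF that] .
  then show "fst b \<in> carrier M" if "b \<in> set bs"
    using that M.slice_carrier[OF assms(1,2)] by blast
  show "snd b x \<in> carrier A" if "b \<in> set bs" "x \<in> carrier (slice M e)"
    by (rule functionalD(1)[OF b(2)[OF that(1)] that(2)])
  show "lsum M (map (\<lambda>b. ract M (fst b) (snd b x)) bs) = x" if "x \<in> carrier (slice M e)"
    using b(3)[OF that] by simp
qed

text \<open>On x \<otimes> d, with a dual basis (b, \<beta>) of eM: \<Sum> \<nu>(b)f(\<beta>(ex))d =
  \<nu>(ex)d = f(e)\<nu>(x)d. As M itself may have no dual basis, L is recovered only up to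
  multiplication by f(e).\<close>

lemma local_expand:
  assumes e: "e \<in> carrier A" "e \<otimes>\<^bsub>A\<^esub> e = e" and bs: "dual_basis A (slice M e) bs"
    and w: "w \<in> carrier T"
  shows "lsum D (map (\<lambda>b. \<nu> (fst b) \<otimes> coeff (\<lambda>x. snd b (lact M e x)) w) bs) = f e \<otimes> L w"
  using w
proof (induction rule: tensor_induct)
  case (tens x d)
  let ?c = "\<lambda>b. coeff (\<lambda>x. snd b (lact M e x))" and ?r = "\<lambda>b. ract M (fst b) (snd b (lact M e x))"
  note b = basisD[OF e bs]
  have d: "d \<in> carrier D" using tens by simp
  have ex: "lact M e x \<in> carrier (slice M e)" "lact M e x \<in> carrier M"
    using tens M.M.lact_assoc[of e e x] e by (simp_all add: M.slice_carrier M.M.lact_closed)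
  have "lsum D (map (\<lambda>b. \<nu> (fst b) \<otimes> ?c b (tn x d)) bs) =
      lsum D (map (\<lambda>b. \<nu> (?r b) \<otimes> d) bs)"
    using b ex tens d
    by (intro lsum_cong)
      (simp add: coeff_tens[OF M.extend_functional[OF e]] \<nu>_ract \<nu>_closed f_closed D.m_assoc)
  also have "\<dots> = lsum D (map (\<lambda>b. \<nu> (?r b)) bs) \<otimes> d"
    using b ex d by (intro D.lsum_mult_right[symmetric]) (simp_all add: \<nu>_closed M.M.ract_closed)
  also have "lsum D (map (\<lambda>b. \<nu> (?r b)) bs) =
      \<nu> (lsum M (map (\<lambda>b. ?r b) bs))"
    using b ex by (intro add_hom_lsum[OF \<nu>_hom M.M.M.abelian_group_axioms D.abelian_group_axioms, symmetric])
      (simp add: M.M.ract_closed)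
  also have "\<dots> = f e \<otimes> \<nu> x"
    using b(5)[OF ex(1)] tens e by (simp add: \<nu>_lact)
  finally show ?case using tens e by (simp add: L_tens f_closed \<nu>_closed D.m_assoc)
next
  case (add s t)
  let ?c = "\<lambda>b. coeff (\<lambda>x. snd b (lact M e x))"
  note b = basisD[OF e bs]
  have c: "?c b w \<in> carrier D" if "b \<in> set bs" "w \<in> carrier T" for b w
    using b(3)[OF that(1)] that(2) by (intro coeff_closed M.extend_functional[OF e])
  have "lsum D (map (\<lambda>b. \<nu> (fst b) \<otimes> ?c b (s \<oplus>\<^bsub>T\<^esub> t)) bs) =
      lsum D (map (\<lambda>b. \<nu> (fst b) \<otimes> ?c b s \<oplus>
        \<nu> (fst b) \<otimes> ?c b t) bs)"
    using b c add.hyps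
    by (intro lsum_cong)
      (simp add: add_homD(2)[OF coeff_hom[OF M.extend_functional[OF e]]] D.r_distr \<nu>_closed)
  also have "\<dots> = f e \<otimes> L s \<oplus> f e \<otimes> L t"
    using b c add by (subst D.lsum_add) (simp_all add: \<nu>_closed D.m_closed)
  finally show ?case
    using add.hyps e by (simp add: add_homD(2)[OF L_hom] D.r_distr f_closed L_closed)
qed

lemma rep_coeffs_exist:
  assumes iso: "L \<in> rmod_iso D T (regular D)"
  shows "\<exists>t. rep_coeffs A M D f \<nu> t"
proof -
  have bij: "bij_betw L (carrier T) (carrier D)" using iso by (simp add: rmod_iso_def)
  define W where "W = inv_into (carrier T) L"
  have W_closed: "W d \<in> carrier T" if "d \<in> carrier D" for d
    using bij that unfolding W_def bij_betw_def by (metis inv_into_into)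
  have LW: "L (W d) = d" if "d \<in> carrier D" for d
    using bij that unfolding W_def by (rule bij_betw_inv_into_right)
  have L_inj: "s = w" if "s \<in> carrier T" "w \<in> carrier T" "L s = L w" for s w
    using bij that by (auto simp: bij_betw_def inj_on_def)
  have ract_closed: "ract T w d \<in> carrier T" if "w \<in> carrier T" "d \<in> carrier D" for w d
    using add_homD(1)[OF ract_hom[OF that(2)] that(1)] .
  \<comment> \<open>The coordinate, along \<xi> extended to M, of the preimage of f(e) under
    L.\<close>
  define t where "t \<xi> e = coeff (\<lambda>x. \<xi> (lact M e x)) (W (f e))" for \<xi> e
  have "rep_coeffs A M D f \<nu> t" unfolding rep_coeffs_def
  proof (intro ballI allI impI conjI)
    fix e assume e: "e \<in> carrier A" "e \<otimes>\<^bsub>A\<^esub> e = e"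
    have fe: "f e \<in> carrier D" "f e \<otimes> f e = f e"
      using f_closed f_mult[of e e] e by simp_all
    { fix \<xi> assume \<xi>: "\<xi> \<in> functionals A (slice M e)"
      note \<xi>e = M.extend_functional[OF e \<xi>]
      show "t \<xi> e \<in> carrier D" unfolding t_def by (intro coeff_closed \<xi>e W_closed fe)
      \<comment> \<open>L is injective and sends both sides to the idempotent f(e).\<close>
      have "ract T (W (f e)) (f e) = W (f e)"
        using fe by (intro L_inj) (simp_all add: W_closed ract_closed L_ract LW)
      then show "t \<xi> e \<otimes> f e = t \<xi> e"
        unfolding t_def by (simp flip: coeff_ract[OF \<xi>e W_closed[OF fe(1)] fe(1)])
      fix x assume "x \<in> carrier (slice M e)"
      then have x: "x \<in> carrier M" "lact M e x = x" using M.slice_carrier[OF e] by auto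
      obtain a where a: "a \<in> carrier A" "ract M x a = x" by (rule M.right_unit[OF x(1)])
      \<comment> \<open>Since f(e)\<nu>(x) = \<nu>(ex) = \<nu>(x), the preimage of f(e) times
        \<nu>(x) must be x \<otimes> 1.\<close>
      have "L (emb x) = \<nu> x"
        using x a \<nu>_ract[OF x(1) a(1)] by (simp add: emb_eq[OF x(1) a] L_tens f_closed)
      moreover have "f e \<otimes> \<nu> x = \<nu> x" using \<nu>_lact[OF x(1) e(1)] x(2) by simp
      ultimately have "ract T (W (f e)) (\<nu> x) = emb x"
        using x a fe by (intro L_inj) (simp_all add: W_closed ract_closed L_ract LW \<nu>_closed emb_closed[OF x(1) a])
      then show "t \<xi> e \<otimes> \<nu> x = f (\<xi> x)"
        using coeff_emb[OF x(1) a \<xi>e] x(2)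
        unfolding t_def by (simp flip: coeff_ract[OF \<xi>e W_closed[OF fe(1)] \<nu>_closed[OF x(1)]])
    }
    fix bs assume bs: "dual_basis A (slice M e) bs"
    show "lsum D (map (\<lambda>b. \<nu> (fst b) \<otimes> t (snd b) e) bs) = f e"
      unfolding t_def using local_expand[OF e bs W_closed[OF fe(1)]] LW[OF fe(1)] fe(2) by simp
  qed
  then show ?thesis by blast
qed

text \<open>Insert f(e) = \<Sum> \<nu>(b)t'(\<beta>, e) into t(\<xi>, e) = t(\<xi>, e)f(e) and use
  t(\<xi>, e)\<nu>(b) = f(\<xi>(b)). Again two families give uniqueness, and t' = t gives left
  units.\<close>

lemma rep_coeffs_expand:
  assumes t: "rep_coeffs A M D f \<nu> t" and t': "rep_coeffs A M D f \<nu> t'"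
    and e: "e \<in> carrier A" "e \<otimes>\<^bsub>A\<^esub> e = e" and \<xi>: "\<xi> \<in> functionals A (slice M e)"
    and bs: "dual_basis A (slice M e) bs"
  shows "t \<xi> e = lsum D (map (\<lambda>b. f (\<xi> (fst b)) \<otimes> t' (snd b) e) bs)"
proof -
  note tD = rep_coeffsD[OF t e] and t'D = rep_coeffsD[OF t' e] and b = basisD[OF e bs]
  have "t \<xi> e = t \<xi> e \<otimes> lsum D (map (\<lambda>b. \<nu> (fst b) \<otimes> t' (snd b) e) bs)"
    using tD(2)[OF \<xi>] t'D(4)[OF bs] by simp
  also have "\<dots> = lsum D (map (\<lambda>b. t \<xi> e \<otimes> (\<nu> (fst b) \<otimes> t' (snd b) e)) bs)"
    using b \<xi> by (intro D.lsum_mult_left) (simp_all add: tD(1) t'D(1) \<nu>_closed D.m_closed)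
  also have "\<dots> = lsum D (map (\<lambda>b. f (\<xi> (fst b)) \<otimes> t' (snd b) e) bs)"
    using b \<xi>
    by (intro lsum_cong) (simp add: tD(1,3) t'D(1) \<nu>_closed flip: D.m_assoc)
  finally show ?thesis .
qed

lemma rep_coeffs_unique:
  assumes t: "rep_coeffs A M D f \<nu> t" and t': "rep_coeffs A M D f \<nu> t'"
    and e: "e \<in> carrier A" "e \<otimes>\<^bsub>A\<^esub> e = e" and \<xi>: "\<xi> \<in> functionals A (slice M e)"
  shows "t \<xi> e = t' \<xi> e"
proof -
  obtain bs where "dual_basis A (slice M e) bs" by (rule M.slice_dual_basis[OF e])
  then show ?thesis
    using rep_coeffs_expand[OF t t' e \<xi>] rep_coeffs_expand[OF t' t' e \<xi>] by simp
qed

text \<open>The inverse of L is handled locally. For each idempotent e, V(d) = \<Sum> b \<otimes>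
  t(\<beta>, e)d satisfies L(V(d)) = f(e)d, so nondegeneracy makes L surjective; and V(L(w)) = w
  once e dominates left units of the module elements in w, which makes L injective.\<close>

lemma L_isoI:
  assumes t: "rep_coeffs A M D f \<nu> t" and nd: "f \<in> nd_hom A D"
  shows "L \<in> rmod_iso D T (regular D)"
proof -
  define V where "V e bs d = lsum T (map (\<lambda>b. tn (fst b) (t (snd b) e \<otimes> d)) bs)" for e bs d
  have cD: "t (snd b) e \<otimes> d \<in> carrier D"
    if "e \<in> carrier A" "e \<otimes>\<^bsub>A\<^esub> e = e" "dual_basis A (slice M e) bs" "b \<in> set bs" "d \<in> carrier D" for e bs b d
    using basisD(3)[OF that(1-4)] that by (simp add: rep_coeffsD(1)[OF t] D.m_closed)
  have cT: "tn (fst b) (t (snd b) e \<otimes> d) \<in> carrier T"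
    if "e \<in> carrier A" "e \<otimes>\<^bsub>A\<^esub> e = e" "dual_basis A (slice M e) bs" "b \<in> set bs" "d \<in> carrier D" for e bs b d
    using basisD(1)[OF that(1-4)] cD[OF that] by (rule tens_via_closed)
  have V_add: "V e bs (d \<oplus> d') = V e bs d \<oplus>\<^bsub>T\<^esub> V e bs d'"
    if e: "e \<in> carrier A" "e \<otimes>\<^bsub>A\<^esub> e = e" and bs: "dual_basis A (slice M e) bs"
      and d: "d \<in> carrier D" "d' \<in> carrier D" for e bs d d'
  proof -
    have "V e bs (d \<oplus> d') = lsum T (map (\<lambda>b. tn (fst b) (t (snd b) e \<otimes> d) \<oplus>\<^bsub>T\<^esub>
        tn (fst b) (t (snd b) e \<otimes> d')) bs)"
      unfolding V_def using basisD[OF e bs] cD[OF e bs] d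
      by (intro lsum_cong) (simp add: D.r_distr rep_coeffsD(1)[OF t e] tens_via_add_right)
    also have "\<dots> = V e bs d \<oplus>\<^bsub>T\<^esub> V e bs d'"
      unfolding V_def using cT[OF e bs] d by (intro T.lsum_add) simp_all
    finally show ?thesis .
  qed
  have V_closed: "V e bs d \<in> carrier T"
    if e: "e \<in> carrier A" "e \<otimes>\<^bsub>A\<^esub> e = e" and bs: "dual_basis A (slice M e) bs" and d: "d \<in> carrier D" for e bs d
    unfolding V_def using cT[OF e bs] d by (intro T.lsum_closed) auto
  have LV: "L (V e bs d) = f e \<otimes> d"
    if e: "e \<in> carrier A" "e \<otimes>\<^bsub>A\<^esub> e = e" and bs: "dual_basis A (slice M e) bs" and d: "d \<in> carrier D" for e bs d
  proof -
    note b = basisD[OF e bs]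
    have "L (V e bs d) = lsum D (map (\<lambda>b. \<nu> (fst b) \<otimes> (t (snd b) e \<otimes> d)) bs)"
      unfolding V_def using b cD[OF e bs] d by (intro L_lsum)
    also have "\<dots> = lsum D (map (\<lambda>b. (\<nu> (fst b) \<otimes> t (snd b) e) \<otimes> d) bs)"
      using b d by (intro lsum_cong) (simp add: D.m_assoc \<nu>_closed rep_coeffsD(1)[OF t e])
    also have "\<dots> = lsum D (map (\<lambda>b. \<nu> (fst b) \<otimes> t (snd b) e) bs) \<otimes> d"
      using b d by (intro D.lsum_mult_right[symmetric]) (simp_all add: D.m_closed \<nu>_closed rep_coeffsD(1)[OF t e])
    finally show ?thesis by (simp add: rep_coeffsD(4)[OF t e bs])
  qed
  \<comment> \<open>The condition is imposed for every idempotent above e, so that it survives when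
    sums, or the two tensors in the injectivity proof, pass to a common larger unit.\<close>
  define inverts_at where "inverts_at w e \<longleftrightarrow> (\<forall>c\<in>carrier A. c \<otimes>\<^bsub>A\<^esub> c = c \<longrightarrow> c \<otimes>\<^bsub>A\<^esub> e = e \<longrightarrow>
      (\<forall>bs. dual_basis A (slice M c) bs \<longrightarrow> V c bs (L w) = w))" for w e
  have VL: "\<exists>e\<in>carrier A. inverts_at w e" if "w \<in> carrier T" for w
    using that
  proof (induction rule: tensor_induct)
    case (tens x d)
    then have d: "d \<in> carrier D" by simp
    obtain e where e: "e \<in> carrier A" "lact M e x = x" by (rule M.left_unit[OF tens(1)])
    have "V c bs (L (tn x d)) = tn x d"
      if c: "c \<in> carrier A" "c \<otimes>\<^bsub>A\<^esub> c = c" "c \<otimes>\<^bsub>A\<^esub> e = e" and bs: "dual_basis A (slice M c) bs" for c bs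
    proof -
      note b = basisD[OF c(1,2) bs]
      have x: "x \<in> carrier (slice M c)"
        using M.M.lact_assoc[OF c(1) e(1) tens(1)] c e tens(1) by (simp add: M.slice_carrier)
      \<comment> \<open>For x in cM, t(\<beta>, c)\<nu>(x) = f(\<beta>(x)), and balancing moves
        \<beta>(x) to the left factor.\<close>
      have "V c bs (L (tn x d)) = lsum T (map (\<lambda>b. tn (ract M (fst b) (snd b x)) d) bs)"
        unfolding V_def
      proof (rule lsum_cong)
        fix y assume y: "y \<in> set bs"
        have "t (snd y) c \<otimes> (\<nu> x \<otimes> d) = f (snd y x) \<otimes> d"
          using b(1-4)[OF y] x d tens(1)
          by (simp add: rep_coeffsD(1)[OF t c(1,2)] \<nu>_closed rep_coeffsD(3)[OF t c(1,2)] flip: D.m_assoc)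
        then show "tn (fst y) (t (snd y) c \<otimes> L (tn x d)) = tn (ract M (fst y) (snd y x)) d"
          using b(1,4)[OF y] x d tens(1) by (simp add: L_tens tens_via_balanced)
      qed
      also have "\<dots> = tn (lsum M (map (\<lambda>b. ract M (fst b) (snd b x)) bs)) d"
        using b x tens(2)
        by (intro add_hom_lsum[OF tens_hom_left M.M.M.abelian_group_axioms abelian_group_tensor, symmetric])
          (simp_all add: M.M.ract_closed)
      finally show ?thesis using b(5)[OF x] by simp
    qed
    then show ?case using e(1) unfolding inverts_at_def by blast
  next
    case (add s w)
    obtain e1 e2 where e1: "e1 \<in> carrier A" "inverts_at s e1" and e2: "e2 \<in> carrier A" "inverts_at w e2"
      using add.IH by (elim bexE)
    obtain e where e: "e \<in> carrier A" "e \<otimes>\<^bsub>A\<^esub> e1 = e1" "e \<otimes>\<^bsub>A\<^esub> e2 = e2" by (rule A.common_unit2[OF e1(1) e2(1)])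
    have "V c bs (L (s \<oplus>\<^bsub>T\<^esub> w)) = s \<oplus>\<^bsub>T\<^esub> w"
      if c: "c \<in> carrier A" "c \<otimes>\<^bsub>A\<^esub> c = c" "c \<otimes>\<^bsub>A\<^esub> e = e" and bs: "dual_basis A (slice M c) bs" for c bs
    proof -
      have ce: "c \<otimes>\<^bsub>A\<^esub> e1 = e1" "c \<otimes>\<^bsub>A\<^esub> e2 = e2"
        using A.left_unit_widen[OF c(1) e(1) e1(1) c(3) e(2)] A.left_unit_widen[OF c(1) e(1) e2(1) c(3) e(3)]
        by simp_all
      show ?thesis
        using e1(2)[unfolded inverts_at_def, rule_format, OF c(1,2) ce(1) bs] e2(2)[unfolded inverts_at_def, rule_format, OF c(1,2) ce(2) bs]
          add.hyps V_add[OF c(1,2) bs L_closed L_closed] by (simp add: add_homD(2)[OF L_hom])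
    qed
    then show ?case using e(1) unfolding inverts_at_def by blast
  qed
  have "inj_on L (carrier T)"
  proof (rule inj_onI)
    fix s w assume s: "s \<in> carrier T" and w: "w \<in> carrier T" and eq: "L s = L w"
    obtain e1 e2 where e1: "e1 \<in> carrier A" "inverts_at s e1" and e2: "e2 \<in> carrier A" "inverts_at w e2"
      using VL[OF s] VL[OF w] by (elim bexE)
    obtain e where e: "e \<in> carrier A" "e \<otimes>\<^bsub>A\<^esub> e = e" "e \<otimes>\<^bsub>A\<^esub> e1 = e1" "e \<otimes>\<^bsub>A\<^esub> e2 = e2"
      by (rule A.common_unit2[OF e1(1) e2(1)])
    obtain bs where bs: "dual_basis A (slice M e) bs" by (rule M.slice_dual_basis[OF e(1,2)])
    have "s = V e bs (L s)" by (rule e1(2)[unfolded inverts_at_def, rule_format, OF e(1,2,3) bs, symmetric])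
    also have "\<dots> = w" unfolding eq by (rule e2(2)[unfolded inverts_at_def, rule_format, OF e(1,2,4) bs])
    finally show "s = w" .
  qed
  moreover have "L ` carrier T = carrier D"
  proof
    show "L ` carrier T \<subseteq> carrier D" using L_closed by blast
    show "carrier D \<subseteq> L ` carrier T"
    proof
      fix d assume d: "d \<in> carrier D"
      obtain e where e: "e \<in> carrier A" "e \<otimes>\<^bsub>A\<^esub> e = e" "f e \<otimes> d = d"
        by (rule nd_hom_unit[OF A.lu_ring_axioms D.rng_axioms nd d])
      obtain bs where bs: "dual_basis A (slice M e) bs" by (rule M.slice_dual_basis[OF e(1,2)])
      show "d \<in> L ` carrier T"
        using LV[OF e(1,2) bs d] V_closed[OF e(1,2) bs d] e(3) by (metis image_eqI)
    qed
  qed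
  ultimately show ?thesis using L_rmod_hom by (simp add: rmod_iso_def bij_betw_def)
qed

end

lemma rep_coeffs_image:
  assumes t: "rep_coeffs A M C f \<nu> t" and M: "proper_bimodule A M" and C: "rng C" and D: "rng D"
    and f: "f \<in> rng_hom A C" and \<nu>: "\<nu> \<in> carrier M \<rightarrow> carrier C" and g: "g \<in> rng_hom C D"
  shows "rep_coeffs A M D (compose (carrier A) g f) (compose (carrier M) g \<nu>) (\<lambda>\<xi> e. g (t \<xi> e))"
proof -
  interpret C: rng C by (rule C)
  interpret D: rng D by (rule D)
  interpret M: proper_bimodule A M by (rule M)
  note gD = rng_homD[OF g] and fD = rng_homD[OF f]
  show ?thesis unfolding rep_coeffs_def
  proof (intro ballI allI impI conjI)
    fix e assume e: "e \<in> carrier A" "e \<otimes>\<^bsub>A\<^esub> e = e"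
    note tD = rep_coeffsD[OF t e]
    { fix \<xi> assume \<xi>: "\<xi> \<in> functionals A (slice M e)"
      show "g (t \<xi> e) \<in> carrier D" by (intro gD(1) tD(1) \<xi>)
      show "g (t \<xi> e) \<otimes>\<^bsub>D\<^esub> compose (carrier A) g f e = g (t \<xi> e)"
        using gD(3)[OF tD(1)[OF \<xi>] fD(1)[OF e(1)]] tD(2)[OF \<xi>] e(1) by (simp add: compose_def)
      fix x assume x: "x \<in> carrier (slice M e)"
      then have xM: "x \<in> carrier M" using M.slice_carrier[OF e] by blast
      show "g (t \<xi> e) \<otimes>\<^bsub>D\<^esub> compose (carrier M) g \<nu> x = compose (carrier A) g f (\<xi> x)"
        using gD(3)[OF tD(1)[OF \<xi>], of "\<nu> x"] tD(3)[OF \<xi> x] \<nu> xM functionalD(1)[OF \<xi> x]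
        by (simp add: compose_def Pi_iff)
    }
    fix bs assume bs: "dual_basis A (slice M e) bs"
    have b: "fst b \<in> carrier M" "\<nu> (fst b) \<in> carrier C" "t (snd b) e \<in> carrier C" if "b \<in> set bs" for b
      using dual_basisD(1,2)[OF bs that] tD(1) M.slice_carrier[OF e] \<nu> by auto
    have "lsum D (map (\<lambda>b. compose (carrier M) g \<nu> (fst b) \<otimes>\<^bsub>D\<^esub> g (t (snd b) e)) bs) =
        lsum D (map (\<lambda>b. g (\<nu> (fst b) \<otimes>\<^bsub>C\<^esub> t (snd b) e)) bs)"
      using b by (intro lsum_cong) (simp add: compose_def gD)
    also have "\<dots> = g (lsum C (map (\<lambda>b. \<nu> (fst b) \<otimes>\<^bsub>C\<^esub> t (snd b) e) bs))"
      using b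
      by (intro add_hom_lsum[OF gD(5) C.abelian_group_axioms D.abelian_group_axioms, symmetric])
        (simp add: C.m_closed)
    also have "\<dots> = compose (carrier A) g f e" using tD(4)[OF bs] e(1) by (simp add: compose_def)
    finally show "lsum D (map (\<lambda>b. compose (carrier M) g \<nu> (fst b) \<otimes>\<^bsub>D\<^esub> g (t (snd b) e)) bs) =
        compose (carrier A) g f e" .
  qed
qed

section \<open>Covariance rings\<close>

definition cov_gens ::
  "'p monoid \<Rightarrow> 'm ring \<Rightarrow> ('p \<Rightarrow> ('m, 'm, 'm) bimod) \<Rightarrow> ('p \<times> 'm + 'p \<times> ('m \<Rightarrow> 'm) \<times> 'm) set" where
  "cov_gens P A F = {Inl (p, x) | p x. p \<in> carrier P \<and> x \<in> carrier (F p)} \<union>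
     {Inr (p, \<xi>, e) | p \<xi> e. p \<in> carrier P \<and> e \<in> carrier A \<and> e \<otimes>\<^bsub>A\<^esub> e = e \<and>
        \<xi> \<in> functionals A (slice (F p) e)}"

text \<open>The first two families express \<open>graded_rep\<close>, the other three
  \<open>rep_coeffs\<close>. Multiplicativity in degree 1 and bilinearity over it are contained in
  the second family, since the maps \<mu> with an index 1 are the multiplication maps.\<close>

definition cov_rels ::
  "'p monoid \<Rightarrow> 'm ring \<Rightarrow> ('p \<Rightarrow> ('m, 'm, 'm) bimod)
    \<Rightarrow> ('p \<Rightarrow> 'p \<Rightarrow> ('m \<times> 'm \<Rightarrow>\<^sub>0 int) set \<Rightarrow> 'm)
    \<Rightarrow> (('p \<times> 'm + 'p \<times> ('m \<Rightarrow> 'm) \<times> 'm) list list \<times> ('p \<times> 'm + 'p \<times> ('m \<Rightarrow> 'm) \<times> 'm) list list) set" where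
  "cov_rels P A F \<mu> =
     {([[Inl (p, x \<oplus>\<^bsub>F p\<^esub> y)]], [[Inl (p, x)], [Inl (p, y)]]) | p x y.
        p \<in> carrier P \<and> x \<in> carrier (F p) \<and> y \<in> carrier (F p)} \<union>
     {([[Inl (p, x), Inl (q, y)]], [[Inl (p \<otimes>\<^bsub>P\<^esub> q, \<mu> p q (tens (F p) A (F q) x y))]]) | p q x y.
        p \<in> carrier P \<and> q \<in> carrier P \<and> x \<in> carrier (F p) \<and> y \<in> carrier (F q)} \<union>
     {([[Inr (p, \<xi>, e), Inl (\<one>\<^bsub>P\<^esub>, e)]], [[Inr (p, \<xi>, e)]]) | p \<xi> e.
        p \<in> carrier P \<and> e \<in> carrier A \<and> e \<otimes>\<^bsub>A\<^esub> e = e \<and> \<xi> \<in> functionals A (slice (F p) e)} \<union>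
     {([[Inr (p, \<xi>, e), Inl (p, x)]], [[Inl (\<one>\<^bsub>P\<^esub>, \<xi> x)]]) | p \<xi> e x.
        p \<in> carrier P \<and> e \<in> carrier A \<and> e \<otimes>\<^bsub>A\<^esub> e = e \<and> \<xi> \<in> functionals A (slice (F p) e) \<and>
        x \<in> carrier (slice (F p) e)} \<union>
     {(map (\<lambda>b. [Inl (p, fst b), Inr (p, snd b, e)]) bs, [[Inl (\<one>\<^bsub>P\<^esub>, e)]]) | p e bs.
        p \<in> carrier P \<and> e \<in> carrier A \<and> e \<otimes>\<^bsub>A\<^esub> e = e \<and> dual_basis A (slice (F p) e) bs}"

text \<open>\<open>covariant_reps\<close> without the invertibility condition: the purely equational
  part, which every homomorphism preserves.\<close>

definition graded_rep ::
  "'p monoid \<Rightarrow> 'm ring \<Rightarrow> ('p \<Rightarrow> ('m, 'm, 'm) bimod)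
    \<Rightarrow> ('p \<Rightarrow> 'p \<Rightarrow> ('m \<times> 'm \<Rightarrow>\<^sub>0 int) set \<Rightarrow> 'm) \<Rightarrow> 'd ring \<Rightarrow> ('p \<Rightarrow> 'm \<Rightarrow> 'd) \<Rightarrow> bool" where
  "graded_rep P A F \<mu> D \<nu> \<longleftrightarrow> \<nu> \<in> (\<Pi>\<^sub>E p\<in>carrier P. carrier (F p) \<rightarrow>\<^sub>E carrier D) \<and>
     (\<forall>p\<in>carrier P. \<forall>x\<in>carrier (F p). \<forall>y\<in>carrier (F p).
        \<nu> p (x \<oplus>\<^bsub>F p\<^esub> y) = \<nu> p x \<oplus>\<^bsub>D\<^esub> \<nu> p y) \<and>
     (\<forall>p\<in>carrier P. \<forall>q\<in>carrier P. \<forall>x\<in>carrier (F p). \<forall>y\<in>carrier (F q).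
        \<nu> p x \<otimes>\<^bsub>D\<^esub> \<nu> q y = \<nu> (p \<otimes>\<^bsub>P\<^esub> q) (\<mu> p q (tens (F p) A (F q) x y)))"

lemma graded_repD:
  assumes "graded_rep P A F \<mu> D \<nu>" "p \<in> carrier P"
  shows "x \<in> carrier (F p) \<Longrightarrow> \<nu> p x \<in> carrier D"
    and "\<lbrakk>x \<in> carrier (F p); y \<in> carrier (F p)\<rbrakk> \<Longrightarrow> \<nu> p (x \<oplus>\<^bsub>F p\<^esub> y) = \<nu> p x \<oplus>\<^bsub>D\<^esub> \<nu> p y"
    and "\<lbrakk>q \<in> carrier P; x \<in> carrier (F p); y \<in> carrier (F q)\<rbrakk>
      \<Longrightarrow> \<nu> p x \<otimes>\<^bsub>D\<^esub> \<nu> q y = \<nu> (p \<otimes>\<^bsub>P\<^esub> q) (\<mu> p q (tens (F p) A (F q) x y))"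
    and "\<nu> p \<in> extensional (carrier (F p))"
  using assms unfolding graded_rep_def by (auto simp: PiE_iff)

lemma graded_rep_extensional: "graded_rep P A F \<mu> D \<nu> \<Longrightarrow> \<nu> \<in> extensional (carrier P)"
  unfolding graded_rep_def by (auto simp: PiE_def)

lemma covariant_reps_iff:
  "\<nu> \<in> covariant_reps P A F \<mu> D \<longleftrightarrow> graded_rep P A F \<mu> D \<nu> \<and>
     (\<forall>p\<in>carrier P. tensor_lift D (\<lambda>x d. \<nu> p x \<otimes>\<^bsub>D\<^esub> d)
        \<in> rmod_iso D (tensor (F p) A (via (\<nu> \<one>\<^bsub>P\<^esub>) D)) (regular D))"
  by (auto simp: covariant_reps_def graded_rep_def)

text \<open>The action on morphisms of the functor that a covariance ring represents, restricted so
  that equal representations are equal as HOL functions.\<close>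

definition push :: "'p monoid \<Rightarrow> ('p \<Rightarrow> ('m, 'm, 'm) bimod) \<Rightarrow> ('c \<Rightarrow> 'd) \<Rightarrow> ('p \<Rightarrow> 'm \<Rightarrow> 'c) \<Rightarrow> 'p \<Rightarrow> 'm \<Rightarrow> 'd" where
  "push P F h \<omega> = (\<lambda>p\<in>carrier P. compose (carrier (F p)) h (\<omega> p))"

section \<open>Covariant representations and their functoriality\<close>

context diagram
begin

lemma bimodule_F: "p \<in> carrier P \<Longrightarrow> bimodule A A (F p)"
  using F_proper[of p] by (simp add: proper_def smooth_bimodule_def)

lemma proper_bimodule_F: "p \<in> carrier P \<Longrightarrow> proper_bimodule A (F p)"
  by (intro proper_bimodule.intro proper_bimodule_axioms.intro A.lu_ring_axioms bimodule_F F_proper)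

lemma carrier_F_one [simp]: "carrier (F \<one>) = carrier A"
  and add_F_one [simp]: "add (F \<one>) = add A"
  by (simp_all add: F_one)

lemma tensor_pair_F: "p \<in> carrier P \<Longrightarrow> q \<in> carrier P \<Longrightarrow> tensor_pair A A (F p) (F q)"
  by (intro tensor_pair.intro bimodule_F bimodule.axioms(1)[OF bimodule_F])

lemma tens_F_closed:
  assumes "p \<in> carrier P" "q \<in> carrier P" "x \<in> carrier (F p)" "y \<in> carrier (F q)"
  shows "tens (F p) A (F q) x y \<in> carrier (bitensor (F p) A (F q))"
  using tensor_pair.tens_closed[OF tensor_pair_F[OF assms(1,2)] assms(3,4)] by (simp add: carrier_bitensor)

lemma \<mu>_closed:
  assumes "p \<in> carrier P" "q \<in> carrier P" "x \<in> carrier (F p)" "y \<in> carrier (F q)"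
  shows "\<mu> p q (tens (F p) A (F q) x y) \<in> carrier (F (p \<otimes> q))"
  using \<mu>_iso[OF assms(1,2)] tens_F_closed[OF assms]
  by (auto simp: bimod_iso_def rmod_iso_def rmod_hom_def)

lemma \<mu>_lact:
  assumes q: "q \<in> carrier P" and a: "a \<in> carrier A" and x: "x \<in> carrier (F q)"
  shows "\<mu> \<one> q (tens (F \<one>) A (F q) a x) = lact (F q) a x"
proof -
  interpret T: tensor_pair A A "F \<one>" "F q" by (rule tensor_pair_F[OF one_closed q])
  have "balanced A (F \<one>) (F q) (F q) (lact (F q))"
    by (auto simp: balanced_def F_one T.N.lact_closed T.N.lact_add_left T.N.lact_add_right T.N.lact_assoc)
  then have "tensor_lift (F q) (lact (F q)) (tens (F \<one>) A (F q) a x) = lact (F q) a x"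
    using a x by (intro T.lift_tens[OF T.N.M.abelian_group_axioms]) simp_all
  then show ?thesis
    using \<mu>_one_left[OF q tens_F_closed[OF one_closed q]] a x by simp
qed

lemma \<mu>_ract:
  assumes q: "q \<in> carrier P" and a: "a \<in> carrier A" and x: "x \<in> carrier (F q)"
  shows "\<mu> q \<one> (tens (F q) A (F \<one>) x a) = ract (F q) x a"
proof -
  interpret T: tensor_pair A A "F q" "F \<one>" by (rule tensor_pair_F[OF q one_closed])
  have "balanced A (F q) (F \<one>) (F q) (ract (F q))"
    by (auto simp: balanced_def F_one T.M.ract_closed T.M.ract_add_left T.M.ract_add_right T.M.ract_assoc)
  then have "tensor_lift (F q) (ract (F q)) (tens (F q) A (F \<one>) x a) = ract (F q) x a"
    using a x by (intro T.lift_tens[OF T.M.M.abelian_group_axioms]) simp_all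
  then show ?thesis
    using \<mu>_one_right[OF q tens_F_closed[OF q one_closed]] a x by simp
qed

text \<open>The covariance equation with first index 1, where \<mu> is the left action by
  \<open>\<mu>_lact\<close>. With \<open>graded_rep_ract\<close>, it makes each
  \<open>\<nu> p\<close> compatible with both actions through \<open>\<nu> \<one>\<close>, as
  \<open>bimodule_rep\<close> asks.\<close>

lemma graded_rep_lact:
  assumes "graded_rep P A F \<mu> D \<nu>" "p \<in> carrier P" "a \<in> carrier A" "x \<in> carrier (F p)"
  shows "\<nu> p (lact (F p) a x) = \<nu> \<one> a \<otimes>\<^bsub>D\<^esub> \<nu> p x"
  using graded_repD(3)[OF assms(1) one_closed assms(2), of a x] assms by (simp add: \<mu>_lact)

lemma graded_rep_ract:
  assumes "graded_rep P A F \<mu> D \<nu>" "p \<in> carrier P" "a \<in> carrier A" "x \<in> carrier (F p)"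
  shows "\<nu> p (ract (F p) x a) = \<nu> p x \<otimes>\<^bsub>D\<^esub> \<nu> \<one> a"
  using graded_repD(3)[OF assms(1,2) one_closed, of x a] assms by (simp add: \<mu>_ract)

lemma graded_rep_hom:
  assumes "graded_rep P A F \<mu> D \<nu>"
  shows "\<nu> \<one> \<in> rng_hom A D"
proof (rule rng_homI)
  note \<nu>D = graded_repD[OF assms one_closed]
  show "\<nu> \<one> \<in> extensional (carrier A)" using \<nu>D(4) by simp
  show "\<nu> \<one> x \<in> carrier D" if "x \<in> carrier A" for x using \<nu>D(1) that by simp
  show "\<nu> \<one> (x \<oplus>\<^bsub>A\<^esub> y) = \<nu> \<one> x \<oplus>\<^bsub>D\<^esub> \<nu> \<one> y" if "x \<in> carrier A" "y \<in> carrier A" for x y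
    using \<nu>D(2)[of x y] that by simp
  show "\<nu> \<one> (x \<otimes>\<^bsub>A\<^esub> y) = \<nu> \<one> x \<otimes>\<^bsub>D\<^esub> \<nu> \<one> y" if "x \<in> carrier A" "y \<in> carrier A" for x y
    using graded_rep_lact[OF assms one_closed, of x y] that by (simp add: F_one)
qed

lemma bimodule_rep:
  assumes D: "rng D" and \<nu>: "graded_rep P A F \<mu> D \<nu>" and p: "p \<in> carrier P"
  shows "bimodule_rep A (F p) D (\<nu> \<one>) (\<nu> p)"
proof -
  interpret proper_bimodule A "F p" by (rule proper_bimodule_F[OF p])
  show ?thesis
    using graded_repD[OF \<nu> p]
    by (intro bimodule_rep.intro bimodule_rep_axioms.intro base_change.intro base_change_axioms.intro
        A.lu_ring_axioms proper_bimodule_axioms M.right_module_axioms D graded_rep_hom[OF \<nu>]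
        graded_rep_lact[OF \<nu> p] graded_rep_ract[OF \<nu> p])
qed

text \<open>This comes from surjectivity in degree 1: every element of D is the image of a tensor in
  A \<otimes> D, where x \<otimes> d goes to \<nu>(x)d and is fixed by \<nu>(e) with ex = x; sums
  take a common unit.\<close>

lemma covariant_rep_nd_hom:
  assumes D: "rng D" and \<nu>: "\<nu> \<in> covariant_reps P A F \<mu> D"
  shows "\<nu> \<one> \<in> nd_hom A D"
proof -
  have gr: "graded_rep P A F \<mu> D \<nu>" using \<nu> by (simp add: covariant_reps_iff)
  interpret N: bimodule_rep A "F \<one>" D "\<nu> \<one>" "\<nu> \<one>" by (rule bimodule_rep[OF D gr one_closed])
  have unit: "\<exists>a\<in>carrier A. \<nu> \<one> a \<otimes>\<^bsub>D\<^esub> N.L w = N.L w" if "w \<in> carrier N.T" for w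
    using that
  proof (induction rule: N.tensor_induct)
    case (tens x d)
    then have x: "x \<in> carrier A" and d: "d \<in> carrier D" by simp_all
    obtain e where e: "e \<in> carrier A" "e \<otimes>\<^bsub>A\<^esub> x = x" by (rule A.common_unit2[OF x x])
    have "\<nu> \<one> e \<otimes>\<^bsub>D\<^esub> \<nu> \<one> x = \<nu> \<one> x" using N.f_mult[OF e(1) x] e(2) by simp
    then show ?case
      using e(1) x d N.D.m_assoc[of "\<nu> \<one> e" "\<nu> \<one> x" d]
      by (intro bexI[of _ e]) (simp_all add: N.L_tens N.f_closed)
  next
    case (add s t)
    then obtain a b where ab: "a \<in> carrier A" "b \<in> carrier A"
      "\<nu> \<one> a \<otimes>\<^bsub>D\<^esub> N.L s = N.L s" "\<nu> \<one> b \<otimes>\<^bsub>D\<^esub> N.L t = N.L t" by blast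
    obtain e where e: "e \<in> carrier A" "e \<otimes>\<^bsub>A\<^esub> a = a" "e \<otimes>\<^bsub>A\<^esub> b = b" by (rule A.common_unit2[OF ab(1,2)])
    note widen = rng_hom_unit_widen(1)[OF D graded_rep_hom[OF gr] e(1)]
    have "\<nu> \<one> e \<otimes>\<^bsub>D\<^esub> N.L s = N.L s" "\<nu> \<one> e \<otimes>\<^bsub>D\<^esub> N.L t = N.L t"
      using widen[OF ab(1) N.L_closed[OF add.hyps(1)] e(2) ab(3)]
        widen[OF ab(2) N.L_closed[OF add.hyps(2)] e(3) ab(4)] .
    then show ?case using e(1) add.hyps
      by (intro bexI[of _ e]) (simp_all add: add_homD(2)[OF N.L_hom] N.D.r_distr N.L_closed N.f_closed)
  qed
  have img: "N.L ` carrier N.T = carrier D"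
    using \<nu> one_closed by (auto simp: covariant_reps_iff rmod_iso_def bij_betw_def)
  show ?thesis
  proof (rule nd_homI[OF D graded_rep_hom[OF gr]])
    fix b assume "b \<in> carrier D"
    then have "b \<in> N.L ` carrier N.T" by (simp add: img)
    then obtain w where w: "b = N.L w" "w \<in> carrier N.T" by (rule imageE)
    show "\<exists>a\<in>carrier A. \<nu> \<one> a \<otimes>\<^bsub>D\<^esub> b = b" unfolding w(1) by (rule unit[OF w(2)])
  qed
qed

lemma covariant_rep_coeffs:
  assumes D: "rng D" and \<nu>: "\<nu> \<in> covariant_reps P A F \<mu> D" and p: "p \<in> carrier P"
  shows "\<exists>t. rep_coeffs A (F p) D (\<nu> \<one>) (\<nu> p) t"
proof -
  have gr: "graded_rep P A F \<mu> D \<nu>" using \<nu> by (simp add: covariant_reps_iff)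
  show ?thesis
    using \<nu> p by (intro bimodule_rep.rep_coeffs_exist[OF bimodule_rep[OF D gr p]]) (simp add: covariant_reps_iff)
qed

lemma covariant_repI:
  assumes D: "rng D" and gr: "graded_rep P A F \<mu> D \<nu>" and nd: "\<nu> \<one> \<in> nd_hom A D"
    and t: "\<And>p. p \<in> carrier P \<Longrightarrow> rep_coeffs A (F p) D (\<nu> \<one>) (\<nu> p) (t p)"
  shows "\<nu> \<in> covariant_reps P A F \<mu> D"
  unfolding covariant_reps_iff
  using gr by (auto intro!: bimodule_rep.L_isoI[OF bimodule_rep[OF D gr] t nd])

lemma push_graded_rep:
  assumes \<omega>: "graded_rep P A F \<mu> C \<omega>" and h: "h \<in> rng_hom C D"
  shows "graded_rep P A F \<mu> D (push P F h \<omega>)"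
proof -
  note hD = rng_homD[OF h] and \<omega>D = graded_repD[OF \<omega>]
  show ?thesis unfolding graded_rep_def
  proof (intro conjI ballI)
    show "push P F h \<omega> \<in> (\<Pi>\<^sub>E p\<in>carrier P. carrier (F p) \<rightarrow>\<^sub>E carrier D)"
      by (auto simp: push_def compose_def \<omega>D hD)
    fix p x assume p: "p \<in> carrier P" and x: "x \<in> carrier (F p)"
    interpret F: bimodule A A "F p" by (rule bimodule_F[OF p])
    show "push P F h \<omega> p (x \<oplus>\<^bsub>F p\<^esub> y) = push P F h \<omega> p x \<oplus>\<^bsub>D\<^esub> push P F h \<omega> p y" if "y \<in> carrier (F p)" for y
      using p x that by (simp add: push_def compose_def \<omega>D hD)
    fix q y assume q: "q \<in> carrier P" and y: "y \<in> carrier (F q)"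
    show "push P F h \<omega> p x \<otimes>\<^bsub>D\<^esub> push P F h \<omega> q y =
        push P F h \<omega> (p \<otimes> q) (\<mu> p q (tens (F p) A (F q) x y))"
      using hD(3)[OF \<omega>D(1)[OF p x] \<omega>D(1)[OF q y]] \<omega>D(3)[OF p q x y] p q x y
      by (simp add: push_def compose_def \<mu>_closed)
  qed
qed

lemma push_one: "push P F h \<omega> \<one> = compose (carrier A) h (\<omega> \<one>)"
  by (simp add: push_def)

text \<open>Invertibility is traded for coefficients, these are mapped by h, and
  \<open>covariant_repI\<close> trades them back. Nondegeneracy of h enters through degree
  1.\<close>

lemma push_covariant:
  assumes C: "lu_ring C" and D: "rng D" and \<omega>: "\<omega> \<in> covariant_reps P A F \<mu> C" and h: "h \<in> nd_hom C D"
  shows "push P F h \<omega> \<in> covariant_reps P A F \<mu> D"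
proof -
  interpret C: lu_ring C by (rule C)
  have gr: "graded_rep P A F \<mu> C \<omega>" using \<omega> by (simp add: covariant_reps_iff)
  note h' = nd_hom_rng_hom[OF h]
  have "\<forall>p\<in>carrier P. \<exists>t. rep_coeffs A (F p) C (\<omega> \<one>) (\<omega> p) t"
    using covariant_rep_coeffs[OF C.rng_axioms \<omega>] by blast
  from bchoice[OF this] obtain t
    where t: "\<And>p. p \<in> carrier P \<Longrightarrow> rep_coeffs A (F p) C (\<omega> \<one>) (\<omega> p) (t p)" by blast
  show ?thesis
  proof (rule covariant_repI[OF D push_graded_rep[OF gr h']])
    show "push P F h \<omega> \<one> \<in> nd_hom A D"
      unfolding push_one
      by (rule nd_hom_compose[OF A.lu_ring_axioms C D covariant_rep_nd_hom[OF C.rng_axioms \<omega>] h])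
    fix p assume p: "p \<in> carrier P"
    have "\<omega> p \<in> carrier (F p) \<rightarrow> carrier C" using graded_repD(1)[OF gr p] by blast
    from rep_coeffs_image[OF t[OF p] proper_bimodule_F[OF p] C.rng_axioms D graded_rep_hom[OF gr] this h']
    show "rep_coeffs A (F p) D (push P F h \<omega> \<one>) (push P F h \<omega> p) (\<lambda>\<xi> e. h (t p \<xi> e))"
      using p by (simp only: push_one) (simp add: push_def)
  qed
qed

lemma push_compose:
  assumes "graded_rep P A F \<mu> C \<omega>"
  shows "push P F (compose (carrier C) g h) \<omega> = push P F g (push P F h \<omega>)"
  using graded_repD(1)[OF assms] by (auto simp: push_def compose_def fun_eq_iff)

lemma push_id:
  assumes "graded_rep P A F \<mu> C \<omega>"
  shows "push P F (\<lambda>x\<in>carrier C. x) \<omega> = \<omega>"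
proof
  fix p show "push P F (\<lambda>x\<in>carrier C. x) \<omega> p = \<omega> p"
  proof (cases "p \<in> carrier P")
    case True
    then show ?thesis
      using graded_repD(1,4)[OF assms True]
      by (auto simp: push_def compose_def fun_eq_iff extensional_def)
  next
    case False
    then show ?thesis using graded_rep_extensional[OF assms] by (simp add: push_def extensional_def)
  qed
qed

section \<open>The covariance ring by generators and relations\<close>

lemma gensI:
  "\<lbrakk>p \<in> carrier P; x \<in> carrier (F p)\<rbrakk> \<Longrightarrow> Inl (p, x) \<in> cov_gens P A F"
  "\<lbrakk>p \<in> carrier P; e \<in> carrier A; e \<otimes>\<^bsub>A\<^esub> e = e; \<xi> \<in> functionals A (slice (F p) e)\<rbrakk>
    \<Longrightarrow> Inr (p, \<xi>, e) \<in> cov_gens P A F"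
  by (auto simp: cov_gens_def)

lemma cov_rels_cases:
  assumes "(v, w) \<in> cov_rels P A F \<mu>"
  obtains
    (add) p x y where "v = [[Inl (p, x \<oplus>\<^bsub>F p\<^esub> y)]]" "w = [[Inl (p, x)], [Inl (p, y)]]"
      "p \<in> carrier P" "x \<in> carrier (F p)" "y \<in> carrier (F p)"
  | (mult) p q x y where "v = [[Inl (p, x), Inl (q, y)]]"
      "w = [[Inl (p \<otimes> q, \<mu> p q (tens (F p) A (F q) x y))]]"
      "p \<in> carrier P" "q \<in> carrier P" "x \<in> carrier (F p)" "y \<in> carrier (F q)"
  | (unit) p \<xi> e where "v = [[Inr (p, \<xi>, e), Inl (\<one>, e)]]" "w = [[Inr (p, \<xi>, e)]]"
      "p \<in> carrier P" "e \<in> carrier A" "e \<otimes>\<^bsub>A\<^esub> e = e" "\<xi> \<in> functionals A (slice (F p) e)"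
  | (eval) p \<xi> e x where "v = [[Inr (p, \<xi>, e), Inl (p, x)]]" "w = [[Inl (\<one>, \<xi> x)]]"
      "p \<in> carrier P" "e \<in> carrier A" "e \<otimes>\<^bsub>A\<^esub> e = e" "\<xi> \<in> functionals A (slice (F p) e)"
      "x \<in> carrier (slice (F p) e)"
  | (sum) p e bs where "v = map (\<lambda>b. [Inl (p, fst b), Inr (p, snd b, e)]) bs" "w = [[Inl (\<one>, e)]]"
      "p \<in> carrier P" "e \<in> carrier A" "e \<otimes>\<^bsub>A\<^esub> e = e" "dual_basis A (slice (F p) e) bs"
  using assms unfolding cov_rels_def by blast

lemma slice_F_subset:
  "\<lbrakk>p \<in> carrier P; e \<in> carrier A; e \<otimes>\<^bsub>A\<^esub> e = e; x \<in> carrier (slice (F p) e)\<rbrakk> \<Longrightarrow> x \<in> carrier (F p)"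
  using proper_bimodule.slice_carrier[OF proper_bimodule_F] by blast

lemma presentation: "presentation (cov_gens P A F) (cov_rels P A F \<mu>)"
proof
  fix v w assume "(v, w) \<in> cov_rels P A F \<mu>"
  then show "set v \<subseteq> words (cov_gens P A F) \<and> set w \<subseteq> words (cov_gens P A F)"
  proof (cases rule: cov_rels_cases)
    case (add p x y)
    interpret M: bimodule A A "F p" by (rule bimodule_F[OF add(3)])
    show ?thesis using add by (simp add: words_def gensI)
  next
    case mult then show ?thesis by (simp add: words_def gensI \<mu>_closed)
  next
    case unit then show ?thesis by (simp add: words_def gensI)
  next
    case eval then show ?thesis
      by (simp add: words_def gensI slice_F_subset functionalD(1)[OF eval(6)])
  next
    case (sum p e bs)
    have "fst b \<in> carrier (F p) \<and> snd b \<in> functionals A (slice (F p) e)" if "b \<in> set bs" for b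
      using dual_basisD(1,2)[OF sum(6) that] slice_F_subset sum by blast
    then show ?thesis using sum by (auto simp: words_def gensI)
  qed
qed

sublocale pres: presentation "cov_gens P A F" "cov_rels P A F \<mu>"
  by (rule presentation)

text \<open>With \<open>satisfiesD\<close>: the relations hold exactly for the values given by a
  graded representation together with coefficients in every degree.\<close>

lemma satisfiesI:
  assumes D: "rng D" and \<nu>: "graded_rep P A F \<mu> D \<nu>"
    and t: "\<And>p. p \<in> carrier P \<Longrightarrow> rep_coeffs A (F p) D (\<nu> \<one>) (\<nu> p) (t p)"
  defines "\<rho> \<equiv> case_sum (\<lambda>(p, x). \<nu> p x) (\<lambda>(p, \<xi>, e). t p \<xi> e)"
  shows "satisfies D \<rho> (cov_rels P A F \<mu>)"
    and "g \<in> cov_gens P A F \<Longrightarrow> \<rho> g \<in> carrier D"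
proof -
  interpret D: rng D by (rule D)
  note \<nu>D = graded_repD[OF \<nu>] and tD = rep_coeffsD[OF t]
  show "\<rho> g \<in> carrier D" if "g \<in> cov_gens P A F"
    using that by (auto simp: cov_gens_def \<rho>_def \<nu>D(1) tD(1))
  have \<nu>1: "\<nu> \<one> a \<in> carrier D" if "a \<in> carrier A" for a using \<nu>D(1)[OF one_closed] that by simp
  show "satisfies D \<rho> (cov_rels P A F \<mu>)"
    unfolding satisfies_def
  proof (safe, goal_cases)
    case (1 v w)
    then show ?case
    proof (cases rule: cov_rels_cases)
      case (add p x y)
      then show ?thesis by (simp add: \<rho>_def \<nu>D(1,2))
    next
      case (mult p q x y)
      then show ?thesis by (simp add: \<rho>_def \<nu>D(1) \<nu>D(3) \<mu>_closed)
    next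
      case unit
      then show ?thesis by (simp add: \<rho>_def tD(1,2))
    next
      case (eval p \<xi> e x)
      then show ?thesis by (simp add: \<rho>_def tD(3))
    next
      case (sum p e bs)
      then show ?thesis using tD(4)[OF sum(3-6)] \<nu>1 by (simp add: \<rho>_def o_def)
    qed
  qed
qed

lemma satisfiesD:
  assumes D: "rng D" and \<rho>: "\<And>g. g \<in> cov_gens P A F \<Longrightarrow> \<rho> g \<in> carrier D"
    and sat: "satisfies D \<rho> (cov_rels P A F \<mu>)"
  defines "\<nu> \<equiv> (\<lambda>p\<in>carrier P. \<lambda>x\<in>carrier (F p). \<rho> (Inl (p, x)))"
  shows "graded_rep P A F \<mu> D \<nu>"
    and "p \<in> carrier P \<Longrightarrow> rep_coeffs A (F p) D (\<nu> \<one>) (\<nu> p) (\<lambda>\<xi> e. \<rho> (Inr (p, \<xi>, e)))"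
proof -
  let ?E = "cov_rels P A F \<mu>"
  interpret D: rng D by (rule D)
  have sat: "lsum D (map (wprod D \<rho>) v) = lsum D (map (wprod D \<rho>) w)"
    if "(v, w) \<in> ?E" for v w
    using sat that by (auto simp: satisfies_def)
  have \<rho>F: "\<rho> (Inl (p, x)) \<in> carrier D" if "p \<in> carrier P" "x \<in> carrier (F p)" for p x
    using \<rho> that by (simp add: gensI)
  have \<rho>t: "\<rho> (Inr (p, \<xi>, e)) \<in> carrier D"
    if "p \<in> carrier P" "e \<in> carrier A" "e \<otimes>\<^bsub>A\<^esub> e = e" "\<xi> \<in> functionals A (slice (F p) e)" for p \<xi> e
    using \<rho> that by (simp add: gensI)
  show "graded_rep P A F \<mu> D \<nu>" unfolding graded_rep_def
  proof (intro conjI ballI)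
    show "\<nu> \<in> (\<Pi>\<^sub>E p\<in>carrier P. carrier (F p) \<rightarrow>\<^sub>E carrier D)" by (auto simp: \<nu>_def \<rho>F)
    fix p x assume p: "p \<in> carrier P" and x: "x \<in> carrier (F p)"
    interpret M: bimodule A A "F p" by (rule bimodule_F[OF p])
    show "\<nu> p (x \<oplus>\<^bsub>F p\<^esub> y) = \<nu> p x \<oplus>\<^bsub>D\<^esub> \<nu> p y" if y: "y \<in> carrier (F p)" for y
    proof -
      have "([[Inl (p, x \<oplus>\<^bsub>F p\<^esub> y)]], [[Inl (p, x)], [Inl (p, y)]]) \<in> ?E"
        using p x y unfolding cov_rels_def by blast
      from sat[OF this] show ?thesis using p x y by (simp add: \<nu>_def \<rho>F)
    qed
    fix q y assume q: "q \<in> carrier P" and y: "y \<in> carrier (F q)"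
    have "([[Inl (p, x), Inl (q, y)]], [[Inl (p \<otimes> q, \<mu> p q (tens (F p) A (F q) x y))]]) \<in> ?E"
      using p x q y unfolding cov_rels_def by blast
    from sat[OF this]
    show "\<nu> p x \<otimes>\<^bsub>D\<^esub> \<nu> q y = \<nu> (p \<otimes> q) (\<mu> p q (tens (F p) A (F q) x y))"
      using p x q y by (simp add: \<nu>_def \<rho>F \<mu>_closed D.m_closed)
  qed
  assume p: "p \<in> carrier P"
  show "rep_coeffs A (F p) D (\<nu> \<one>) (\<nu> p) (\<lambda>\<xi> e. \<rho> (Inr (p, \<xi>, e)))"
    unfolding rep_coeffs_def
  proof (intro ballI allI impI conjI)
    fix e assume e: "e \<in> carrier A" "e \<otimes>\<^bsub>A\<^esub> e = e"
    have e1: "\<rho> (Inl (\<one>, a)) \<in> carrier D" "\<nu> \<one> a = \<rho> (Inl (\<one>, a))" if "a \<in> carrier A" for a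
      using \<rho>F[OF one_closed] that by (simp_all add: \<nu>_def)
    { fix \<xi> assume \<xi>: "\<xi> \<in> functionals A (slice (F p) e)"
      show "\<rho> (Inr (p, \<xi>, e)) \<in> carrier D" by (rule \<rho>t[OF p e \<xi>])
      have "([[Inr (p, \<xi>, e), Inl (\<one>, e)]], [[Inr (p, \<xi>, e)]]) \<in> ?E"
        using p e \<xi> unfolding cov_rels_def by blast
      from sat[OF this] show "\<rho> (Inr (p, \<xi>, e)) \<otimes>\<^bsub>D\<^esub> \<nu> \<one> e = \<rho> (Inr (p, \<xi>, e))"
        using p e \<xi> e1[OF e(1)] by (simp add: \<rho>t D.m_closed)
      fix x assume x: "x \<in> carrier (slice (F p) e)"
      have "([[Inr (p, \<xi>, e), Inl (p, x)]], [[Inl (\<one>, \<xi> x)]]) \<in> ?E"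
        using p e \<xi> x unfolding cov_rels_def by blast
      from sat[OF this] show "\<rho> (Inr (p, \<xi>, e)) \<otimes>\<^bsub>D\<^esub> \<nu> p x = \<nu> \<one> (\<xi> x)"
        using p e \<xi> e1[OF functionalD(1)[OF \<xi> x]] slice_F_subset[OF p e x]
        by (simp add: \<rho>t \<rho>F \<nu>_def D.m_closed)
    }
    fix bs assume bs: "dual_basis A (slice (F p) e) bs"
    have "(map (\<lambda>b. [Inl (p, fst b), Inr (p, snd b, e)]) bs, [[Inl (\<one>, e)]]) \<in> ?E"
      using p e bs unfolding cov_rels_def by blast
    from sat[OF this] have "lsum D (map (\<lambda>b. \<rho> (Inl (p, fst b)) \<otimes>\<^bsub>D\<^esub> \<rho> (Inr (p, snd b, e))) bs) = \<nu> \<one> e"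
      using e1[OF e(1)] by (simp add: o_def)
    moreover have "lsum D (map (\<lambda>b. \<nu> p (fst b) \<otimes>\<^bsub>D\<^esub> \<rho> (Inr (p, snd b, e))) bs) =
        lsum D (map (\<lambda>b. \<rho> (Inl (p, fst b)) \<otimes>\<^bsub>D\<^esub> \<rho> (Inr (p, snd b, e))) bs)"
      using slice_F_subset[OF p e dual_basisD(1)[OF bs]] p by (intro lsum_cong) (simp add: \<nu>_def)
    ultimately show "lsum D (map (\<lambda>b. \<nu> p (fst b) \<otimes>\<^bsub>D\<^esub> \<rho> (Inr (p, snd b, e))) bs) = \<nu> \<one> e" by simp
  qed
qed

definition univ :: "'p \<Rightarrow> 'm \<Rightarrow> ('p, 'm) cov_elt" where
  "univ = (\<lambda>p\<in>carrier P. \<lambda>x\<in>carrier (F p). pres.gen (Inl (p, x)))"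

definition coef :: "'p \<Rightarrow> ('m \<Rightarrow> 'm) \<Rightarrow> 'm \<Rightarrow> ('p, 'm) cov_elt" where
  "coef p \<xi> e = pres.gen (Inr (p, \<xi>, e))"

lemma univ_graded: "graded_rep P A F \<mu> pres.quot univ"
  unfolding univ_def by (rule satisfiesD(1)[OF pres.rng_quot pres.gen_closed pres.satisfies_quot])

lemma coef_coeffs: "p \<in> carrier P \<Longrightarrow> rep_coeffs A (F p) pres.quot (univ \<one>) (univ p) (coef p)"
  using satisfiesD(2)[OF pres.rng_quot pres.gen_closed pres.satisfies_quot]
  unfolding univ_def[symmetric] coef_def[symmetric] .

lemma cov_gens_cases:
  assumes "g \<in> cov_gens P A F"
  obtains (F) p x where "g = Inl (p, x)" "p \<in> carrier P" "x \<in> carrier (F p)"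
  | (t) p \<xi> e where "g = Inr (p, \<xi>, e)" "p \<in> carrier P" "e \<in> carrier A" "e \<otimes>\<^bsub>A\<^esub> e = e"
      "\<xi> \<in> functionals A (slice (F p) e)"
  using assms unfolding cov_gens_def by blast

text \<open>Elements of \<open>F p\<close> have units on both sides, as \<open>F p\<close> is
  smooth. For the scalar of (\<xi>, e), the right unit is a defining relation, and the left one
  comes from its expansion along a dual basis of the slice.\<close>

lemma quot_lu_ring: "lu_ring pres.quot" and univ_nd_hom: "univ \<one> \<in> nd_hom A pres.quot"
proof -
  interpret C: rng pres.quot by (rule pres.rng_quot)
  let ?f = "univ \<one>"
  have f: "?f \<in> rng_hom A pres.quot" by (rule graded_rep_hom[OF univ_graded])
  note fD = rng_homD[OF f]
  have "(\<exists>a\<in>carrier A. ?f a \<otimes>\<^bsub>pres.quot\<^esub> pres.gen g = pres.gen g) \<and>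
      (\<exists>b\<in>carrier A. pres.gen g \<otimes>\<^bsub>pres.quot\<^esub> ?f b = pres.gen g)"
    if "g \<in> cov_gens P A F" for g
    using that
  proof (cases rule: cov_gens_cases)
    case (F p x)
    interpret M: proper_bimodule A "F p" by (rule proper_bimodule_F[OF F(2)])
    have g: "pres.gen g = univ p x" using F by (simp add: univ_def)
    obtain a where a: "a \<in> carrier A" "lact (F p) a x = x" by (rule M.left_unit[OF F(3)])
    obtain b where b: "b \<in> carrier A" "ract (F p) x b = x" by (rule M.right_unit[OF F(3)])
    show ?thesis
      using graded_rep_lact[OF univ_graded F(2) a(1) F(3)] graded_rep_ract[OF univ_graded F(2) b(1) F(3)] a b
      unfolding g by auto
  next
    case (t p \<xi> e)
    interpret N: bimodule_rep A "F p" pres.quot ?f "univ p"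
      by (rule bimodule_rep[OF C.rng_axioms univ_graded t(2)])
    have g: "pres.gen g = coef p \<xi> e" by (simp add: coef_def t(1))
    note T = coef_coeffs[OF t(2)]
    obtain bs where bs: "dual_basis A (slice (F p) e) bs" by (rule N.M.slice_dual_basis[OF t(3,4)])
    have \<xi>b: "\<xi> (fst b) \<in> carrier A" "coef p (snd b) e \<in> carrier pres.quot" if "b \<in> set bs" for b
      using dual_basisD(1,2)[OF bs that] functionalD(1)[OF t(5)] rep_coeffsD(1)[OF T t(3,4)] by auto
    then have "\<exists>c\<in>carrier A. ?f c \<otimes>\<^bsub>pres.quot\<^esub> coef p \<xi> e = coef p \<xi> e"
      unfolding N.rep_coeffs_expand[OF T T t(3,4,5) bs]
      by (intro lsum_left_unit[OF A.lu_ring_axioms C.rng_axioms f])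
    then show ?thesis
      using t(3) rep_coeffsD(2)[OF T t(3,4,5)] unfolding g by blast
  qed
  then show "lu_ring pres.quot" "?f \<in> nd_hom A pres.quot"
    using pres.quot_lu_ring[OF A.lu_ring_axioms f] by blast+
qed

lemma univ_covariant: "univ \<in> covariant_reps P A F \<mu> pres.quot"
  by (rule covariant_repI[OF pres.rng_quot univ_graded univ_nd_hom coef_coeffs])

text \<open>Equal pushed representations mean equal values on all \<open>F p\<close>; the values on
  the scalars follow, both being coefficients for one and the same representation.\<close>

lemma push_univ_inj:
  assumes D: "rng D" and g: "g \<in> rng_hom pres.quot D" and h: "h \<in> rng_hom pres.quot D"
    and eq: "push P F g univ = push P F h univ"
  shows "g = h"
proof (rule pres.quot_hom_eqI[OF D g h])
  fix x assume "x \<in> cov_gens P A F"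
  then show "g (pres.gen x) = h (pres.gen x)"
  proof (cases rule: cov_gens_cases)
    case (F p y)
    then show ?thesis
      using fun_cong[OF fun_cong[OF eq, of p], of y] by (simp add: push_def compose_def univ_def)
  next
    case (t p \<xi> e)
    interpret N: bimodule_rep A "F p" D "push P F g univ \<one>" "push P F g univ p"
      by (rule bimodule_rep[OF D push_graded_rep[OF univ_graded g] t(2)])
    have "univ p \<in> carrier (F p) \<rightarrow> carrier pres.quot" using graded_repD(1)[OF univ_graded t(2)] by blast
    note im = rep_coeffs_image[OF coef_coeffs[OF t(2)] proper_bimodule_F[OF t(2)] pres.rng_quot D
        graded_rep_hom[OF univ_graded] this]
    have "rep_coeffs A (F p) D (push P F k univ \<one>) (push P F k univ p) (\<lambda>\<xi> e. k (coef p \<xi> e))"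
      if "k \<in> rng_hom pres.quot D" for k
      using im[OF that] t(2) by (simp only: push_one) (simp add: push_def)
    from N.rep_coeffs_unique[OF this[OF g] this[OF h, folded eq] t(3,4,5)]
    show ?thesis by (simp add: t(1) coef_def)
  qed
qed

lemma covariance_ring_iff:
  "covariance_ring TYPE('d) P A F \<mu> C \<omega> \<longleftrightarrow> lu_ring C \<and> \<omega> \<in> covariant_reps P A F \<mu> C \<and>
     (\<forall>D :: 'd ring. lu_ring D \<longrightarrow>
        bij_betw (\<lambda>h. push P F h \<omega>) (nd_hom C D) (covariant_reps P A F \<mu> D))"
  unfolding covariance_ring_def push_def ..

theorem covariance_ring_quot: "covariance_ring TYPE('d) P A F \<mu> pres.quot univ"
  unfolding covariance_ring_iff
proof (intro conjI allI impI quot_lu_ring univ_covariant)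
  fix D :: "'d ring"
  assume D: "lu_ring D"
  interpret D: lu_ring D by (rule D)
  show "bij_betw (\<lambda>h. push P F h univ) (nd_hom pres.quot D) (covariant_reps P A F \<mu> D)"
    unfolding bij_betw_def
  proof
    show "inj_on (\<lambda>h. push P F h univ) (nd_hom pres.quot D)"
      by (rule inj_onI) (rule push_univ_inj[OF D.rng_axioms nd_hom_rng_hom nd_hom_rng_hom])
    show "(\<lambda>h. push P F h univ) ` nd_hom pres.quot D = covariant_reps P A F \<mu> D"
    proof
      show "(\<lambda>h. push P F h univ) ` nd_hom pres.quot D \<subseteq> covariant_reps P A F \<mu> D"
        using push_covariant[OF quot_lu_ring D.rng_axioms univ_covariant] by blast
      show "covariant_reps P A F \<mu> D \<subseteq> (\<lambda>h. push P F h univ) ` nd_hom pres.quot D"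
      proof
        fix \<nu> assume \<nu>: "\<nu> \<in> covariant_reps P A F \<mu> D"
        have gr: "graded_rep P A F \<mu> D \<nu>" using \<nu> by (simp add: covariant_reps_iff)
        have "\<forall>p\<in>carrier P. \<exists>t. rep_coeffs A (F p) D (\<nu> \<one>) (\<nu> p) t"
          using covariant_rep_coeffs[OF D.rng_axioms \<nu>] by blast
        from bchoice[OF this] obtain t
          where t: "\<And>p. p \<in> carrier P \<Longrightarrow> rep_coeffs A (F p) D (\<nu> \<one>) (\<nu> p) (t p)" by blast
        \<comment> \<open>The presentation sends elements of \<open>F p\<close> to their values
          under \<nu> and the symbols to the chosen coefficients.\<close>
        obtain h where h: "h \<in> rng_hom pres.quot D"
          "\<And>x. x \<in> cov_gens P A F \<Longrightarrow>
            h (pres.gen x) = case_sum (\<lambda>(p, x). \<nu> p x) (\<lambda>(p, \<xi>, e). t p \<xi> e) x"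
          by (rule pres.quot_universal[OF D.rng_axioms satisfiesI(2,1)[OF D.rng_axioms gr t]]) blast+
        have "push P F h univ = \<nu>"
        proof (intro ext)
          fix p x
          show "push P F h univ p x = \<nu> p x"
          proof (cases "p \<in> carrier P \<and> x \<in> carrier (F p)")
            case True
            then show ?thesis using h(2)[of "Inl (p, x)"] by (simp add: push_def compose_def univ_def gensI)
          next
            case False
            then show ?thesis
              using graded_rep_extensional[OF gr] graded_repD(4)[OF gr, of p]
              by (auto simp: push_def compose_def extensional_def)
          qed
        qed
        \<comment> \<open>Nondegeneracy of h is inherited: its composite with
          \<open>univ \<one>\<close> is \<open>\<nu> \<one>\<close>.\<close>
        moreover have "h \<in> nd_hom pres.quot D"
          using calculation push_one[of h univ]
          by (intro nd_hom_factor[OF A.lu_ring_axioms D.rng_axioms covariant_rep_nd_hom[OF D.rng_axioms \<nu>]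
                h(1) graded_rep_hom[OF univ_graded]]) simp
        ultimately show "\<nu> \<in> (\<lambda>h. push P F h univ) ` nd_hom pres.quot D" by blast
      qed
    qed
  qed
qed

text \<open>The Yoneda argument inside the common type \<open>'c\<close> gives mutually inverse k
  and l. Composition with k is then a bijection for D over \<open>'d\<close> as well; followed by
  the bijection that belongs to \<omega>, it is the map that pushes \<open>\<omega>'\<close>, the
  image of \<omega> under k.\<close>

lemma covariance_ring_transport:
  fixes C :: "'c ring" and C' :: "'c ring"
  assumes Cd: "covariance_ring TYPE('d) P A F \<mu> C \<omega>"
    and C: "covariance_ring TYPE('c) P A F \<mu> C \<omega>" and C': "covariance_ring TYPE('c) P A F \<mu> C' \<omega>'"
  shows "covariance_ring TYPE('d) P A F \<mu> C' \<omega>'"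
proof -
  note C = C[unfolded covariance_ring_iff] and C' = C'[unfolded covariance_ring_iff]
  interpret C: lu_ring C using C by blast
  interpret C': lu_ring C' using C' by blast
  have \<omega>: "\<omega> \<in> covariant_reps P A F \<mu> C" and \<omega>': "\<omega>' \<in> covariant_reps P A F \<mu> C'" using C C' by blast+
  then have gr: "graded_rep P A F \<mu> C \<omega>" and gr': "graded_rep P A F \<mu> C' \<omega>'"
    by (simp_all add: covariant_reps_iff)
  have bij: "bij_betw (\<lambda>h. push P F h \<omega>) (nd_hom C D) (covariant_reps P A F \<mu> D)"
    and bij': "bij_betw (\<lambda>h. push P F h \<omega>') (nd_hom C' D) (covariant_reps P A F \<mu> D)"
    if "lu_ring D" for D :: "'c ring"
    using C C' that by blast+
  obtain k where k: "k \<in> nd_hom C C'" "push P F k \<omega> = \<omega>'"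
    using bij[OF C'.lu_ring_axioms] \<omega>' unfolding bij_betw_def by (metis (no_types, lifting) imageE)
  obtain l where l: "l \<in> nd_hom C' C" "push P F l \<omega>' = \<omega>"
    using bij'[OF C.lu_ring_axioms] \<omega> unfolding bij_betw_def by (metis (no_types, lifting) imageE)
  \<comment> \<open>A nondegenerate endomorphism of C that fixes \<omega> is the identity, by
    injectivity of the universal bijection for the test ring C itself.\<close>
  have "push P F (compose (carrier C) l k) \<omega> = push P F (\<lambda>x\<in>carrier C. x) \<omega>"
    by (simp add: push_compose[OF gr] push_id[OF gr] k l)
  then have lk: "compose (carrier C) l k = (\<lambda>x\<in>carrier C. x)"
    using bij[OF C.lu_ring_axioms] nd_hom_id[OF C.lu_ring_axioms]
      nd_hom_compose[OF C.lu_ring_axioms C'.lu_ring_axioms C.rng_axioms k(1) l(1)]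
    unfolding bij_betw_def by (blast dest: inj_onD)
  have "push P F (compose (carrier C') k l) \<omega>' = push P F (\<lambda>x\<in>carrier C'. x) \<omega>'"
    by (simp add: push_compose[OF gr'] push_id[OF gr'] k l)
  then have kl: "compose (carrier C') k l = (\<lambda>x\<in>carrier C'. x)"
    using bij'[OF C'.lu_ring_axioms] nd_hom_id[OF C'.lu_ring_axioms]
      nd_hom_compose[OF C'.lu_ring_axioms C.lu_ring_axioms C'.rng_axioms l(1) k(1)]
    unfolding bij_betw_def by (blast dest: inj_onD)
  show ?thesis unfolding covariance_ring_iff
  proof (intro conjI allI impI C'.lu_ring_axioms \<omega>')
    fix D :: "'d ring" assume D: "lu_ring D"
    interpret D: lu_ring D by (rule D)
    note k' = nd_hom_rng_hom[OF k(1)] and l' = nd_hom_rng_hom[OF l(1)]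
    have "bij_betw (\<lambda>g. compose (carrier C) g k) (nd_hom C' D) (nd_hom C D)"
    proof (rule bij_betw_byWitness[of _ "\<lambda>g. compose (carrier C') g l"])
      show "\<forall>g\<in>nd_hom C' D. compose (carrier C') (compose (carrier C) g k) l = g"
        by (simp add: compose_rng_hom_assoc[OF l', symmetric] kl compose_restrict_id_right[where B = D, OF nd_hom_rng_hom])
      show "\<forall>g\<in>nd_hom C D. compose (carrier C) (compose (carrier C') g l) k = g"
        by (simp add: compose_rng_hom_assoc[OF k', symmetric] lk compose_restrict_id_right[where B = D, OF nd_hom_rng_hom])
      show "(\<lambda>g. compose (carrier C) g k) ` nd_hom C' D \<subseteq> nd_hom C D"
        using nd_hom_compose[OF C.lu_ring_axioms C'.lu_ring_axioms D.rng_axioms k(1)] by blast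
      show "(\<lambda>g. compose (carrier C') g l) ` nd_hom C D \<subseteq> nd_hom C' D"
        using nd_hom_compose[OF C'.lu_ring_axioms C.lu_ring_axioms D.rng_axioms l(1)] by blast
    qed
    then have "bij_betw ((\<lambda>h. push P F h \<omega>) \<circ> (\<lambda>g. compose (carrier C) g k)) (nd_hom C' D) (covariant_reps P A F \<mu> D)"
      using Cd D by (intro bij_betw_trans) (auto simp: covariance_ring_iff)
    then show "bij_betw (\<lambda>h. push P F h \<omega>') (nd_hom C' D) (covariant_reps P A F \<mu> D)"
      by (simp add: o_def push_compose[OF gr] k(2))
  qed
qed

theorem covariance_ring_cov: "covariance_ring TYPE('d) P A F \<mu> (fst (cov P A F \<mu>)) (snd (cov P A F \<mu>))"
proof -
  have "case cov P A F \<mu> of (C, \<omega>) \<Rightarrow> covariance_ring TYPE(('p, 'm) cov_elt) P A F \<mu> C \<omega>"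
    unfolding cov_def by (rule someI[of _ "(pres.quot, univ)"]) (simp add: covariance_ring_quot)
  then have "covariance_ring TYPE(('p, 'm) cov_elt) P A F \<mu> (fst (cov P A F \<mu>)) (snd (cov P A F \<mu>))"
    by (simp add: case_prod_beta)
  then show ?thesis
    by (rule covariance_ring_transport[OF covariance_ring_quot covariance_ring_quot])
qed

end

text \<open>\<open>'d\<close> occurs neither in \<open>cohn\<close> nor in \<open>cov\<close>, so
  both universal properties hold for test rings over every type. The isomorphism is stated for
  localisations in two types, each tested over both, since either one serves as a test ring for the
  other.\<close>

theorem theorem4p8:
  fixes R :: "'r ring" and I :: "'i set"
    and Ps :: "'i \<Rightarrow> ('r, 'p) rmod" and Qs :: "'i \<Rightarrow> ('r, 'q) rmod"
    and u :: "'i \<Rightarrow> 'p \<Rightarrow> 'q"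
    and P :: "'s monoid" and A :: "'m ring"
    and F :: "'s \<Rightarrow> ('m, 'm, 'm) bimod"
    and \<mu> :: "'s \<Rightarrow> 's \<Rightarrow> ('m \<times> 'm \<Rightarrow>\<^sub>0 int) set \<Rightarrow> 'm"
  shows
    "(lu_ring R \<and>
      (\<forall>i\<in>I. fgp R (Ps i) \<and> fgp R (Qs i) \<and> u i \<in> rmod_hom R (Ps i) (Qs i)) \<longrightarrow>
        cohn_localisation TYPE('d) R I Ps Qs u
          (fst (cohn R I Ps Qs u)) (snd (cohn R I Ps Qs u)) \<and>
        (\<forall>(R1 :: 'a ring) \<phi>1 (R2 :: 'b ring) \<phi>2.
           cohn_localisation TYPE('a) R I Ps Qs u R1 \<phi>1 \<and>
           cohn_localisation TYPE('b) R I Ps Qs u R1 \<phi>1 \<and>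
           cohn_localisation TYPE('a) R I Ps Qs u R2 \<phi>2 \<and>
           cohn_localisation TYPE('b) R I Ps Qs u R2 \<phi>2 \<longrightarrow>
             (\<exists>h\<in>rng_iso R1 R2. compose (carrier R) h \<phi>1 = \<phi>2))) \<and>
     (diagram P A F \<mu> \<longrightarrow>
        covariance_ring TYPE('d) P A F \<mu> (fst (cov P A F \<mu>)) (snd (cov P A F \<mu>)))"
proof (intro conjI impI allI; (elim conjE)?)
  assume "lu_ring R" and "\<forall>i\<in>I. fgp R (Ps i) \<and> fgp R (Qs i) \<and> u i \<in> rmod_hom R (Ps i) (Qs i)"
  then have "cohn_data R I Ps Qs u" by (intro cohn_data.intro cohn_data_axioms.intro) blast+
  then show "cohn_localisation TYPE('d) R I Ps Qs u (fst (cohn R I Ps Qs u)) (snd (cohn R I Ps Qs u))"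
    by (rule cohn_localisation_cohn)
next
  fix R1 :: "'a ring" and \<phi>1 and R2 :: "'b ring" and \<phi>2
  assume R: "lu_ring R"
    and loc: "cohn_localisation TYPE('a) R I Ps Qs u R1 \<phi>1" "cohn_localisation TYPE('b) R I Ps Qs u R1 \<phi>1"
      "cohn_localisation TYPE('a) R I Ps Qs u R2 \<phi>2" "cohn_localisation TYPE('b) R I Ps Qs u R2 \<phi>2"
  obtain k l where "k \<in> nd_hom R1 R2" "l \<in> nd_hom R2 R1" "compose (carrier R) k \<phi>1 = \<phi>2"
    "compose (carrier R1) l k = (\<lambda>x\<in>carrier R1. x)"
    "compose (carrier R2) k l = (\<lambda>x\<in>carrier R2. x)"
    by (rule cohn_localisation_unique[OF R loc])
  then show "\<exists>h\<in>rng_iso R1 R2. compose (carrier R) h \<phi>1 = \<phi>2"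
    by (intro bexI[of _ k] rng_iso_of_inverse[of k R1 R2 l] nd_hom_rng_hom)
next
  assume "diagram P A F \<mu>"
  then show "covariance_ring TYPE('d) P A F \<mu> (fst (cov P A F \<mu>)) (snd (cov P A F \<mu>))"
    by (rule diagram.covariance_ring_cov)
qed

end
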